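(* For each choice of sign $\pm$, one has the equalities of subalgebras of $O_q(B^\pm)$ $$O_q(N^\pm)'=O_q(B^\pm)^{\mathrm{co}\,\eta^\pm}\qquad\text{and}\qquad O_q(N^\pm)=O_q(B^\pm)^{\mathrm{co}\,\theta^\pm}.$$
   Context: $k$ is a field, $q\in k^\times$ is not a root of unity, $\widehat q=q-q^{-1}$, and $n\ge 1$. $O_q(\mathrm{SL}_{n+1})$ is the $k$-algebra generated by $X_{ij}$ ($1\le i,j\le n+1$) with relations (1) $X_{ij}X_{im}=qX_{im}X_{ij}$ for $j<m$; (2) $X_{ij}X_{lj}=qX_{lj}X_{ij}$ for $i<l$; (3) $X_{ij}X_{lm}=X_{lm}X_{ij}$ for $i<l$, $j>m$; (4) $X_{ij}X_{lm}-X_{lm}X_{ij}=\widehat q X_{im}X_{lj}$ for $i<l$, $j<m$; (5) $\sum_{\sigma\in \mathrm{Sym}_{n+1}}(-q)^{\ell(\sigma)}X_{1\sigma(1)}\cdots X_{n+1,\sigma(n+1)}=1$, where $\ell$ is the length function. It is a Hopf algebra with $\Delta(X_{ij})=\sum_{s=1}^{n+1}X_{is}\otimes X_{sj}$ and $\epsilon(X_{ij})=\delta_{ij}$. $O_q(B^+)=O_q(\mathrm{SL}_{n+1})/\langle X_{ij}\mid i>j\rangle$, $O_q(B^-)=O_q(\mathrm{SL}_{n+1})/\langle X_{ij}\mid i<j\rangle$, $O_q(T)=O_q(\mathrm{SL}_{n+1})/\langle X_{ij}\mid i\ne j\rangle$; these are quotients by Hopf ideals, hence Hopf algebras. Cosets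 of $X_{ij}$ in $O_q(B^\pm)$ are again denoted $X_{ij}$; the coset of $X_{ii}$ in $O_q(T)$ is denoted $Y_{ii}$. In $O_q(B^\pm)$ the elements $X_{ii}$ commute with each other and $X_{11}\cdots X_{n+1,n+1}=1$, so each $X_{ii}$ is invertible. $O_q(N^+)$ and $O_q(N^+)'$ are the $k$-subalgebras of $O_q(B^+)$ generated respectively by $\{X_{ii}^{-1}X_{ij}\mid 1\le i<j\le n+1\}$ and by $\{X_{ij}X_{jj}^{-1}\mid 1\le i<j\le n+1\}$. $O_q(N^-)$ and $O_q(N^-)'$ are the $k$-subalgebras of $O_q(B^-)$ generated respectively by $\{X_{jj}^{-1}X_{ji}\mid 1\le i<j\le n+1\}$ and by $\{X_{ji}X_{ii}^{-1}\mid 1\le i<j\le n+1\}$. Let $p^\pm:O_q(B^\pm)\to O_q(T)$ be the projection with $p^\pm(X_{ii})=Y_{ii}$ and $p^\pm(X_{ij})=0$ for $i\neq j$. Define the algebra homomorphisms $\eta^\pm=(\mathrm{id}\otimes p^\pm)\Delta:O_q(B^\pm)\to O_q(B^\pm)\otimes O_q(T)$ and $\theta^\pm=(p^\pm\otimes\mathrm{id})\Delta:O_q(B^\pm)\to O_q(T)\otimes O_q(B^\pm)$, so $\eta^\pm(X_{ij})=X_{ij}\otimes Y_{jj}$ and $\theta^\pm(X_{ij})=Y_{ii}\otimes X_{ij}$. The coinvariants are $O_q(B^\pm)^{\mathrm{co}\,\eta^\pm}=\{x\mid \eta^\pm(x)=x\otimes 1\}$ and $O_q(B^\pm)^{\mathrm{co}\,\theta^\pm}=\{x\mid\theta^\pm(x)=1\otimes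 x\}$. *)

theory Defs
  imports
    "HOL-Algebra.QuotRing"
    "HOL-Algebra.Subrings"
    "HOL-Algebra.Module"
    "HOL-Library.Poly_Mapping"
    "HOL-Combinatorics.Permutations"
begin

section \<open>Associative algebras over a field\<close>

text \<open>The ground field is a type \<open>'k\<close> of class \<open>field\<close>; a \<open>'k\<close>-algebra is a ring together with a
  scalar multiplication, represented by the record type \<open>('k, 'a) module\<close>.  (The locale
  \<open>algebra\<close> of HOL-Algebra only covers commutative algebras, so only its record is used.)\<close>

definition alg_hom :: "('k, 'a) module \<Rightarrow> ('k, 'b) module \<Rightarrow> ('a \<Rightarrow> 'b) set" where
  "alg_hom A B =
     {h \<in> ring_hom A B. \<forall>c. \<forall>x \<in> carrier A. h (c \<odot>\<^bsub>A\<^esub> x) = c \<odot>\<^bsub>B\<^esub> h x}"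

definition is_subalg :: "('k, 'a) module \<Rightarrow> 'a set \<Rightarrow> bool" where
  "is_subalg A S \<longleftrightarrow> subring S A \<and> (\<forall>c. \<forall>x \<in> S. c \<odot>\<^bsub>A\<^esub> x \<in> S)"

definition gen_subalg :: "('k, 'a) module \<Rightarrow> 'a set \<Rightarrow> 'a set" where
  "gen_subalg A G = \<Inter>{S. is_subalg A S \<and> G \<subseteq> S}"

text \<open>The quotient by a two-sided ideal: the library's factor ring, whose elements are cosets,
  with the induced scalar multiplication.\<close>

definition quot_alg :: "('k, 'a) module \<Rightarrow> 'a set \<Rightarrow> ('k, 'a set) module" where
  "quot_alg A J =
     ring.extend (A Quot J) (module.fields (\<lambda>c C. \<Union>x\<in>C. J +>\<^bsub>A\<^esub> (c \<odot>\<^bsub>A\<^esub> x)))"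

text \<open>The monoid algebra of \<open>M\<close>: finitely supported functions on \<open>carrier M\<close>, with the convolution
  product.  The element \<open>m\<close> of \<open>M\<close> becomes \<open>Poly_Mapping.single m 1\<close>.\<close>

definition monoid_alg :: "('m, 'e) monoid_scheme \<Rightarrow> ('k::field, 'm \<Rightarrow>\<^sub>0 'k) module" where
  "monoid_alg M =
     \<lparr>carrier = {f. Poly_Mapping.keys f \<subseteq> carrier M},
      monoid.mult = (\<lambda>f g. \<Sum>a\<in>Poly_Mapping.keys f. \<Sum>b\<in>Poly_Mapping.keys g.
        Poly_Mapping.single (a \<otimes>\<^bsub>M\<^esub> b) (Poly_Mapping.lookup f a * Poly_Mapping.lookup g b)),
      one = Poly_Mapping.single \<one>\<^bsub>M\<^esub> 1,
      zero = 0,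
      add = (+),
      smult = (\<lambda>c f. Poly_Mapping.map (\<lambda>x. c * x) f)\<rparr>"

definition free_monoid :: "'g set \<Rightarrow> 'g list monoid" where
  "free_monoid G = \<lparr>carrier = lists G, monoid.mult = (@), one = []\<rparr>"

definition free_alg :: "'g set \<Rightarrow> ('k::field, 'g list \<Rightarrow>\<^sub>0 'k) module" where
  "free_alg G = monoid_alg (free_monoid G)"

definition free_gen :: "'g \<Rightarrow> 'g list \<Rightarrow>\<^sub>0 'k::field" where
  "free_gen g = Poly_Mapping.single [g] 1"


section \<open>Tensor products of algebras\<close>

text \<open>\<open>A \<otimes> B\<close> is the free vector space on \<open>carrier A \<times> carrier B\<close> modulo the bilinearity relations,
  with \<open>(a \<otimes> b) (a' \<otimes> b') = a a' \<otimes> b b'\<close>.  The free vector space is taken as the monoid algebra of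
  the multiplicative monoid of \<open>A \<times> B\<close>.  Multiplying a bilinearity relation by a basis element
  gives a bilinearity relation again, so the ideal they generate is just their linear span.\<close>

definition bilin_rels ::
    "('k::field, 'a) module \<Rightarrow> ('k, 'b) module \<Rightarrow> ('a \<times> 'b \<Rightarrow>\<^sub>0 'k) set" where
  "bilin_rels A B =
     {Poly_Mapping.single (a \<oplus>\<^bsub>A\<^esub> a', b) 1
        - Poly_Mapping.single (a, b) 1 - Poly_Mapping.single (a', b) 1
      | a a' b. a \<in> carrier A \<and> a' \<in> carrier A \<and> b \<in> carrier B}
   \<union> {Poly_Mapping.single (a, b \<oplus>\<^bsub>B\<^esub> b') 1
        - Poly_Mapping.single (a, b) 1 - Poly_Mapping.single (a, b') 1
      | a b b'. a \<in> carrier A \<and> b \<in> carrier B \<and> b' \<in> carrier B}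
   \<union> {Poly_Mapping.single (c \<odot>\<^bsub>A\<^esub> a, b) 1 - Poly_Mapping.single (a, b) c
      | c a b. a \<in> carrier A \<and> b \<in> carrier B}
   \<union> {Poly_Mapping.single (a, c \<odot>\<^bsub>B\<^esub> b) 1 - Poly_Mapping.single (a, b) c
      | c a b. a \<in> carrier A \<and> b \<in> carrier B}"

definition tensor_ideal ::
    "('k::field, 'a) module \<Rightarrow> ('k, 'b) module \<Rightarrow> ('a \<times> 'b \<Rightarrow>\<^sub>0 'k) set" where
  "tensor_ideal A B = Idl\<^bsub>monoid_alg (A \<times>\<times> B) :: ('k, _) module\<^esub> (bilin_rels A B)"

definition tensor_alg ::
    "('k::field, 'a) module \<Rightarrow> ('k, 'b) module \<Rightarrow> ('k, ('a \<times> 'b \<Rightarrow>\<^sub>0 'k) set) module" where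
  "tensor_alg A B = quot_alg (monoid_alg (A \<times>\<times> B)) (tensor_ideal A B)"

definition tens ::
    "('k::field, 'a) module \<Rightarrow> ('k, 'b) module \<Rightarrow> 'a \<Rightarrow> 'b \<Rightarrow> ('a \<times> 'b \<Rightarrow>\<^sub>0 'k) set" where
  "tens A B a b =
     tensor_ideal A B +>\<^bsub>monoid_alg (A \<times>\<times> B) :: ('k, _) module\<^esub> Poly_Mapping.single (a, b) 1"

text \<open>Here and below, \<open>SOME\<close> picks an algebra homomorphism with prescribed values on generators.
  These conditions determine it on the carrier of its domain, and its values elsewhere are
  irrelevant.\<close>

definition tensor_map ::
    "('k::field, 'a) module \<Rightarrow> ('k, 'b) module \<Rightarrow> ('k, 'c) module \<Rightarrow> ('k, 'd) module \<Rightarrow>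
     ('a \<Rightarrow> 'c) \<Rightarrow> ('b \<Rightarrow> 'd) \<Rightarrow> ('a \<times> 'b \<Rightarrow>\<^sub>0 'k) set \<Rightarrow> ('c \<times> 'd \<Rightarrow>\<^sub>0 'k) set" where
  "tensor_map A B C D f g =
     (SOME h. h \<in> alg_hom (tensor_alg A B) (tensor_alg C D) \<and>
        (\<forall>a \<in> carrier A. \<forall>b \<in> carrier B. h (tens A B a b) = tens C D (f a) (g b)))"


section \<open>Quantized coordinate rings\<close>

text \<open>Indices run over \<open>{1..n+1}\<close>, and \<open>n\<close> is the rank, so that \<open>OqSL n q\<close> is the quantized coordinate
  ring of the special linear group of size \<open>n + 1\<close>.\<close>

abbreviation idx :: "nat \<Rightarrow> nat set" where
  "idx n \<equiv> {1..n + 1}"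

definition OqFree :: "nat \<Rightarrow> ('k::field, (nat \<times> nat) list \<Rightarrow>\<^sub>0 'k) module" where
  "OqFree n = free_alg (idx n \<times> idx n)"

definition perm_length :: "nat \<Rightarrow> (nat \<Rightarrow> nat) \<Rightarrow> nat" where
  "perm_length n \<sigma> = card {(i, j). i \<in> idx n \<and> j \<in> idx n \<and> i < j \<and> \<sigma> j < \<sigma> i}"

definition qdet :: "nat \<Rightarrow> 'k::field \<Rightarrow> (nat \<times> nat) list \<Rightarrow>\<^sub>0 'k" where
  "qdet n q = (let F = OqFree n in
     \<Oplus>\<^bsub>F\<^esub>\<sigma> \<in> {\<sigma>. \<sigma> permutes idx n}.
       (- q) ^ perm_length n \<sigma> \<odot>\<^bsub>F\<^esub>
         foldr (\<lambda>i y. free_gen (i, \<sigma> i) \<otimes>\<^bsub>F\<^esub> y) [1..<n + 2] \<one>\<^bsub>F\<^esub>)"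

definition qrels :: "nat \<Rightarrow> 'k::field \<Rightarrow> ((nat \<times> nat) list \<Rightarrow>\<^sub>0 'k) set" where
  "qrels n q = (let F = OqFree n; X = (\<lambda>i j. free_gen (i, j)) in
     {X i j \<otimes>\<^bsub>F\<^esub> X i m \<ominus>\<^bsub>F\<^esub> q \<odot>\<^bsub>F\<^esub> (X i m \<otimes>\<^bsub>F\<^esub> X i j)
      | i j m. {i, j, m} \<subseteq> idx n \<and> j < m}
   \<union> {X i j \<otimes>\<^bsub>F\<^esub> X l j \<ominus>\<^bsub>F\<^esub> q \<odot>\<^bsub>F\<^esub> (X l j \<otimes>\<^bsub>F\<^esub> X i j)
      | i j l. {i, j, l} \<subseteq> idx n \<and> i < l}
   \<union> {X i j \<otimes>\<^bsub>F\<^esub> X l m \<ominus>\<^bsub>F\<^esub> X l m \<otimes>\<^bsub>F\<^esub> X i j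
      | i j l m. {i, j, l, m} \<subseteq> idx n \<and> i < l \<and> j > m}
   \<union> {(X i j \<otimes>\<^bsub>F\<^esub> X l m \<ominus>\<^bsub>F\<^esub> X l m \<otimes>\<^bsub>F\<^esub> X i j)
        \<ominus>\<^bsub>F\<^esub> (q - inverse q) \<odot>\<^bsub>F\<^esub> (X i m \<otimes>\<^bsub>F\<^esub> X l j)
      | i j l m. {i, j, l, m} \<subseteq> idx n \<and> i < l \<and> j < m}
   \<union> {qdet n q \<ominus>\<^bsub>F\<^esub> \<one>\<^bsub>F\<^esub>})"

definition SL_ideal :: "nat \<Rightarrow> 'k::field \<Rightarrow> ((nat \<times> nat) list \<Rightarrow>\<^sub>0 'k) set" where
  "SL_ideal n q = Idl\<^bsub>OqFree n :: ('k, _) module\<^esub> (qrels n q)"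

definition OqSL :: "nat \<Rightarrow> 'k::field \<Rightarrow> ('k, ((nat \<times> nat) list \<Rightarrow>\<^sub>0 'k) set) module" where
  "OqSL n q = quot_alg (OqFree n) (SL_ideal n q)"

definition XSL :: "nat \<Rightarrow> 'k::field \<Rightarrow> nat \<Rightarrow> nat \<Rightarrow> ((nat \<times> nat) list \<Rightarrow>\<^sub>0 'k) set" where
  "XSL n q i j = SL_ideal n q +>\<^bsub>OqFree n :: ('k, _) module\<^esub> free_gen (i, j)"

definition comultSL :: "nat \<Rightarrow> 'k::field \<Rightarrow> ((nat \<times> nat) list \<Rightarrow>\<^sub>0 'k) set \<Rightarrow>
    ((((nat \<times> nat) list \<Rightarrow>\<^sub>0 'k) set \<times> ((nat \<times> nat) list \<Rightarrow>\<^sub>0 'k) set) \<Rightarrow>\<^sub>0 'k) set" where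
  "comultSL n q = (let A = OqSL n q in
     SOME h. h \<in> alg_hom A (tensor_alg A A) \<and>
       (\<forall>i \<in> idx n. \<forall>j \<in> idx n. h (XSL n q i j) =
          (\<Oplus>\<^bsub>tensor_alg A A\<^esub>r \<in> idx n. tens A A (XSL n q i r) (XSL n q r j))))"


section \<open>Borel and torus quotients\<close>

datatype pm = PlusSign | MinusSign

text \<open>\<open>zero_pos s\<close> holds of the positions \<open>(i, j)\<close> at which \<open>X i j\<close> is killed in the Borel quotient
  of sign \<open>s\<close>.\<close>

fun zero_pos :: "pm \<Rightarrow> nat \<Rightarrow> nat \<Rightarrow> bool" where
  "zero_pos PlusSign i j \<longleftrightarrow> i > j"
| "zero_pos MinusSign i j \<longleftrightarrow> i < j"

definition B_ideal :: "nat \<Rightarrow> 'k::field \<Rightarrow> pm \<Rightarrow> ((nat \<times> nat) list \<Rightarrow>\<^sub>0 'k) set set" where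
  "B_ideal n q s =
     Idl\<^bsub>OqSL n q\<^esub> {XSL n q i j | i j. i \<in> idx n \<and> j \<in> idx n \<and> zero_pos s i j}"

definition OqB :: "nat \<Rightarrow> 'k::field \<Rightarrow> pm \<Rightarrow> ('k, ((nat \<times> nat) list \<Rightarrow>\<^sub>0 'k) set set) module" where
  "OqB n q s = quot_alg (OqSL n q) (B_ideal n q s)"

definition projB :: "nat \<Rightarrow> 'k::field \<Rightarrow> pm \<Rightarrow>
    ((nat \<times> nat) list \<Rightarrow>\<^sub>0 'k) set \<Rightarrow> ((nat \<times> nat) list \<Rightarrow>\<^sub>0 'k) set set" where
  "projB n q s x = B_ideal n q s +>\<^bsub>OqSL n q\<^esub> x"

definition XB :: "nat \<Rightarrow> 'k::field \<Rightarrow> pm \<Rightarrow> nat \<Rightarrow> nat \<Rightarrow> ((nat \<times> nat) list \<Rightarrow>\<^sub>0 'k) set set" where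
  "XB n q s i j = projB n q s (XSL n q i j)"

definition T_ideal :: "nat \<Rightarrow> 'k::field \<Rightarrow> ((nat \<times> nat) list \<Rightarrow>\<^sub>0 'k) set set" where
  "T_ideal n q =
     Idl\<^bsub>OqSL n q\<^esub> {XSL n q i j | i j. i \<in> idx n \<and> j \<in> idx n \<and> i \<noteq> j}"

definition OqT :: "nat \<Rightarrow> 'k::field \<Rightarrow> ('k, ((nat \<times> nat) list \<Rightarrow>\<^sub>0 'k) set set) module" where
  "OqT n q = quot_alg (OqSL n q) (T_ideal n q)"

definition YT :: "nat \<Rightarrow> 'k::field \<Rightarrow> nat \<Rightarrow> ((nat \<times> nat) list \<Rightarrow>\<^sub>0 'k) set set" where
  "YT n q i = T_ideal n q +>\<^bsub>OqSL n q\<^esub> XSL n q i i"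

text \<open>The comultiplication of the quotient Hopf algebra is the one induced from \<open>OqSL n q\<close>.\<close>

definition comultB :: "nat \<Rightarrow> 'k::field \<Rightarrow> pm \<Rightarrow> ((nat \<times> nat) list \<Rightarrow>\<^sub>0 'k) set set \<Rightarrow>
    ((((nat \<times> nat) list \<Rightarrow>\<^sub>0 'k) set set \<times> ((nat \<times> nat) list \<Rightarrow>\<^sub>0 'k) set set) \<Rightarrow>\<^sub>0 'k) set" where
  "comultB n q s = (let A = OqSL n q; B = OqB n q s; \<pi> = projB n q s in
     SOME h. h \<in> alg_hom B (tensor_alg B B) \<and>
       (\<forall>x \<in> carrier A. h (\<pi> x) = tensor_map A A B B \<pi> \<pi> (comultSL n q x)))"

definition projBT :: "nat \<Rightarrow> 'k::field \<Rightarrow> pm \<Rightarrow>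
    ((nat \<times> nat) list \<Rightarrow>\<^sub>0 'k) set set \<Rightarrow> ((nat \<times> nat) list \<Rightarrow>\<^sub>0 'k) set set" where
  "projBT n q s = (SOME h. h \<in> alg_hom (OqB n q s) (OqT n q) \<and>
     (\<forall>i \<in> idx n. h (XB n q s i i) = YT n q i) \<and>
     (\<forall>i \<in> idx n. \<forall>j \<in> idx n. i \<noteq> j \<longrightarrow> h (XB n q s i j) = \<zero>\<^bsub>OqT n q\<^esub>))"

definition eta :: "nat \<Rightarrow> 'k::field \<Rightarrow> pm \<Rightarrow> ((nat \<times> nat) list \<Rightarrow>\<^sub>0 'k) set set \<Rightarrow>
    ((((nat \<times> nat) list \<Rightarrow>\<^sub>0 'k) set set \<times> ((nat \<times> nat) list \<Rightarrow>\<^sub>0 'k) set set) \<Rightarrow>\<^sub>0 'k) set" where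
  "eta n q s = (let B = OqB n q s; T = OqT n q in
     tensor_map B B B T id (projBT n q s) \<circ> comultB n q s)"

definition theta :: "nat \<Rightarrow> 'k::field \<Rightarrow> pm \<Rightarrow> ((nat \<times> nat) list \<Rightarrow>\<^sub>0 'k) set set \<Rightarrow>
    ((((nat \<times> nat) list \<Rightarrow>\<^sub>0 'k) set set \<times> ((nat \<times> nat) list \<Rightarrow>\<^sub>0 'k) set set) \<Rightarrow>\<^sub>0 'k) set" where
  "theta n q s = (let B = OqB n q s; T = OqT n q in
     tensor_map B B T B (projBT n q s) id \<circ> comultB n q s)"

definition coinv_eta :: "nat \<Rightarrow> 'k::field \<Rightarrow> pm \<Rightarrow> ((nat \<times> nat) list \<Rightarrow>\<^sub>0 'k) set set set" where
  "coinv_eta n q s = (let B = OqB n q s; T = OqT n q in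
     {x \<in> carrier B. eta n q s x = tens B T x \<one>\<^bsub>T\<^esub>})"

definition coinv_theta :: "nat \<Rightarrow> 'k::field \<Rightarrow> pm \<Rightarrow> ((nat \<times> nat) list \<Rightarrow>\<^sub>0 'k) set set set" where
  "coinv_theta n q s = (let B = OqB n q s; T = OqT n q in
     {x \<in> carrier B. theta n q s x = tens T B \<one>\<^bsub>T\<^esub> x})"


section \<open>Unipotent subalgebras\<close>

fun OqN_gens :: "nat \<Rightarrow> 'k::field \<Rightarrow> pm \<Rightarrow> ((nat \<times> nat) list \<Rightarrow>\<^sub>0 'k) set set set" where
  "OqN_gens n q PlusSign = (let B = OqB n q PlusSign; X = XB n q PlusSign in
     {inv\<^bsub>B\<^esub> (X i i) \<otimes>\<^bsub>B\<^esub> X i j | i j. 1 \<le> i \<and> i < j \<and> j \<le> n + 1})"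
| "OqN_gens n q MinusSign = (let B = OqB n q MinusSign; X = XB n q MinusSign in
     {inv\<^bsub>B\<^esub> (X j j) \<otimes>\<^bsub>B\<^esub> X j i | i j. 1 \<le> i \<and> i < j \<and> j \<le> n + 1})"

fun OqN'_gens :: "nat \<Rightarrow> 'k::field \<Rightarrow> pm \<Rightarrow> ((nat \<times> nat) list \<Rightarrow>\<^sub>0 'k) set set set" where
  "OqN'_gens n q PlusSign = (let B = OqB n q PlusSign; X = XB n q PlusSign in
     {X i j \<otimes>\<^bsub>B\<^esub> inv\<^bsub>B\<^esub> (X j j) | i j. 1 \<le> i \<and> i < j \<and> j \<le> n + 1})"
| "OqN'_gens n q MinusSign = (let B = OqB n q MinusSign; X = XB n q MinusSign in
     {X j i \<otimes>\<^bsub>B\<^esub> inv\<^bsub>B\<^esub> (X i i) | i j. 1 \<le> i \<and> i < j \<and> j \<le> n + 1})"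

definition OqN :: "nat \<Rightarrow> 'k::field \<Rightarrow> pm \<Rightarrow> ((nat \<times> nat) list \<Rightarrow>\<^sub>0 'k) set set set" where
  "OqN n q s = gen_subalg (OqB n q s) (OqN_gens n q s)"

definition OqN' :: "nat \<Rightarrow> 'k::field \<Rightarrow> pm \<Rightarrow> ((nat \<times> nat) list \<Rightarrow>\<^sub>0 'k) set set set" where
  "OqN' n q s = gen_subalg (OqB n q s) (OqN'_gens n q s)"

end

theory Submission
  imports Defs "HOL-Combinatorics.Multiset_Permutations"
begin

text \<open>In \<open>B = O\<^sub>q(B\<^sup>\<plusminus>)\<close> the diagonal generators commute with every generator up to a scalar, so each
  word in the generators is \<open>a t\<close> with \<open>a\<close> in the unipotent subalgebra \<open>N\<close> and \<open>t\<close> a monomial in the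
  diagonal generators.  Elements of \<open>N\<close> are coinvariant, and the coaction sends \<open>t\<close> to \<open>t\<close> tensored
  with its image in the torus.  Composing the coaction with the functional \<open>f\<close> on the torus that
  reads off the coefficient of the trivial monomial therefore gives a linear map \<open>P\<close> with
  \<open>P (a t) = a\<close> if \<open>t = 1\<close> and \<open>P (a t) = 0\<close> otherwise.  So \<open>P\<close> maps \<open>B\<close> into \<open>N\<close>, and it fixes the
  coinvariants.

  All the structure maps are defined by choice, so their existence has to be shown.  The only
  serious point is the comultiplication: the relations of a quantum matrix say that \<open>X \<otimes> X\<close> commutes
  with an \<open>R\<close>-matrix, and the quantum determinant is multiplicative because it is antisymmetric, up
  to factors \<open>- q\<close>, in adjacent rows.\<close>

section \<open>Algebras, linear maps and algebra homomorphisms\<close>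

text \<open>A word may be written as \<open>a t\<close> in several ways, so \<open>P\<close> is not
  defined through such a decomposition: it is the coaction followed by the contraction of
  \<open>b \<otimes> t\<close> to \<open>f t\<close> times \<open>b\<close>, and words only serve to
  compute its values. The obstacle is that \<open>f\<close> and the contraction are linear but not
  multiplicative, while the quantized rings, the torus and the tensor products are quotients by
  generated two-sided ideals. Killing the generators \<open>r\<close> does not suffice; all products
  \<open>u r v\<close> have to be killed. In a monoid algebra \<open>u\<close> and \<open>v\<close>
  may be taken to be monoid elements. Between such elements a bilinearity relation stays a
  bilinearity relation. A relation of the quantized ring, sandwiched between two words, yields words
  with off-diagonal letters, reorderings of one word, or the insertion of one full run of diagonal
  letters, and the functional respects all three. Maps given by choice enter only through their
  specifications, that is, through values on generators, on cosets or on pure tensors. Both signs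
  are treated at once through \<open>zero_pos\<close>.\<close>

locale kalgebra = ring A for A :: "('k::field, 'a) module" (structure) +
  assumes smult_closed [simp, intro]: "x \<in> carrier A \<Longrightarrow> c \<odot> x \<in> carrier A"
    and smult_l_distr: "x \<in> carrier A \<Longrightarrow> (c + d) \<odot> x = c \<odot> x \<oplus> d \<odot> x"
    and smult_r_distr: "x \<in> carrier A \<Longrightarrow> y \<in> carrier A \<Longrightarrow> c \<odot> (x \<oplus> y) = c \<odot> x \<oplus> c \<odot> y"
    and smult_assoc: "x \<in> carrier A \<Longrightarrow> c \<odot> (d \<odot> x) = (c * d) \<odot> x"
    and smult_one [simp]: "x \<in> carrier A \<Longrightarrow> 1 \<odot> x = x"
    and smult_mult_l: "x \<in> carrier A \<Longrightarrow> y \<in> carrier A \<Longrightarrow> (c \<odot> x) \<otimes> y = c \<odot> (x \<otimes> y)"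
    and smult_mult_r: "x \<in> carrier A \<Longrightarrow> y \<in> carrier A \<Longrightarrow> x \<otimes> (c \<odot> y) = c \<odot> (x \<otimes> y)"
begin

lemma smult_zero_left [simp]: "x \<in> carrier A \<Longrightarrow> 0 \<odot> x = \<zero>"
  using smult_l_distr[of x 0 0] by (metis add.l_cancel_one add_0 smult_closed)

lemma smult_zero_right [simp]: "c \<odot> \<zero> = \<zero>"
  using smult_r_distr[of \<zero> \<zero> c] by (metis add.l_cancel_one l_zero smult_closed zero_closed)

lemma smult_minus_left: "x \<in> carrier A \<Longrightarrow> (- c) \<odot> x = \<ominus> (c \<odot> x)"
  using smult_l_distr[of x "- c" c] by (simp add: minus_equality)

lemma smult_finsum:
  "f \<in> I \<rightarrow> carrier A \<Longrightarrow> c \<odot> (\<Oplus>i\<in>I. f i) = (\<Oplus>i\<in>I. c \<odot> f i)"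
proof (induction I rule: infinite_finite_induct)
  case (insert x F)
  then have "f x \<in> carrier A" "f \<in> F \<rightarrow> carrier A" by auto
  moreover have "(\<lambda>i. c \<odot> f i) \<in> F \<rightarrow> carrier A" using \<open>f \<in> F \<rightarrow> carrier A\<close> by auto
  ultimately show ?case using insert by (simp add: smult_r_distr)
qed auto

end

text \<open>Kept beside \<open>alg_hom\<close> because the functional on the torus and the
  projection built from it are linear without being multiplicative.\<close>

definition lin_map :: "('k, 'a) module \<Rightarrow> ('k, 'b) module \<Rightarrow> ('a \<Rightarrow> 'b) set" where
  "lin_map A B = {h. h \<in> carrier A \<rightarrow> carrier B \<and>
     (\<forall>x\<in>carrier A. \<forall>y\<in>carrier A. h (x \<oplus>\<^bsub>A\<^esub> y) = h x \<oplus>\<^bsub>B\<^esub> h y) \<and>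
     (\<forall>c. \<forall>x\<in>carrier A. h (c \<odot>\<^bsub>A\<^esub> x) = c \<odot>\<^bsub>B\<^esub> h x)}"

lemma lin_mapI:
  assumes "\<And>x. x \<in> carrier A \<Longrightarrow> h x \<in> carrier B"
    and "\<And>x y. x \<in> carrier A \<Longrightarrow> y \<in> carrier A \<Longrightarrow> h (x \<oplus>\<^bsub>A\<^esub> y) = h x \<oplus>\<^bsub>B\<^esub> h y"
    and "\<And>c x. x \<in> carrier A \<Longrightarrow> h (c \<odot>\<^bsub>A\<^esub> x) = c \<odot>\<^bsub>B\<^esub> h x"
  shows "h \<in> lin_map A B"
  using assms by (auto simp: lin_map_def)

lemma lin_map_closed: "h \<in> lin_map A B \<Longrightarrow> x \<in> carrier A \<Longrightarrow> h x \<in> carrier B"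
  and lin_map_add: "h \<in> lin_map A B \<Longrightarrow> x \<in> carrier A \<Longrightarrow> y \<in> carrier A \<Longrightarrow>
    h (x \<oplus>\<^bsub>A\<^esub> y) = h x \<oplus>\<^bsub>B\<^esub> h y"
  and lin_map_smult: "h \<in> lin_map A B \<Longrightarrow> x \<in> carrier A \<Longrightarrow> h (c \<odot>\<^bsub>A\<^esub> x) = c \<odot>\<^bsub>B\<^esub> h x"
  by (auto simp: lin_map_def)

lemma lin_map_zero:
  assumes "kalgebra A" "kalgebra B" "h \<in> lin_map A B"
  shows "h \<zero>\<^bsub>A\<^esub> = \<zero>\<^bsub>B\<^esub>"
proof -
  interpret A: kalgebra A by fact
  interpret B: kalgebra B by fact
  have "h \<zero>\<^bsub>A\<^esub> = h (0 \<odot>\<^bsub>A\<^esub> \<zero>\<^bsub>A\<^esub>)" by simp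
  also have "\<dots> = 0 \<odot>\<^bsub>B\<^esub> h \<zero>\<^bsub>A\<^esub>" by (rule lin_map_smult[OF assms(3)]) simp
  also have "\<dots> = \<zero>\<^bsub>B\<^esub>" using lin_map_closed[OF assms(3)] by simp
  finally show ?thesis .
qed

lemma lin_map_minus:
  assumes "kalgebra A" "kalgebra B" "h \<in> lin_map A B" "x \<in> carrier A" "y \<in> carrier A"
  shows "h (x \<ominus>\<^bsub>A\<^esub> y) = h x \<ominus>\<^bsub>B\<^esub> h y"
proof -
  interpret A: kalgebra A by fact
  interpret B: kalgebra B by fact
  have hc: "h x \<in> carrier B" "h y \<in> carrier B" using lin_map_closed assms by metis+
  have "h (x \<ominus>\<^bsub>A\<^esub> y) = h (x \<oplus>\<^bsub>A\<^esub> (- 1) \<odot>\<^bsub>A\<^esub> y)"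
    using assms by (simp add: A.minus_eq A.smult_minus_left)
  also have "\<dots> = h x \<ominus>\<^bsub>B\<^esub> h y"
    using assms hc by (simp add: lin_map_add[OF assms(3)] lin_map_smult[OF assms(3)] B.minus_eq B.smult_minus_left)
  finally show ?thesis .
qed

lemma lin_map_finsum:
  assumes "kalgebra A" "kalgebra B" "h \<in> lin_map A B" "f \<in> I \<rightarrow> carrier A"
  shows "h (\<Oplus>\<^bsub>A\<^esub>i\<in>I. f i) = (\<Oplus>\<^bsub>B\<^esub>i\<in>I. h (f i))"
proof -
  interpret A: kalgebra A by fact
  interpret B: kalgebra B by fact
  show ?thesis using assms(4)
  proof (induction I rule: infinite_finite_induct)
    case (insert x F)
    then have "f x \<in> carrier A" "f \<in> F \<rightarrow> carrier A" by auto
    moreover have "(\<lambda>i. h (f i)) \<in> F \<rightarrow> carrier B"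
      using \<open>f \<in> F \<rightarrow> carrier A\<close> lin_map_closed[OF assms(3)] by auto
    ultimately show ?case
      using insert lin_map_closed[OF assms(3)] by (simp add: lin_map_add[OF assms(3)])
  qed (auto simp: lin_map_zero[OF assms(1-3)])
qed

lemma lin_map_comp: "g \<in> lin_map B C \<Longrightarrow> h \<in> lin_map A B \<Longrightarrow> g \<circ> h \<in> lin_map A C"
  by (auto simp: lin_map_def Pi_iff)

lemma alg_homI:
  assumes "\<And>x. x \<in> carrier A \<Longrightarrow> h x \<in> carrier B"
    and "\<And>x y. x \<in> carrier A \<Longrightarrow> y \<in> carrier A \<Longrightarrow> h (x \<otimes>\<^bsub>A\<^esub> y) = h x \<otimes>\<^bsub>B\<^esub> h y"
    and "\<And>x y. x \<in> carrier A \<Longrightarrow> y \<in> carrier A \<Longrightarrow> h (x \<oplus>\<^bsub>A\<^esub> y) = h x \<oplus>\<^bsub>B\<^esub> h y"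
    and "h \<one>\<^bsub>A\<^esub> = \<one>\<^bsub>B\<^esub>"
    and "\<And>c x. x \<in> carrier A \<Longrightarrow> h (c \<odot>\<^bsub>A\<^esub> x) = c \<odot>\<^bsub>B\<^esub> h x"
  shows "h \<in> alg_hom A B"
  using assms by (auto simp: alg_hom_def ring_hom_def)

lemma alg_hom_lin_map: "h \<in> alg_hom A B \<Longrightarrow> h \<in> lin_map A B"
  by (auto simp: alg_hom_def ring_hom_def lin_map_def)

lemma alg_hom_closed: "h \<in> alg_hom A B \<Longrightarrow> x \<in> carrier A \<Longrightarrow> h x \<in> carrier B"
  and alg_hom_mult: "h \<in> alg_hom A B \<Longrightarrow> x \<in> carrier A \<Longrightarrow> y \<in> carrier A \<Longrightarrow>
    h (x \<otimes>\<^bsub>A\<^esub> y) = h x \<otimes>\<^bsub>B\<^esub> h y"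
  and alg_hom_add: "h \<in> alg_hom A B \<Longrightarrow> x \<in> carrier A \<Longrightarrow> y \<in> carrier A \<Longrightarrow>
    h (x \<oplus>\<^bsub>A\<^esub> y) = h x \<oplus>\<^bsub>B\<^esub> h y"
  and alg_hom_one: "h \<in> alg_hom A B \<Longrightarrow> h \<one>\<^bsub>A\<^esub> = \<one>\<^bsub>B\<^esub>"
  and alg_hom_smult: "h \<in> alg_hom A B \<Longrightarrow> x \<in> carrier A \<Longrightarrow> h (c \<odot>\<^bsub>A\<^esub> x) = c \<odot>\<^bsub>B\<^esub> h x"
  by (auto simp: alg_hom_def ring_hom_def)

lemma alg_hom_comp: "g \<in> alg_hom B C \<Longrightarrow> h \<in> alg_hom A B \<Longrightarrow> g \<circ> h \<in> alg_hom A C"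
  by (auto simp: alg_hom_def ring_hom_def Pi_iff)

lemma id_alg_hom: "id \<in> alg_hom A A"
  by (auto simp: alg_hom_def ring_hom_def)

lemma alg_hom_kernel_ideal:
  assumes "kalgebra A" "kalgebra B" "h \<in> alg_hom A B"
  shows "ideal {x \<in> carrier A. h x = \<zero>\<^bsub>B\<^esub>} A"
proof -
  interpret A: kalgebra A by fact
  interpret B: kalgebra B by fact
  note h = assms(3)
  interpret ring_hom_ring A B h
    using h by (intro ring_hom_ringI2 A.ring_axioms B.ring_axioms) (simp add: alg_hom_def)
  show ?thesis by (rule kernel_is_ideal[unfolded a_kernel_def'])
qed

text \<open>The kernel is a two-sided ideal containing \<open>R\<close>, so minimality of the
  generated ideal applies.\<close>

lemma alg_hom_kills_genideal:
  assumes "kalgebra A" "kalgebra B" "h \<in> alg_hom A B" "R \<subseteq> carrier A"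
    and "\<And>r. r \<in> R \<Longrightarrow> h r = \<zero>\<^bsub>B\<^esub>" "x \<in> Idl\<^bsub>A\<^esub> R"
  shows "h x = \<zero>\<^bsub>B\<^esub>"
proof -
  interpret A: kalgebra A by fact
  have "Idl\<^bsub>A\<^esub> R \<subseteq> {x \<in> carrier A. h x = \<zero>\<^bsub>B\<^esub>}"
    using assms by (intro A.genideal_minimal alg_hom_kernel_ideal) auto
  then show ?thesis using assms by auto
qed


section \<open>Monoid algebras\<close>

abbreviation single where "single \<equiv> Poly_Mapping.single"
abbreviation keys where "keys \<equiv> Poly_Mapping.keys"
abbreviation lookup where "lookup \<equiv> Poly_Mapping.lookup"

text \<open>Linearity in the form of an induction rule: statements about monoid algebras are reduced
  to multiples of basis elements.\<close>

lemma keys_induct [consumes 1, case_names zero single add]: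
  assumes "keys f \<subseteq> S"
    and zero: "P 0"
    and single: "\<And>a c. a \<in> S \<Longrightarrow> P (single a c)"
    and add: "\<And>f g. keys f \<subseteq> S \<Longrightarrow> keys g \<subseteq> S \<Longrightarrow> P f \<Longrightarrow> P g \<Longrightarrow> P (f + g)"
  shows "P f"
  using assms(1)
proof (induction f rule: update_induct)
  case const
  then show ?case using zero by simp
next
  case (update f a b)
  \<comment> \<open>The induction only updates at a key outside the support, so updating amounts to
    adding a multiple of a basis element.\<close>
  have eq: "Poly_Mapping.update a b f = f + single a b"
    using update by (intro poly_mapping_eqI) (auto simp: lookup_update lookup_add lookup_single when_def in_keys_iff)
  have "keys (Poly_Mapping.update a b f) = insert a (keys f)"
    using update by (auto simp: in_keys_iff lookup_update split: if_splits)
  then have "a \<in> S" "keys f \<subseteq> S" using update by auto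
  then show ?case unfolding eq using update by (intro add single) auto
qed

lemma keys_add_subset:
  "keys f \<subseteq> S \<Longrightarrow> keys g \<subseteq> S \<Longrightarrow> keys (f + g) \<subseteq> S"
  using keys_add[of f g] by blast

lemma lookup_scale [simp]:
  "lookup (Poly_Mapping.map (\<lambda>x. c * x) f) a = (c::'k::field) * lookup f a"
  by (simp add: map.rep_eq when_def)

lemma scale_single [simp]:
  "Poly_Mapping.map (\<lambda>x. c * x) (single a d) = single a ((c::'k::field) * d)"
  by (rule poly_mapping_eqI) (simp add: lookup_single when_def)

lemma scale_zero [simp]: "Poly_Mapping.map (\<lambda>x. (c::'k::field) * x) 0 = 0"
  by (rule poly_mapping_eqI) simp

lemma scale_add:
  "Poly_Mapping.map (\<lambda>x. c * x) (f + g) =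
    Poly_Mapping.map (\<lambda>x. c * x) f + Poly_Mapping.map (\<lambda>x. (c::'k::field) * x) g"
  by (rule poly_mapping_eqI) (simp add: lookup_add distrib_left)

lemma keys_scale: "keys (Poly_Mapping.map (\<lambda>x. (c::'k::field) * x) f) \<subseteq> keys f"
  by (auto simp: in_keys_iff)

lemma monoid_alg_simps [simp]:
  fixes M :: "('m, 'e) monoid_scheme"
  shows "carrier (monoid_alg M :: ('k::field, 'm \<Rightarrow>\<^sub>0 'k) module) = {f. keys f \<subseteq> carrier M}"
    and "(\<oplus>\<^bsub>monoid_alg M :: ('k::field, 'm \<Rightarrow>\<^sub>0 'k) module\<^esub>) = (+)"
    and "\<zero>\<^bsub>monoid_alg M :: ('k::field, 'm \<Rightarrow>\<^sub>0 'k) module\<^esub> = 0"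
    and "\<one>\<^bsub>monoid_alg M :: ('k::field, 'm \<Rightarrow>\<^sub>0 'k) module\<^esub> = single \<one>\<^bsub>M\<^esub> 1"
    and "(\<odot>\<^bsub>monoid_alg M :: ('k::field, 'm \<Rightarrow>\<^sub>0 'k) module\<^esub>) = (\<lambda>c f. Poly_Mapping.map (\<lambda>x. c * x) f)"
  by (simp_all add: monoid_alg_def)

context
  fixes M :: "('m, 'e) monoid_scheme" and A :: "('k::field, 'm \<Rightarrow>\<^sub>0 'k) module"
  defines "A \<equiv> monoid_alg M"
begin

text \<open>The defining sum runs over the supports, which change under addition. Fixed larger index
  sets add only zero terms and make bilinearity visible.\<close>

lemma monoid_alg_mult_superset:
  assumes "finite S" "finite T" "keys f \<subseteq> S" "keys g \<subseteq> T"
  shows "f \<otimes>\<^bsub>A\<^esub> g = (\<Sum>a\<in>S. \<Sum>b\<in>T. single (a \<otimes>\<^bsub>M\<^esub> b)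
    (lookup f a * lookup g b))"
proof -
  have "f \<otimes>\<^bsub>A\<^esub> g = (\<Sum>a\<in>keys f. \<Sum>b\<in>T. single (a \<otimes>\<^bsub>M\<^esub> b)
    (lookup f a * lookup g b))"
    unfolding A_def monoid_alg_def monoid.simps
    by (intro sum.cong refl sum.mono_neutral_left) (use assms in \<open>auto simp: in_keys_iff\<close>)
  also have "\<dots> = (\<Sum>a\<in>S. \<Sum>b\<in>T. single (a \<otimes>\<^bsub>M\<^esub> b)
    (lookup f a * lookup g b))"
    using assms by (auto intro!: sum.mono_neutral_left simp: in_keys_iff)
  finally show ?thesis .
qed

lemma monoid_alg_mult_add_left: "(f + g) \<otimes>\<^bsub>A\<^esub> h = f \<otimes>\<^bsub>A\<^esub> h + g \<otimes>\<^bsub>A\<^esub> h"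
proof -
  let ?S = "keys f \<union> keys g" and ?T = "keys h"
  show ?thesis
    using keys_add[of f g]
    by (simp add: monoid_alg_mult_superset[of ?S ?T] lookup_add algebra_simps single_add sum.distrib)
qed

lemma monoid_alg_mult_add_right: "h \<otimes>\<^bsub>A\<^esub> (f + g) = h \<otimes>\<^bsub>A\<^esub> f + h \<otimes>\<^bsub>A\<^esub> g"
proof -
  let ?S = "keys f \<union> keys g" and ?T = "keys h"
  show ?thesis
    using keys_add[of f g]
    by (simp add: monoid_alg_mult_superset[of ?T ?S] lookup_add algebra_simps single_add sum.distrib)
qed

lemma monoid_alg_mult_diff_left: "(f - g) \<otimes>\<^bsub>A\<^esub> h = f \<otimes>\<^bsub>A\<^esub> h - g \<otimes>\<^bsub>A\<^esub> h"
  using monoid_alg_mult_add_left[of "f - g" g h] by (simp add: algebra_simps)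

lemma monoid_alg_mult_diff_right: "h \<otimes>\<^bsub>A\<^esub> (f - g) = h \<otimes>\<^bsub>A\<^esub> f - h \<otimes>\<^bsub>A\<^esub> g"
  using monoid_alg_mult_add_right[of h "f - g" g] by (simp add: algebra_simps)

lemma monoid_alg_mult_zero [simp]: "0 \<otimes>\<^bsub>A\<^esub> f = 0" "f \<otimes>\<^bsub>A\<^esub> 0 = 0"
  by (simp_all add: A_def monoid_alg_def)

lemma monoid_alg_mult_single [simp]:
  "single a c \<otimes>\<^bsub>A\<^esub> single b d = single (a \<otimes>\<^bsub>M\<^esub> b) (c * d)"
  by (subst monoid_alg_mult_superset[of "{a}" "{b}"]) (auto split: if_splits)

text \<open>The laws for the product are multilinear, so \<open>keys_induct\<close> in each argument
  reduces them to basis elements, where they become the monoid laws.\<close>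

lemma kalgebra_monoid_alg:
  assumes "Group.monoid M"
  shows "kalgebra A"
proof -
  interpret M: Group.monoid M by fact
  note ind = keys_induct[where S = "carrier M"]
  have car: "carrier A = {f. keys f \<subseteq> carrier M}" by (simp add: A_def)
  have closed: "keys (f \<otimes>\<^bsub>A\<^esub> g) \<subseteq> carrier M"
    if "keys f \<subseteq> carrier M" "keys g \<subseteq> carrier M" for f g
    using that(1)
  proof (induction f rule: ind)
    case (single a c)
    show ?case using that(2)
    proof (induction g rule: ind)
      case (add g h) then show ?case by (simp add: monoid_alg_mult_add_right keys_add_subset)
    qed (use single in auto)
  next
    case (add f g) then show ?case by (simp add: monoid_alg_mult_add_left keys_add_subset)
  qed auto
  have assoc: "(f \<otimes>\<^bsub>A\<^esub> g) \<otimes>\<^bsub>A\<^esub> h = f \<otimes>\<^bsub>A\<^esub> (g \<otimes>\<^bsub>A\<^esub> h)"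
    if f: "keys f \<subseteq> carrier M" and g: "keys g \<subseteq> carrier M"
      and h: "keys h \<subseteq> carrier M" for f g h
    using f
  proof (induction f rule: ind)
    case (single a c)
    show ?case using g
    proof (induction g rule: ind)
      case (single b d)
      note b = single
      show ?case using h
      proof (induction h rule: ind)
        case (single b' d') then show ?case using \<open>a \<in> carrier M\<close> b
          by (simp add: M.m_assoc mult.assoc)
      qed (auto simp: monoid_alg_mult_add_right)
    qed (auto simp: monoid_alg_mult_add_right monoid_alg_mult_add_left)
  qed (auto simp: monoid_alg_mult_add_left)
  have sl: "Poly_Mapping.map ((*) c) f \<otimes>\<^bsub>A\<^esub> g = Poly_Mapping.map ((*) c) (f \<otimes>\<^bsub>A\<^esub> g)"
    if f: "keys f \<subseteq> carrier M" and g: "keys g \<subseteq> carrier M" for f g c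
    using f
  proof (induction f rule: ind)
    case (single a c)
    show ?case using g
      by (induction g rule: ind) (auto simp: monoid_alg_mult_add_right scale_add mult.assoc)
  qed (auto simp: monoid_alg_mult_add_left scale_add)
  have sr: "f \<otimes>\<^bsub>A\<^esub> Poly_Mapping.map ((*) c) g = Poly_Mapping.map ((*) c) (f \<otimes>\<^bsub>A\<^esub> g)"
    if f: "keys f \<subseteq> carrier M" and g: "keys g \<subseteq> carrier M" for f g c
    using f
  proof (induction f rule: ind)
    case (single a c)
    show ?case using g
      by (induction g rule: ind) (auto simp: monoid_alg_mult_add_right scale_add mult.left_commute)
  qed (auto simp: monoid_alg_mult_add_left scale_add)
  have one: "single \<one>\<^bsub>M\<^esub> 1 \<otimes>\<^bsub>A\<^esub> f = f" "f \<otimes>\<^bsub>A\<^esub> single \<one>\<^bsub>M\<^esub> 1 = f"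
    if "keys f \<subseteq> carrier M" for f
    using that by (induction f rule: ind) (auto simp: monoid_alg_mult_add_left monoid_alg_mult_add_right)
  have "ring A"
  proof (rule ringI)
    show "abelian_group A"
    proof (rule abelian_groupI)
      fix x assume "x \<in> carrier A"
      then show "\<exists>y\<in>carrier A. y \<oplus>\<^bsub>A\<^esub> x = \<zero>\<^bsub>A\<^esub>"
        by (intro bexI[of _ "- x"]) (auto simp: A_def in_keys_iff)
    qed (simp_all add: A_def keys_add_subset add.assoc add.commute)
    show "Group.monoid A"
      using closed assoc one by (intro monoidI) (auto simp: car simp: A_def)
  qed (auto simp: A_def monoid_alg_mult_add_left[unfolded A_def] monoid_alg_mult_add_right[unfolded A_def])
  then show ?thesis
  proof (intro kalgebra.intro kalgebra_axioms.intro)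
    fix x c assume "x \<in> carrier A"
    then show "c \<odot>\<^bsub>A\<^esub> x \<in> carrier A" using keys_scale[of c x] by (auto simp: A_def)
  next
    fix x y c assume "x \<in> carrier A" "y \<in> carrier A"
    then show "c \<odot>\<^bsub>A\<^esub> x \<otimes>\<^bsub>A\<^esub> y = c \<odot>\<^bsub>A\<^esub> (x \<otimes>\<^bsub>A\<^esub> y)"
      and "x \<otimes>\<^bsub>A\<^esub> (c \<odot>\<^bsub>A\<^esub> y) = c \<odot>\<^bsub>A\<^esub> (x \<otimes>\<^bsub>A\<^esub> y)"
      using sl sr by (simp_all add: car) (simp_all add: A_def)
  qed (auto simp: A_def scale_add lookup_add algebra_simps intro!: poly_mapping_eqI)
qed

end

lemma monoid_alg_a_inv:
  assumes "Group.monoid M" "keys f \<subseteq> carrier M"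
  shows "\<ominus>\<^bsub>monoid_alg M :: ('k::field, 'm \<Rightarrow>\<^sub>0 'k) module\<^esub> f = - f"
proof -
  interpret kalgebra "monoid_alg M :: ('k::field, 'm \<Rightarrow>\<^sub>0 'k) module" by (rule kalgebra_monoid_alg) fact
  show ?thesis by (rule minus_equality) (use assms in \<open>auto simp: in_keys_iff\<close>)
qed

lemma monoid_alg_minus:
  assumes "Group.monoid M" "keys g \<subseteq> carrier M"
  shows "f \<ominus>\<^bsub>monoid_alg M :: ('k::field, 'm \<Rightarrow>\<^sub>0 'k) module\<^esub> g = f - g"
  unfolding a_minus_def using assms by (simp add: monoid_alg_a_inv)

section \<open>Linear extension from the basis and the universal property of a monoid
  algebra\<close>

definition lin_ext :: "('k::field, 'b) module \<Rightarrow> ('m \<Rightarrow> 'b) \<Rightarrow> ('m \<Rightarrow>\<^sub>0 'k) \<Rightarrow> 'b" where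
  "lin_ext B \<phi> f = (\<Oplus>\<^bsub>B\<^esub>a\<in>keys f. lookup f a \<odot>\<^bsub>B\<^esub> \<phi> a)"

context kalgebra
begin

lemma lin_ext_superset:
  assumes "finite T" "keys f \<subseteq> T" "\<phi> \<in> T \<rightarrow> carrier A"
  shows "lin_ext A \<phi> f = (\<Oplus>a\<in>T. lookup f a \<odot> \<phi> a)"
  unfolding lin_ext_def using assms
  by (intro add.finprod_mono_neutral_cong_left) (auto simp: in_keys_iff Pi_iff)

lemma lin_ext_zero [simp]: "lin_ext A \<phi> 0 = \<zero>"
  by (simp add: lin_ext_def)

lemma lin_ext_single [simp]: "\<phi> a \<in> carrier A \<Longrightarrow> lin_ext A \<phi> (single a c) = c \<odot> \<phi> a"
  by (subst lin_ext_superset[of "{a}"]) auto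

lemma lin_ext_lin_map:
  assumes "\<phi> \<in> carrier M \<rightarrow> carrier A"
  shows "lin_ext A \<phi> \<in> lin_map (monoid_alg M) A"
proof (rule lin_mapI)
  fix f assume f: "f \<in> carrier (monoid_alg M :: ('k, _) module)"
  then show "lin_ext A \<phi> f \<in> carrier A"
    unfolding lin_ext_def using assms by (intro finsum_closed) auto
  fix c
  have p: "\<phi> \<in> keys f \<rightarrow> carrier A" using f assms by auto
  show "lin_ext A \<phi> (c \<odot>\<^bsub>monoid_alg M\<^esub> f) = c \<odot> lin_ext A \<phi> f"
    using keys_scale[of c f] p
    by (simp add: lin_ext_superset[of "keys f"] smult_finsum Pi_iff)
       (auto intro!: finsum_cong' simp: smult_assoc)
next
  fix f g assume fg: "f \<in> carrier (monoid_alg M :: ('k, _) module)" "g \<in> carrier (monoid_alg M :: ('k, _) module)"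
  let ?T = "keys f \<union> keys g"
  have p: "\<phi> \<in> ?T \<rightarrow> carrier A" using fg assms by auto
  have "lin_ext A \<phi> (f + g) = (\<Oplus>a\<in>?T. lookup f a \<odot> \<phi> a \<oplus> lookup g a \<odot> \<phi> a)"
    using keys_add[of f g] p
    by (subst lin_ext_superset[of ?T])
       (auto simp: lookup_add smult_l_distr Pi_iff simp del: finsum_addf intro!: finsum_cong')
  also have "\<dots> = lin_ext A \<phi> f \<oplus> lin_ext A \<phi> g"
    using p by (subst finsum_addf) (auto simp: lin_ext_superset[of ?T] Pi_iff)
  finally show "lin_ext A \<phi> (f \<oplus>\<^bsub>monoid_alg M\<^esub> g) = lin_ext A \<phi> f \<oplus> lin_ext A \<phi> g" by simp
qed

lemma lin_ext_alg_hom: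
  assumes M: "Group.monoid M" and \<phi>: "\<phi> \<in> carrier M \<rightarrow> carrier A"
    and mult: "\<And>a b. a \<in> carrier M \<Longrightarrow> b \<in> carrier M \<Longrightarrow> \<phi> (a \<otimes>\<^bsub>M\<^esub> b) = \<phi> a \<otimes> \<phi> b"
    and one: "\<phi> \<one>\<^bsub>M\<^esub> = \<one>"
  shows "lin_ext A \<phi> \<in> alg_hom (monoid_alg M) A"
proof -
  interpret M: Group.monoid M by fact
  interpret MA: kalgebra "monoid_alg M :: ('k, _) module" by (rule kalgebra_monoid_alg) fact
  note L = lin_ext_lin_map[OF \<phi>]
  note L' = lin_map_closed[OF L, simplified] lin_map_add[OF L, simplified]
  have keys_mult: "keys (f \<otimes>\<^bsub>monoid_alg M :: ('k, _) module\<^esub> g) \<subseteq> carrier M"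
    if "keys f \<subseteq> carrier M" "keys g \<subseteq> carrier M" for f g
    using MA.m_closed[of f g] that by simp
  have "lin_ext A \<phi> (f \<otimes>\<^bsub>monoid_alg M\<^esub> g) = lin_ext A \<phi> f \<otimes> lin_ext A \<phi> g"
    if f: "keys f \<subseteq> carrier M" and g: "keys g \<subseteq> carrier M" for f g
    using f
  proof (induction f rule: keys_induct)
    case (single a c)
    show ?case using g
    proof (induction g rule: keys_induct)
      case (single b d)
      have "\<phi> a \<in> carrier A" "\<phi> b \<in> carrier A" "\<phi> (a \<otimes>\<^bsub>M\<^esub> b) \<in> carrier A"
        using single \<phi> \<open>a \<in> carrier M\<close> by auto
      then show ?case using single \<open>a \<in> carrier M\<close>
        by (simp add: mult smult_mult_l smult_mult_r smult_assoc mult.commute)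
    qed (use single in \<open>auto simp: monoid_alg_mult_add_right L' keys_mult r_distr L'\<close>)
  qed (use g in \<open>auto simp: monoid_alg_mult_add_left L' keys_mult l_distr L'\<close>)
  then show ?thesis
    using L' lin_map_smult[OF L, simplified] one \<phi> by (intro alg_homI) auto
qed

end

text \<open>\<open>Z\<close> is closed under linear combinations only. The elements all of whose
  two-sided multiples lie in \<open>Z\<close> form the largest ideal inside \<open>Z\<close>, and
  \<open>R\<close> lies in that ideal by assumption. With \<open>Z\<close> the kernel of a linear
  map, this shows that the map vanishes on an ideal without being multiplicative.\<close>

lemma (in kalgebra) genideal_subset:
  assumes R: "R \<subseteq> carrier A"
    and Z0: "\<zero> \<in> Z" and Zadd: "\<And>f g. f \<in> Z \<Longrightarrow> g \<in> Z \<Longrightarrow> f \<oplus> g \<in> Z"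
    and Zsm: "\<And>c f. f \<in> Z \<Longrightarrow> c \<odot> f \<in> Z"
    and ZR: "\<And>u v r. u \<in> carrier A \<Longrightarrow> v \<in> carrier A \<Longrightarrow> r \<in> R \<Longrightarrow> u \<otimes> r \<otimes> v \<in> Z"
  shows "Idl R \<subseteq> Z"
proof -
  define K where "K = {x \<in> carrier A. \<forall>u\<in>carrier A. \<forall>v\<in>carrier A. u \<otimes> x \<otimes> v \<in> Z}"
  have "ideal K A"
  proof (rule idealI)
    show "ring A" by (rule ring_axioms)
    show "subgroup K (add_monoid A)"
    proof (rule add.subgroupI)
      fix a assume a: "a \<in> K"
      then have ac: "a \<in> carrier A" by (simp add: K_def)
      \<comment> \<open>Negation is the scalar \<open>- 1\<close>, so closure under scalars supplies
        closure under negatives.\<close>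
      have "u \<otimes> (\<ominus> a) \<otimes> v = (- 1) \<odot> (u \<otimes> a \<otimes> v)" if "u \<in> carrier A" "v \<in> carrier A" for u v
        using that ac by (simp add: r_minus l_minus smult_minus_left)
      then show "\<ominus> a \<in> K" using a ac Zsm by (simp add: K_def)
    next
      fix a b assume "a \<in> K" "b \<in> K"
      then show "a \<oplus> b \<in> K" using Zadd by (simp add: K_def l_distr r_distr)
    qed (use Z0 in \<open>auto simp: K_def\<close>)
  next
    fix a x assume a: "a \<in> K" and x: "x \<in> carrier A"
    have ac: "a \<in> carrier A" using a by (simp add: K_def)
    have "u \<otimes> (x \<otimes> a) \<otimes> v \<in> Z" "u \<otimes> (a \<otimes> x) \<otimes> v \<in> Z" if "u \<in> carrier A" "v \<in> carrier A" for u v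
    proof -
      have "(u \<otimes> x) \<otimes> a \<otimes> v \<in> Z" "u \<otimes> a \<otimes> (x \<otimes> v) \<in> Z" using a x that by (auto simp: K_def)
      then show "u \<otimes> (x \<otimes> a) \<otimes> v \<in> Z" "u \<otimes> (a \<otimes> x) \<otimes> v \<in> Z" using x ac that by (simp_all add: m_assoc)
    qed
    then show "x \<otimes> a \<in> K" "a \<otimes> x \<in> K" using x ac by (auto simp: K_def)
  qed
  moreover have "R \<subseteq> K" using ZR R by (auto simp: K_def)
  ultimately have "Idl R \<subseteq> K" by (rule genideal_minimal)
  moreover have "K \<subseteq> Z"
  proof
    fix x assume "x \<in> K"
    then have "\<one> \<otimes> x \<otimes> \<one> \<in> Z" "x \<in> carrier A" unfolding K_def by blast+
    then show "x \<in> Z" by simp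
  qed
  ultimately show ?thesis by blast
qed

text \<open>The product is linear in both outer factors, so it is enough to test outer factors that
  are monoid elements.\<close>

lemma monoid_alg_sandwich:
  fixes r :: "'m \<Rightarrow>\<^sub>0 'k::field"
  assumes M: "Group.monoid M"
    and Z0: "0 \<in> Z" and Zadd: "\<And>f g. f \<in> Z \<Longrightarrow> g \<in> Z \<Longrightarrow> f + g \<in> Z"
    and Zsm: "\<And>c f. f \<in> Z \<Longrightarrow> Poly_Mapping.map (\<lambda>x. c * x) f \<in> Z"
    and r: "keys r \<subseteq> carrier M"
    and Zr: "\<And>u v. u \<in> carrier M \<Longrightarrow> v \<in> carrier M \<Longrightarrow>
      single u 1 \<otimes>\<^bsub>monoid_alg M :: ('k, _) module\<^esub> r
        \<otimes>\<^bsub>monoid_alg M :: ('k, _) module\<^esub> single v 1 \<in> Z"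
    and x: "keys x \<subseteq> carrier M" and y: "keys y \<subseteq> carrier M"
  shows "x \<otimes>\<^bsub>monoid_alg M :: ('k, _) module\<^esub> r \<otimes>\<^bsub>monoid_alg M :: ('k, _) module\<^esub> y \<in> Z"
proof -
  define A where "A = (monoid_alg M :: ('k, _) module)"
  interpret A: kalgebra A unfolding A_def by (rule kalgebra_monoid_alg) fact
  have car: "carrier A = {f. keys f \<subseteq> carrier M}" by (simp add: A_def)
  have sc: "single a c = c \<odot>\<^bsub>A\<^esub> single a 1" for a and c :: 'k by (simp add: A_def)
  have Zsm': "c \<odot>\<^bsub>A\<^esub> f \<in> Z" if "f \<in> Z" for c f using Zsm[OF that] by (simp add: A_def)
  have "x \<otimes>\<^bsub>A\<^esub> r \<otimes>\<^bsub>A\<^esub> y \<in> Z"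
    using x
  proof (induction x rule: keys_induct)
    case (single a c)
    show ?case using y
    proof (induction y rule: keys_induct)
      case (single b d)
      have ab: "single a 1 \<in> carrier A" "single b 1 \<in> carrier A" "r \<in> carrier A"
        using single \<open>a \<in> carrier M\<close> r by (auto simp: car)
      have "single a 1 \<otimes>\<^bsub>A\<^esub> r \<otimes>\<^bsub>A\<^esub> single b 1 \<in> Z"
        using Zr[OF \<open>a \<in> carrier M\<close> single] by (simp add: A_def)
      then have "(c * d) \<odot>\<^bsub>A\<^esub> (single a 1 \<otimes>\<^bsub>A\<^esub> r \<otimes>\<^bsub>A\<^esub> single b 1) \<in> Z" by (rule Zsm')
      moreover have "single a c \<otimes>\<^bsub>A\<^esub> r \<otimes>\<^bsub>A\<^esub> single b d
        = (c * d) \<odot>\<^bsub>A\<^esub> (single a 1 \<otimes>\<^bsub>A\<^esub> r \<otimes>\<^bsub>A\<^esub> single b 1)"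
        unfolding sc[of a c] sc[of b d] using ab
        by (simp only: A.smult_mult_l A.smult_mult_r A.smult_assoc A.m_closed A.smult_closed mult.commute)
      ultimately show ?case by simp
    qed (use Z0 Zadd in \<open>auto simp: A_def monoid_alg_mult_add_right\<close>)
  qed (use Z0 Zadd in \<open>auto simp: A_def monoid_alg_mult_add_left\<close>)
  then show ?thesis by (simp add: A_def)
qed

lemma genideal_monoid_alg_subset:
  fixes R :: "('m \<Rightarrow>\<^sub>0 'k::field) set"
  assumes M: "Group.monoid M" and R: "R \<subseteq> {f. keys f \<subseteq> carrier M}"
    and Z0: "0 \<in> Z" and Zadd: "\<And>f g. f \<in> Z \<Longrightarrow> g \<in> Z \<Longrightarrow> f + g \<in> Z"
    and Zsm: "\<And>c f. f \<in> Z \<Longrightarrow> Poly_Mapping.map (\<lambda>x. c * x) f \<in> Z"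
    and ZR: "\<And>u v r. u \<in> carrier M \<Longrightarrow> v \<in> carrier M \<Longrightarrow> r \<in> R \<Longrightarrow>
      single u 1 \<otimes>\<^bsub>monoid_alg M :: ('k, _) module\<^esub> r
        \<otimes>\<^bsub>monoid_alg M :: ('k, _) module\<^esub> single v 1 \<in> Z"
  shows "Idl\<^bsub>monoid_alg M :: ('k, _) module\<^esub> R \<subseteq> Z"
proof -
  interpret A: kalgebra "monoid_alg M :: ('k, _) module" by (rule kalgebra_monoid_alg) fact
  show ?thesis
  proof (rule A.genideal_subset)
    fix x y r assume "x \<in> carrier (monoid_alg M :: ('k, _) module)" "y \<in> carrier (monoid_alg M :: ('k, _) module)" "r \<in> R"
    then show "x \<otimes>\<^bsub>monoid_alg M :: ('k, _) module\<^esub> r \<otimes>\<^bsub>monoid_alg M :: ('k, _) module\<^esub> y \<in> Z"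
      using R by (intro monoid_alg_sandwich[OF M Z0 Zadd Zsm _ ZR]) auto
  qed (use R Z0 Zadd Zsm in simp_all)
qed

section \<open>Quotient algebras\<close>

lemma quot_alg_simps:
  "carrier (quot_alg A J) = a_rcosets\<^bsub>A\<^esub> J"
  "(\<otimes>\<^bsub>quot_alg A J\<^esub>) = rcoset_mult A J"
  "\<one>\<^bsub>quot_alg A J\<^esub> = J +>\<^bsub>A\<^esub> \<one>\<^bsub>A\<^esub>"
  "\<zero>\<^bsub>quot_alg A J\<^esub> = J"
  "(\<oplus>\<^bsub>quot_alg A J\<^esub>) = set_add A"
  "(\<odot>\<^bsub>quot_alg A J\<^esub>) = (\<lambda>c C. \<Union>x\<in>C. J +>\<^bsub>A\<^esub> (c \<odot>\<^bsub>A\<^esub> x))"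
  by (simp_all add: quot_alg_def FactRing_def ring.defs module.defs)

text \<open>Meaningful when \<open>g\<close> is constant on the coset \<open>C\<close>: then the
  image is a singleton and \<open>the_elem\<close> extracts its element.\<close>

definition descend :: "('a \<Rightarrow> 'b) \<Rightarrow> 'a set \<Rightarrow> 'b" where
  "descend g C = the_elem (g ` C)"

locale kalgebra_ideal = kalgebra A + ideal J A for A :: "('k::field, 'a) module" (structure) and J
begin

abbreviation Q where "Q \<equiv> quot_alg A J"

text \<open>A ring ideal is automatically a subspace, since \<open>c\<close> times \<open>x\<close>
  is the product of \<open>c \<odot> \<one>\<close> and \<open>x\<close>.\<close>

lemma ideal_smult: "x \<in> J \<Longrightarrow> c \<odot> x \<in> J"
  using I_l_closed[of x "c \<odot> \<one>"] a_subset by (auto simp: smult_mult_l)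

text \<open>The union that defines the scalar action ranges over representatives that all give the
  same coset, so it collapses to that coset.\<close>

lemma coset_smult: "x \<in> carrier A \<Longrightarrow> c \<odot>\<^bsub>Q\<^esub> (J +> x) = J +> (c \<odot> x)"
proof -
  assume x: "x \<in> carrier A"
  have "J +> (c \<odot> y) = J +> (c \<odot> x)" if y: "y \<in> J +> x" for y
  proof -
    obtain j where j: "j \<in> J" "y = j \<oplus> x" using y by (auto simp: a_r_coset_def')
    then have "c \<odot> y = c \<odot> j \<oplus> c \<odot> x" using a_subset x by (auto simp: smult_r_distr)
    then have "c \<odot> y \<in> J +> (c \<odot> x)" using ideal_smult[OF j(1)] by (auto simp: a_r_coset_def')
    then show ?thesis using x by (metis a_repr_independence smult_closed is_additive_subgroup additive_subgroup_def)
  qed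
  moreover have "J +> x \<noteq> {}" using a_rcos_self[OF x] by auto
  ultimately show ?thesis by (simp add: quot_alg_simps)
qed

lemma coset_alg_hom: "(\<lambda>x. J +> x) \<in> alg_hom A Q"
  by (rule alg_homI)
     (auto simp: coset_smult, auto simp: quot_alg_simps a_rcosetsI[OF a_subset] rcoset_mult_add a_rcos_sum)

lemma coset_surj: "C \<in> carrier Q \<Longrightarrow> \<exists>x\<in>carrier A. C = J +> x"
  by (auto simp: quot_alg_simps A_RCOSETS_def')

lemma coset_zero_iff: "x \<in> carrier A \<Longrightarrow> J +> x = \<zero>\<^bsub>Q\<^esub> \<longleftrightarrow> x \<in> J"
  unfolding quot_alg_simps
  by (metis a_coset_join2 a_rcos_self additive_subgroup.a_subgroup is_additive_subgroup)

lemma kalgebra_quot: "kalgebra Q"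
proof -
  \<comment> \<open>Only the scalar multiplication is added to the record of the factor ring, and no
    ring axiom mentions it.\<close>
  have "ring Q = ring (A Quot J)"
    unfolding ring_def abelian_group_def abelian_monoid_def abelian_group_axioms_def comm_group_def
      Group.comm_monoid_def Group.group_def Group.monoid_def comm_monoid_axioms_def group_axioms_def
      ring_axioms_def Units_def
    by (simp add: quot_alg_simps FactRing_def)
  then have "ring Q" using quotient_is_ring by simp
  note h = coset_alg_hom
  note hs = alg_hom_add[OF h, symmetric] alg_hom_mult[OF h, symmetric] alg_hom_smult[OF h, symmetric]
  show ?thesis
  proof (intro kalgebra.intro kalgebra_axioms.intro)
    show "ring Q" by fact
  qed (auto dest!: coset_surj simp: hs smult_l_distr smult_r_distr smult_assoc smult_mult_l
      smult_mult_r alg_hom_closed[OF h])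
qed

lemma descend_coset:
  assumes "x \<in> carrier A" "\<And>j. j \<in> J \<Longrightarrow> g (j \<oplus> x) = g x"
  shows "descend g (J +> x) = g x"
proof -
  have "g ` (J +> x) = {g x}"
    using assms a_rcos_self[OF assms(1)] by (auto simp: a_r_coset_def')
  then show ?thesis by (simp add: descend_def)
qed

lemma descend_lin_map_coset:
  assumes "kalgebra B" "g \<in> lin_map A B" "\<And>j. j \<in> J \<Longrightarrow> g j = \<zero>\<^bsub>B\<^esub>" "x \<in> carrier A"
  shows "descend g (J +> x) = g x"
proof (rule descend_coset[OF assms(4)])
  interpret B: kalgebra B by fact
  fix j assume j: "j \<in> J"
  then show "g (j \<oplus> x) = g x"
    using assms(3,4) lin_map_closed[OF assms(2)] lin_map_add[OF assms(2), of j x] a_subset by auto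
qed

lemma descend_lin_map:
  assumes "kalgebra B" "g \<in> lin_map A B" "\<And>j. j \<in> J \<Longrightarrow> g j = \<zero>\<^bsub>B\<^esub>"
  shows "descend g \<in> lin_map Q B"
proof -
  note h = coset_alg_hom
  note hs = alg_hom_add[OF h, symmetric] alg_hom_smult[OF h, symmetric]
  show ?thesis
    by (rule lin_mapI)
       (auto dest!: coset_surj simp: hs descend_lin_map_coset[OF assms] lin_map_closed[OF assms(2)]
          lin_map_add[OF assms(2)] lin_map_smult[OF assms(2)])
qed

lemma descend_alg_hom:
  assumes "kalgebra B" "g \<in> alg_hom A B" "\<And>j. j \<in> J \<Longrightarrow> g j = \<zero>\<^bsub>B\<^esub>"
  shows "descend g \<in> alg_hom Q B"
proof -
  note h = coset_alg_hom
  note hs = alg_hom_add[OF h, symmetric] alg_hom_mult[OF h, symmetric] alg_hom_smult[OF h, symmetric]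
    alg_hom_one[OF h, symmetric]
  note g = alg_hom_lin_map[OF assms(2)]
  show ?thesis
    by (rule alg_homI)
       (auto dest!: coset_surj simp: hs descend_lin_map_coset[OF assms(1) g assms(3)]
          alg_hom_closed[OF assms(2)] alg_hom_mult[OF assms(2)]
          alg_hom_add[OF assms(2)] alg_hom_smult[OF assms(2)] alg_hom_one[OF assms(2)])
qed

end


section \<open>Tensor products\<close>

lemma bilin_relI:
  "a \<in> carrier A \<Longrightarrow> a' \<in> carrier A \<Longrightarrow> b \<in> carrier B \<Longrightarrow>
    single (a \<oplus>\<^bsub>A\<^esub> a', b) 1 - single (a, b) 1 - single (a', b) 1
    \<in> bilin_rels A B"
  "a \<in> carrier A \<Longrightarrow> b \<in> carrier B \<Longrightarrow> b' \<in> carrier B \<Longrightarrow>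
    single (a, b \<oplus>\<^bsub>B\<^esub> b') 1 - single (a, b) 1 - single (a, b') 1
    \<in> bilin_rels A B"
  "a \<in> carrier A \<Longrightarrow> b \<in> carrier B \<Longrightarrow>
    single (c \<odot>\<^bsub>A\<^esub> a, b) 1 - single (a, b) c \<in> bilin_rels A B"
  "a \<in> carrier A \<Longrightarrow> b \<in> carrier B \<Longrightarrow>
    single (a, c \<odot>\<^bsub>B\<^esub> b) 1 - single (a, b) c \<in> bilin_rels A B"
  unfolding bilin_rels_def by blast+

locale kalgebra_pair = A: kalgebra A + B: kalgebra B
  for A :: "('k::field, 'a) module" and B :: "('k, 'b) module"
begin

abbreviation AB where "AB \<equiv> (monoid_alg (A \<times>\<times> B) :: ('k, 'a \<times> 'b \<Rightarrow>\<^sub>0 'k) module)"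

abbreviation TAB where "TAB \<equiv> tensor_alg A B"

lemma monoid_prod: "Group.monoid (A \<times>\<times> B)"
  by (rule DirProd_monoid) (rule A.monoid_axioms B.monoid_axioms)+

sublocale AB: kalgebra AB
  by (rule kalgebra_monoid_alg[OF monoid_prod])

lemma AB_single: "a \<in> carrier A \<Longrightarrow> b \<in> carrier B \<Longrightarrow> single (a, b) c \<in> carrier AB"
  by simp

lemma AB_minus: "g \<in> carrier AB \<Longrightarrow> f - g = f \<ominus>\<^bsub>AB\<^esub> g"
  using monoid_alg_minus[OF monoid_prod, of g f] by simp

lemma AB_minus_closed: "f \<in> carrier AB \<Longrightarrow> g \<in> carrier AB \<Longrightarrow> f - g \<in> carrier AB"
  by (simp only: AB_minus AB.minus_closed)

lemma bilin_rels_closed: "bilin_rels A B \<subseteq> carrier AB"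
  unfolding bilin_rels_def by (blast intro: AB_minus_closed AB_single A.a_closed B.a_closed)

sublocale TI: kalgebra_ideal AB "tensor_ideal A B"
  unfolding tensor_ideal_def
  by (intro kalgebra_ideal.intro AB.kalgebra_axioms AB.genideal_ideal bilin_rels_closed)

lemma tensor_alg_eq: "TAB = TI.Q"
  by (simp add: tensor_alg_def)

sublocale T: kalgebra "TAB"
  unfolding tensor_alg_eq by (rule TI.kalgebra_quot)

lemma coset_hom: "(\<lambda>x. tensor_ideal A B +>\<^bsub>AB\<^esub> x) \<in> alg_hom AB (TAB)"
  unfolding tensor_alg_eq by (rule TI.coset_alg_hom)

lemma tens_closed [simp, intro]: "a \<in> carrier A \<Longrightarrow> b \<in> carrier B \<Longrightarrow> tens A B a b \<in> carrier (TAB)"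
  unfolding tens_def by (rule alg_hom_closed[OF coset_hom]) simp

lemma tens_mult:
  assumes "a \<in> carrier A" "b \<in> carrier B" "a' \<in> carrier A" "b' \<in> carrier B"
  shows "tens A B a b \<otimes>\<^bsub>TAB\<^esub> tens A B a' b' = tens A B (a \<otimes>\<^bsub>A\<^esub> a') (b \<otimes>\<^bsub>B\<^esub> b')"
  unfolding tens_def using assms
  by (simp add: alg_hom_mult[OF coset_hom, symmetric])

lemma tens_one: "tens A B \<one>\<^bsub>A\<^esub> \<one>\<^bsub>B\<^esub> = \<one>\<^bsub>TAB\<^esub>"
  unfolding tens_def using alg_hom_one[OF coset_hom] by simp

lemma rel_zero: "r \<in> bilin_rels A B \<Longrightarrow> tensor_ideal A B +>\<^bsub>AB\<^esub> r = \<zero>\<^bsub>TAB\<^esub>"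
  using bilin_rels_closed AB.genideal_self[OF bilin_rels_closed] TI.coset_zero_iff
  unfolding tensor_alg_eq tensor_ideal_def by blast

text \<open>Phrased for arbitrary pairs, so that additivity in either tensor factor is an
  instance.\<close>

lemma rel_add:
  assumes "single x 1 - single y 1 - single z 1 \<in> bilin_rels A B"
    "x \<in> carrier A \<times> carrier B" "y \<in> carrier A \<times> carrier B" "z \<in> carrier A \<times> carrier B"
  shows "tensor_ideal A B +>\<^bsub>AB\<^esub> single x 1 =
    (tensor_ideal A B +>\<^bsub>AB\<^esub> single y 1)
    \<oplus>\<^bsub>TAB\<^esub> (tensor_ideal A B +>\<^bsub>AB\<^esub> single z 1)"
proof -
  define \<pi> where "\<pi> = (\<lambda>x. tensor_ideal A B +>\<^bsub>AB\<^esub> x)"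
  note h = alg_hom_lin_map[OF coset_hom, folded \<pi>_def]
  define X Y Z where "X = (single x 1 :: 'a \<times> 'b \<Rightarrow>\<^sub>0 'k)"
    and "Y = (single y 1 :: 'a \<times> 'b \<Rightarrow>\<^sub>0 'k)" and "Z = (single z 1 :: 'a \<times> 'b \<Rightarrow>\<^sub>0 'k)"
  have c: "X \<in> carrier AB" "Y \<in> carrier AB" "Z \<in> carrier AB" using assms by (auto simp: X_def Y_def Z_def)
  have p: "\<pi> X \<in> carrier (TAB)" "\<pi> Y \<in> carrier (TAB)" "\<pi> Z \<in> carrier (TAB)"
    using c lin_map_closed[OF h] by auto
  have eq: "X - Y - Z = (X \<ominus>\<^bsub>AB\<^esub> Y) \<ominus>\<^bsub>AB\<^esub> Z" using c by (simp only: AB_minus AB_minus_closed)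
  have "\<zero>\<^bsub>TAB\<^esub> = \<pi> (X - Y - Z)"
    using rel_zero[OF assms(1)] by (simp add: X_def Y_def Z_def \<pi>_def)
  also have "\<dots> = (\<pi> X \<ominus>\<^bsub>TAB\<^esub> \<pi> Y) \<ominus>\<^bsub>TAB\<^esub> \<pi> Z"
    unfolding eq using c
    by (simp only: lin_map_minus[OF AB.kalgebra_axioms T.kalgebra_axioms h] AB.minus_closed)
  also have "\<dots> = \<pi> X \<ominus>\<^bsub>TAB\<^esub> (\<pi> Y \<oplus>\<^bsub>TAB\<^esub> \<pi> Z)"
    using p by (simp add: T.minus_eq T.minus_add T.a_assoc)
  finally have "\<pi> X = \<pi> Y \<oplus>\<^bsub>TAB\<^esub> \<pi> Z"
    using p by (metis T.a_closed T.r_right_minus_eq)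
  then show ?thesis by (simp add: \<pi>_def X_def Y_def Z_def)
qed

lemma rel_smult:
  assumes "single x 1 - single y c \<in> bilin_rels A B"
    "x \<in> carrier A \<times> carrier B" "y \<in> carrier A \<times> carrier B"
  shows "tensor_ideal A B +>\<^bsub>AB\<^esub> single x 1 =
    c \<odot>\<^bsub>TAB\<^esub> (tensor_ideal A B +>\<^bsub>AB\<^esub> single y 1)"
proof -
  define \<pi> where "\<pi> = (\<lambda>x. tensor_ideal A B +>\<^bsub>AB\<^esub> x)"
  note h = alg_hom_lin_map[OF coset_hom, folded \<pi>_def]
  define X Y where "X = (single x 1 :: 'a \<times> 'b \<Rightarrow>\<^sub>0 'k)"
    and "Y = (single y 1 :: 'a \<times> 'b \<Rightarrow>\<^sub>0 'k)"
  have c: "X \<in> carrier AB" "Y \<in> carrier AB" using assms by (auto simp: X_def Y_def)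
  have p: "\<pi> X \<in> carrier (TAB)" "\<pi> Y \<in> carrier (TAB)"
    using c lin_map_closed[OF h] by auto
  have cY: "single y c = c \<odot>\<^bsub>AB\<^esub> Y" by (simp add: Y_def)
  have "\<zero>\<^bsub>TAB\<^esub> = \<pi> (X - c \<odot>\<^bsub>AB\<^esub> Y)"
    using rel_zero[OF assms(1)] unfolding cY by (simp add: X_def Y_def \<pi>_def)
  also have "\<dots> = \<pi> (X \<ominus>\<^bsub>AB\<^esub> c \<odot>\<^bsub>AB\<^esub> Y)" using c by (simp only: AB_minus AB.smult_closed)
  also have "\<dots> = \<pi> X \<ominus>\<^bsub>TAB\<^esub> c \<odot>\<^bsub>TAB\<^esub> \<pi> Y"
    using c by (simp only: lin_map_minus[OF AB.kalgebra_axioms T.kalgebra_axioms h] lin_map_smult[OF h] AB.smult_closed)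
  finally have "\<pi> X = c \<odot>\<^bsub>TAB\<^esub> \<pi> Y"
    using p by (metis T.smult_closed T.r_right_minus_eq)
  then show ?thesis by (simp add: \<pi>_def X_def Y_def)
qed

lemma tens_add_left:
  assumes "a \<in> carrier A" "a' \<in> carrier A" "b \<in> carrier B"
  shows "tens A B (a \<oplus>\<^bsub>A\<^esub> a') b = tens A B a b \<oplus>\<^bsub>TAB\<^esub> tens A B a' b"
  unfolding tens_def by (rule rel_add) (use assms in \<open>auto intro: bilin_relI\<close>)

lemma tens_add_right:
  assumes "a \<in> carrier A" "b \<in> carrier B" "b' \<in> carrier B"
  shows "tens A B a (b \<oplus>\<^bsub>B\<^esub> b') = tens A B a b \<oplus>\<^bsub>TAB\<^esub> tens A B a b'"
  unfolding tens_def by (rule rel_add) (use assms in \<open>auto intro: bilin_relI\<close>)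

lemma tens_smult_left:
  assumes "a \<in> carrier A" "b \<in> carrier B"
  shows "tens A B (c \<odot>\<^bsub>A\<^esub> a) b = c \<odot>\<^bsub>TAB\<^esub> tens A B a b"
  unfolding tens_def by (rule rel_smult) (use assms in \<open>auto intro: bilin_relI\<close>)

lemma tens_smult_right:
  assumes "a \<in> carrier A" "b \<in> carrier B"
  shows "tens A B a (c \<odot>\<^bsub>B\<^esub> b) = c \<odot>\<^bsub>TAB\<^esub> tens A B a b"
  unfolding tens_def by (rule rel_smult) (use assms in \<open>auto intro: bilin_relI\<close>)

lemma tens_lin_map_left: "b \<in> carrier B \<Longrightarrow> (\<lambda>a. tens A B a b) \<in> lin_map A (TAB)"
  by (rule lin_mapI) (auto simp: tens_add_left tens_smult_left)

lemma tens_lin_map_right: "a \<in> carrier A \<Longrightarrow> (\<lambda>b. tens A B a b) \<in> lin_map B (TAB)"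
  by (rule lin_mapI) (auto simp: tens_add_right tens_smult_right)

lemma tens_zero_left [simp]: "b \<in> carrier B \<Longrightarrow> tens A B \<zero>\<^bsub>A\<^esub> b = \<zero>\<^bsub>TAB\<^esub>"
  using lin_map_zero[OF A.kalgebra_axioms T.kalgebra_axioms tens_lin_map_left] .

lemma tens_zero_right [simp]: "a \<in> carrier A \<Longrightarrow> tens A B a \<zero>\<^bsub>B\<^esub> = \<zero>\<^bsub>TAB\<^esub>"
  using lin_map_zero[OF B.kalgebra_axioms T.kalgebra_axioms tens_lin_map_right] .

lemma tens_left_alg_hom: "(\<lambda>a. tens A B a \<one>\<^bsub>B\<^esub>) \<in> alg_hom A (TAB)"
  by (rule alg_homI) (auto simp: tens_add_left tens_smult_left tens_mult tens_one)

lemma tens_right_alg_hom: "(\<lambda>b. tens A B \<one>\<^bsub>A\<^esub> b) \<in> alg_hom B (TAB)"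
  by (rule alg_homI) (auto simp: tens_add_right tens_smult_right tens_mult tens_one)

definition bilinear :: "('k, 'c) module \<Rightarrow> ('a \<Rightarrow> 'b \<Rightarrow> 'c) \<Rightarrow> bool" where
  "bilinear V \<beta> \<longleftrightarrow> (\<forall>a\<in>carrier A. \<beta> a \<in> lin_map B V) \<and> (\<forall>b\<in>carrier B. (\<lambda>a. \<beta> a b) \<in> lin_map A V)"

lemma lin_ext_kills_bilin_rels:
  assumes V: "kalgebra V" and bil: "bilinear V \<beta>" and r: "r \<in> bilin_rels A B"
  shows "lin_ext V (case_prod \<beta>) r = \<zero>\<^bsub>V\<^esub>"
proof -
  interpret V: kalgebra V by fact
  have b1: "\<beta> a \<in> lin_map B V" if "a \<in> carrier A" for a using bil that by (simp add: bilinear_def)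
  have b2: "(\<lambda>a. \<beta> a b) \<in> lin_map A V" if "b \<in> carrier B" for b using bil that by (simp add: bilinear_def)
  have cl: "\<beta> a b \<in> carrier V" if "a \<in> carrier A" "b \<in> carrier B" for a b
    using lin_map_closed[OF b1[OF that(1)] that(2)] .
  have L: "lin_ext V (case_prod \<beta>) \<in> lin_map AB V"
    by (rule V.lin_ext_lin_map) (auto simp: cl)
  have diff: "lin_ext V (case_prod \<beta>) (f - g) = lin_ext V (case_prod \<beta>) f \<ominus>\<^bsub>V\<^esub> lin_ext V (case_prod \<beta>) g"
    if "f \<in> carrier AB" "g \<in> carrier AB" for f g
    using that by (simp only: AB_minus lin_map_minus[OF AB.kalgebra_axioms V L])
  have s: "lin_ext V (case_prod \<beta>) (single (a, b) c) = c \<odot>\<^bsub>V\<^esub> \<beta> a b"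
    if "a \<in> carrier A" "b \<in> carrier B" for a b c using that by (simp add: cl)
  have canc: "(x \<oplus>\<^bsub>V\<^esub> y) \<ominus>\<^bsub>V\<^esub> x \<ominus>\<^bsub>V\<^esub> y = \<zero>\<^bsub>V\<^esub>" if "x \<in> carrier V" "y \<in> carrier V" for x y
    using that by (metis V.minus_eq V.add.inv_closed V.add.m_comm V.add.m_lcomm V.a_closed V.r_neg V.r_zero)
  show ?thesis
    using r unfolding bilin_rels_def
    by (safe; simp only: diff s AB_single AB_minus_closed A.a_closed B.a_closed A.smult_closed B.smult_closed
         lin_map_add[OF b1] lin_map_smult[OF b1] lin_map_add[OF b2] lin_map_smult[OF b2] cl V.smult_one V.a_closed
         canc V.smult_closed V.r_right_minus_eq)
qed

text \<open>The tensor product is a quotient by an ideal, while the induced map need not be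
  multiplicative. It kills the ideal because the bilinearity relations are stable under
  multiplication by basis elements on both sides.\<close>

lemma bilinear_descend:
  assumes V: "kalgebra V" and bil: "bilinear V \<beta>"
  shows "\<exists>h \<in> lin_map (TAB) V. \<forall>a\<in>carrier A. \<forall>b\<in>carrier B. h (tens A B a b) = \<beta> a b"
proof -
  interpret V: kalgebra V by fact
  have b1: "\<beta> a \<in> lin_map B V" if "a \<in> carrier A" for a using bil that by (simp add: bilinear_def)
  have cl: "\<beta> a b \<in> carrier V" if "a \<in> carrier A" "b \<in> carrier B" for a b
    using lin_map_closed[OF b1[OF that(1)] that(2)] .
  let ?L = "lin_ext V (case_prod \<beta>)"
  have L: "?L \<in> lin_map AB V"
    by (rule V.lin_ext_lin_map) (auto simp: cl)
  define Z where "Z = {f \<in> carrier AB. ?L f = \<zero>\<^bsub>V\<^esub>}"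
  have "tensor_ideal A B \<subseteq> Z" unfolding tensor_ideal_def
  proof (rule genideal_monoid_alg_subset[OF monoid_prod])
    show "bilin_rels A B \<subseteq> {f. keys f \<subseteq> carrier (A \<times>\<times> B)}"
      using bilin_rels_closed by simp
    show "0 \<in> Z" by (simp add: Z_def)
    show "f + g \<in> Z" if "f \<in> Z" "g \<in> Z" for f g
      using that AB.a_closed[of f g] lin_map_add[OF L, of f g] by (simp add: Z_def)
    show "Poly_Mapping.map ((*) c) f \<in> Z" if "f \<in> Z" for c f
      using that AB.smult_closed[of f c] lin_map_smult[OF L, of f c] by (simp add: Z_def)
  next
    fix u v r assume u: "u \<in> carrier (A \<times>\<times> B)" and v: "v \<in> carrier (A \<times>\<times> B)" and r: "r \<in> bilin_rels A B"
    let ?r = "single u 1 \<otimes>\<^bsub>AB\<^esub> r \<otimes>\<^bsub>AB\<^esub> single v 1"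
    obtain u1 u2 v1 v2 where uv: "u = (u1, u2)" "v = (v1, v2)" by fastforce
    have c: "u1 \<in> carrier A" "v1 \<in> carrier A" "u2 \<in> carrier B" "v2 \<in> carrier B" using u v uv by auto
    \<comment> \<open>Distributivity and compatibility with scalars in both algebras carry each of
      the four families into itself.\<close>
    have "?r \<in> bilin_rels A B"
      using r[unfolded bilin_rels_def]
    proof (elim UnE CollectE exE conjE, goal_cases)
      case (1 a a' b)
      then show ?case using c bilin_relI(1)[of "u1 \<otimes>\<^bsub>A\<^esub> a \<otimes>\<^bsub>A\<^esub> v1" A "u1 \<otimes>\<^bsub>A\<^esub> a' \<otimes>\<^bsub>A\<^esub> v1" "u2 \<otimes>\<^bsub>B\<^esub> b \<otimes>\<^bsub>B\<^esub> v2" B]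
        by (simp add: uv monoid_alg_mult_diff_left monoid_alg_mult_diff_right A.l_distr A.r_distr
            B.l_distr B.r_distr A.smult_mult_l A.smult_mult_r B.smult_mult_l B.smult_mult_r)
    next
      case (2 a b b')
      then show ?case using c bilin_relI(2)[of "u1 \<otimes>\<^bsub>A\<^esub> a \<otimes>\<^bsub>A\<^esub> v1" A "u2 \<otimes>\<^bsub>B\<^esub> b \<otimes>\<^bsub>B\<^esub> v2" B "u2 \<otimes>\<^bsub>B\<^esub> b' \<otimes>\<^bsub>B\<^esub> v2"]
        by (simp add: uv monoid_alg_mult_diff_left monoid_alg_mult_diff_right A.l_distr A.r_distr
            B.l_distr B.r_distr A.smult_mult_l A.smult_mult_r B.smult_mult_l B.smult_mult_r)
    next
      case (3 d a b)
      then show ?case using c bilin_relI(3)[of "u1 \<otimes>\<^bsub>A\<^esub> a \<otimes>\<^bsub>A\<^esub> v1" A "u2 \<otimes>\<^bsub>B\<^esub> b \<otimes>\<^bsub>B\<^esub> v2" B d]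
        by (simp add: uv monoid_alg_mult_diff_left monoid_alg_mult_diff_right A.l_distr A.r_distr
            B.l_distr B.r_distr A.smult_mult_l A.smult_mult_r B.smult_mult_l B.smult_mult_r)
    next
      case (4 d a b)
      then show ?case using c bilin_relI(4)[of "u1 \<otimes>\<^bsub>A\<^esub> a \<otimes>\<^bsub>A\<^esub> v1" A "u2 \<otimes>\<^bsub>B\<^esub> b \<otimes>\<^bsub>B\<^esub> v2" B d]
        by (simp add: uv monoid_alg_mult_diff_left monoid_alg_mult_diff_right A.l_distr A.r_distr
            B.l_distr B.r_distr A.smult_mult_l A.smult_mult_r B.smult_mult_l B.smult_mult_r)
    qed
    then show "?r \<in> Z"
      using lin_ext_kills_bilin_rels[OF V bil] bilin_rels_closed by (auto simp: Z_def)
  qed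
  then have kill: "?L j = \<zero>\<^bsub>V\<^esub>" if "j \<in> tensor_ideal A B" for j using that by (auto simp: Z_def)
  show ?thesis
  proof (intro bexI ballI)
    show "descend ?L \<in> lin_map (TAB) V"
      unfolding tensor_alg_eq by (rule TI.descend_lin_map[OF V L kill])
    fix a b assume "a \<in> carrier A" "b \<in> carrier B"
    then show "descend ?L (tens A B a b) = \<beta> a b"
      unfolding tens_def by (simp add: TI.descend_lin_map_coset[OF V L kill] cl)
  qed
qed

text \<open>Here the extension to the monoid algebra is multiplicative, so its kernel is an ideal
  and the relations alone have to be checked.\<close>

lemma bilinear_descend_alg_hom:
  assumes C: "kalgebra C" and bil: "bilinear C \<beta>"
    and mult: "\<And>a b a' b'. a \<in> carrier A \<Longrightarrow> b \<in> carrier B \<Longrightarrow> a' \<in> carrier A \<Longrightarrow> b' \<in> carrier B \<Longrightarrow>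
      \<beta> (a \<otimes>\<^bsub>A\<^esub> a') (b \<otimes>\<^bsub>B\<^esub> b') = \<beta> a b \<otimes>\<^bsub>C\<^esub> \<beta> a' b'"
    and one: "\<beta> \<one>\<^bsub>A\<^esub> \<one>\<^bsub>B\<^esub> = \<one>\<^bsub>C\<^esub>"
  shows "\<exists>h \<in> alg_hom (TAB) C. \<forall>a\<in>carrier A. \<forall>b\<in>carrier B. h (tens A B a b) = \<beta> a b"
proof -
  interpret C: kalgebra C by fact
  have b1: "\<beta> a \<in> lin_map B C" if "a \<in> carrier A" for a using bil that by (simp add: bilinear_def)
  have cl: "\<beta> a b \<in> carrier C" if "a \<in> carrier A" "b \<in> carrier B" for a b
    using lin_map_closed[OF b1[OF that(1)] that(2)] .
  let ?L = "lin_ext C (case_prod \<beta>)"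
  have L: "?L \<in> alg_hom AB C"
    by (rule C.lin_ext_alg_hom[OF monoid_prod]) (auto simp: cl mult one)
  have kill: "?L j = \<zero>\<^bsub>C\<^esub>" if "j \<in> tensor_ideal A B" for j
    by (rule alg_hom_kills_genideal[OF AB.kalgebra_axioms C L bilin_rels_closed
          lin_ext_kills_bilin_rels[OF C bil] that[unfolded tensor_ideal_def]])
  show ?thesis
  proof (intro bexI ballI)
    show "descend ?L \<in> alg_hom (TAB) C"
      unfolding tensor_alg_eq by (rule TI.descend_alg_hom[OF C L kill])
    fix a b assume "a \<in> carrier A" "b \<in> carrier B"
    then show "descend ?L (tens A B a b) = \<beta> a b"
      unfolding tens_def by (simp add: TI.descend_lin_map_coset[OF C alg_hom_lin_map[OF L] kill] cl)
  qed
qed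

end

text \<open>Shows that the choice in \<open>tensor_map\<close> is made from a nonempty set:
  \<open>(a, b)\<close> mapped to \<open>tens C D (f a) (g b)\<close> is bilinear and
  multiplicative.\<close>

lemma tensor_map_spec:
  assumes "kalgebra A" "kalgebra B" "kalgebra C" "kalgebra D" "f \<in> alg_hom A C" "g \<in> alg_hom B D"
  shows "tensor_map A B C D f g \<in> alg_hom (tensor_alg A B) (tensor_alg C D)"
    and "a \<in> carrier A \<Longrightarrow> b \<in> carrier B \<Longrightarrow> tensor_map A B C D f g (tens A B a b) = tens C D (f a) (g b)"
proof -
  interpret AB: kalgebra_pair A B using assms by (intro kalgebra_pair.intro)
  interpret CD: kalgebra_pair C D using assms by (intro kalgebra_pair.intro)
  note f = alg_hom_closed[OF assms(5)] alg_hom_mult[OF assms(5)] alg_hom_add[OF assms(5)] alg_hom_one[OF assms(5)]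
    alg_hom_smult[OF assms(5)]
  note g = alg_hom_closed[OF assms(6)] alg_hom_mult[OF assms(6)] alg_hom_add[OF assms(6)] alg_hom_one[OF assms(6)]
    alg_hom_smult[OF assms(6)]
  have "AB.bilinear (tensor_alg C D) (\<lambda>a b. tens C D (f a) (g b))"
    unfolding AB.bilinear_def
    by (auto intro!: lin_mapI simp: f g CD.tens_add_left CD.tens_add_right CD.tens_smult_left CD.tens_smult_right)
  then have "\<exists>h \<in> alg_hom (tensor_alg A B) (tensor_alg C D).
      \<forall>a\<in>carrier A. \<forall>b\<in>carrier B. h (tens A B a b) = tens C D (f a) (g b)"
    by (rule AB.bilinear_descend_alg_hom[OF CD.T.kalgebra_axioms]) (simp_all add: f g CD.tens_mult CD.tens_one)
  then have "\<exists>h. h \<in> alg_hom (tensor_alg A B) (tensor_alg C D) \<and>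
        (\<forall>a \<in> carrier A. \<forall>b \<in> carrier B. h (tens A B a b) = tens C D (f a) (g b))"
    by blast
  from someI_ex[OF this]
  show "tensor_map A B C D f g \<in> alg_hom (tensor_alg A B) (tensor_alg C D)"
    and "a \<in> carrier A \<Longrightarrow> b \<in> carrier B \<Longrightarrow> tensor_map A B C D f g (tens A B a b) = tens C D (f a) (g b)"
    unfolding tensor_map_def by auto
qed

section \<open>Quantum matrices\<close>

context abelian_monoid
begin

lemma finsum_eqI:
  assumes "\<And>i. i \<in> I \<Longrightarrow> f i = g i" "\<And>i. i \<in> I \<Longrightarrow> g i \<in> carrier G"
  shows "finsum G f I = finsum G g I"
  using assms by (intro finsum_cong') auto

lemma finsum_swap:
  assumes "finite I" "finite J" "\<And>i j. i \<in> I \<Longrightarrow> j \<in> J \<Longrightarrow> f i j \<in> carrier G"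
  shows "(\<Oplus>i\<in>I. \<Oplus>j\<in>J. f i j) = (\<Oplus>j\<in>J. \<Oplus>i\<in>I. f i j)"
  using assms(1,3)
proof (induction I rule: finite_induct)
  case (insert x F)
  have "(\<Oplus>i\<in>insert x F. \<Oplus>j\<in>J. f i j) = (\<Oplus>j\<in>J. f x j) \<oplus> (\<Oplus>i\<in>F. \<Oplus>j\<in>J. f i j)"
    using insert by (subst finsum_insert) auto
  also have "\<dots> = (\<Oplus>j\<in>J. f x j \<oplus> (\<Oplus>i\<in>F. f i j))"
    using insert by (subst finsum_addf) auto
  also have "\<dots> = (\<Oplus>j\<in>J. \<Oplus>i\<in>insert x F. f i j)"
    using insert by (intro finsum_eqI) auto
  finally show ?case .
qed auto

end

text \<open>The relations apart from the determinant, as a predicate on matrices over any algebra: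
  it is applied to the generators, to their images under homomorphisms and to matrices over tensor
  squares.\<close>

definition qmatrix :: "('k::field, 'a) module \<Rightarrow> nat set \<Rightarrow> 'k \<Rightarrow> (nat \<Rightarrow> nat \<Rightarrow> 'a) \<Rightarrow> bool" where
  "qmatrix A I q x \<longleftrightarrow>
     (\<forall>i\<in>I. \<forall>j\<in>I. x i j \<in> carrier A) \<and>
     (\<forall>i\<in>I. \<forall>j\<in>I. \<forall>m\<in>I. j < m \<longrightarrow>
        x i j \<otimes>\<^bsub>A\<^esub> x i m = q \<odot>\<^bsub>A\<^esub> (x i m \<otimes>\<^bsub>A\<^esub> x i j)) \<and>
     (\<forall>i\<in>I. \<forall>j\<in>I. \<forall>l\<in>I. i < l \<longrightarrow>
        x i j \<otimes>\<^bsub>A\<^esub> x l j = q \<odot>\<^bsub>A\<^esub> (x l j \<otimes>\<^bsub>A\<^esub> x i j)) \<and>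
     (\<forall>i\<in>I. \<forall>j\<in>I. \<forall>l\<in>I. \<forall>m\<in>I. i < l \<longrightarrow> m < j \<longrightarrow>
        x i j \<otimes>\<^bsub>A\<^esub> x l m = x l m \<otimes>\<^bsub>A\<^esub> x i j) \<and>
     (\<forall>i\<in>I. \<forall>j\<in>I. \<forall>l\<in>I. \<forall>m\<in>I. i < l \<longrightarrow> j < m \<longrightarrow>
        x i j \<otimes>\<^bsub>A\<^esub> x l m = x l m \<otimes>\<^bsub>A\<^esub> x i j \<oplus>\<^bsub>A\<^esub> (q - inverse q) \<odot>\<^bsub>A\<^esub> (x i m \<otimes>\<^bsub>A\<^esub> x l j))"

lemma qmatrixD:
  assumes "qmatrix A I q x"
  shows "i \<in> I \<Longrightarrow> j \<in> I \<Longrightarrow> x i j \<in> carrier A"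
    and "i \<in> I \<Longrightarrow> j \<in> I \<Longrightarrow> m \<in> I \<Longrightarrow> j < m \<Longrightarrow>
        x i j \<otimes>\<^bsub>A\<^esub> x i m = q \<odot>\<^bsub>A\<^esub> (x i m \<otimes>\<^bsub>A\<^esub> x i j)"
    and "i \<in> I \<Longrightarrow> j \<in> I \<Longrightarrow> l \<in> I \<Longrightarrow> i < l \<Longrightarrow>
        x i j \<otimes>\<^bsub>A\<^esub> x l j = q \<odot>\<^bsub>A\<^esub> (x l j \<otimes>\<^bsub>A\<^esub> x i j)"
    and "i \<in> I \<Longrightarrow> j \<in> I \<Longrightarrow> l \<in> I \<Longrightarrow> m \<in> I \<Longrightarrow> i < l \<Longrightarrow> m < j \<Longrightarrow>
        x i j \<otimes>\<^bsub>A\<^esub> x l m = x l m \<otimes>\<^bsub>A\<^esub> x i j"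
    and "i \<in> I \<Longrightarrow> j \<in> I \<Longrightarrow> l \<in> I \<Longrightarrow> m \<in> I \<Longrightarrow> i < l \<Longrightarrow> j < m \<Longrightarrow>
        x i j \<otimes>\<^bsub>A\<^esub> x l m = x l m \<otimes>\<^bsub>A\<^esub> x i j \<oplus>\<^bsub>A\<^esub> (q - inverse q) \<odot>\<^bsub>A\<^esub> (x i m \<otimes>\<^bsub>A\<^esub> x l j)"
  apply (rule assms[unfolded qmatrix_def, THEN conjunct1, rule_format]; assumption)
  apply (rule assms[unfolded qmatrix_def, THEN conjunct2, THEN conjunct1, rule_format]; assumption)
  apply (rule assms[unfolded qmatrix_def, THEN conjunct2, THEN conjunct2, THEN conjunct1, rule_format]; assumption)
  apply (rule assms[unfolded qmatrix_def, THEN conjunct2, THEN conjunct2, THEN conjunct2, THEN conjunct1, rule_format]; assumption)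
  apply (rule assms[unfolded qmatrix_def, THEN conjunct2, THEN conjunct2, THEN conjunct2, THEN conjunct2, rule_format]; assumption)
  done

definition R_swap :: "'k::field \<Rightarrow> nat \<Rightarrow> nat \<Rightarrow> 'k" where
  "R_swap q i j = (if i = j then q else 1)"

definition R_stay :: "'k::field \<Rightarrow> nat \<Rightarrow> nat \<Rightarrow> 'k" where
  "R_stay q i j = (if i < j then q - inverse q else 0)"

text \<open>With \<open>R\<close> the operator \<open>e\<^sub>i \<otimes> e\<^sub>j \<mapsto> R_swap q i j (e\<^sub>j \<otimes> e\<^sub>i) + R_stay q i j (e\<^sub>i \<otimes> e\<^sub>j)\<close>, the relations say
  that \<open>R\<close> commutes with \<open>X \<otimes> X\<close>.  This form is visibly stable under products of two matrices
  whose entries commute with each other.\<close>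

definition R_commute :: "('k::field, 'a) module \<Rightarrow> nat set \<Rightarrow> 'k \<Rightarrow> (nat \<Rightarrow> nat \<Rightarrow> 'a) \<Rightarrow> bool" where
  "R_commute A I q x \<longleftrightarrow>
     (\<forall>i\<in>I. \<forall>j\<in>I. \<forall>m\<in>I. \<forall>l\<in>I.
        R_swap q i j \<odot>\<^bsub>A\<^esub> (x j m \<otimes>\<^bsub>A\<^esub> x i l) \<oplus>\<^bsub>A\<^esub> R_stay q i j \<odot>\<^bsub>A\<^esub> (x i m \<otimes>\<^bsub>A\<^esub> x j l)
      = R_swap q m l \<odot>\<^bsub>A\<^esub> (x i l \<otimes>\<^bsub>A\<^esub> x j m) \<oplus>\<^bsub>A\<^esub> R_stay q m l \<odot>\<^bsub>A\<^esub> (x i m \<otimes>\<^bsub>A\<^esub> x j l))"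

context kalgebra
begin

lemma smult_add_same: "u \<in> carrier A \<Longrightarrow> u \<oplus> c \<odot> u = (1 + c) \<odot> u" "u \<in> carrier A \<Longrightarrow> c \<odot> u \<oplus> u = (c + 1) \<odot> u"
  by (simp_all add: smult_l_distr)

text \<open>The nine cases compare \<open>i\<close> with \<open>j\<close> and \<open>m\<close> with
  \<open>l\<close>; each is a single relation of the quantum matrix up to reordering.\<close>

lemma qmatrix_R_commute:
  assumes "qmatrix A I q x" "q \<noteq> 0"
  shows "R_commute A I q x"
  unfolding R_commute_def
proof (intro ballI)
  note D = qmatrixD[OF assms(1)]
  fix i j m l assume ij: "i \<in> I" "j \<in> I" "m \<in> I" "l \<in> I"
  have c: "x a b \<otimes> x c d \<in> carrier A" if "a \<in> I" "b \<in> I" "c \<in> I" "d \<in> I" for a b c d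
    using D(1) that by auto
  note c' = c[OF ij(1,3,2,4)] c[OF ij(1,4,2,3)] c[OF ij(2,3,1,4)] c[OF ij(2,4,1,3)]
    c[OF ij(1,3,1,3)] c[OF ij(1,3,1,4)] c[OF ij(1,4,1,3)] c[OF ij(1,3,2,3)]  c[OF ij(2,3,1,3)]
  note S = smult_assoc smult_l_distr[symmetric] smult_add_same
  \<comment> \<open>This says that \<open>q\<close> is a root of the Hecke equation
    \<open>t\<^sup>2 = 1 + (q - inverse q) t\<close> of \<open>R\<close>; it enters when two entries
    share a row or a column.\<close>
  have qq: "1 + (q - inverse q) * q = q * q"
    using assms(2) by (simp add: left_diff_distrib)
  consider "i = j" "m = l" | "i = j" "m < l" | "i = j" "l < m" | "i < j" "m = l" | "j < i" "m = l"
    | "i < j" "m < l" | "i < j" "l < m" | "j < i" "m < l" | "j < i" "l < m" by linarith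
  then show "R_swap q i j \<odot> (x j m \<otimes> x i l) \<oplus> R_stay q i j \<odot> (x i m \<otimes> x j l)
      = R_swap q m l \<odot> (x i l \<otimes> x j m) \<oplus> R_stay q m l \<odot> (x i m \<otimes> x j l)"
  proof cases
    case 1 then show ?thesis by (simp add: R_swap_def R_stay_def)
  next
    case 2
    then have "x i m \<otimes> x i l = q \<odot> (x i l \<otimes> x i m)" using D(2) ij by auto
    then show ?thesis using 2 c' by (simp add: R_swap_def R_stay_def S qq)
  next
    case 3
    then have "x i l \<otimes> x i m = q \<odot> (x i m \<otimes> x i l)" using D(2) ij by auto
    then show ?thesis using 3 c' by (simp add: R_swap_def R_stay_def S)
  next
    case 4
    then have "x i m \<otimes> x j m = q \<odot> (x j m \<otimes> x i m)" using D(3) ij by auto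
    then show ?thesis using 4 c' by (simp add: R_swap_def R_stay_def S qq)
  next
    case 5
    then have "x j m \<otimes> x i m = q \<odot> (x i m \<otimes> x j m)" using D(3) ij by auto
    then show ?thesis using 5 c' by (simp add: R_swap_def R_stay_def S)
  next
    case 6
    then have "x i l \<otimes> x j m = x j m \<otimes> x i l" using D(4) ij by auto
    then show ?thesis using 6 c' by (simp add: R_swap_def R_stay_def)
  next
    case 7
    then have "x i l \<otimes> x j m = x j m \<otimes> x i l \<oplus> (q - inverse q) \<odot> (x i m \<otimes> x j l)" using D(5) ij by auto
    then show ?thesis using 7 c' by (simp add: R_swap_def R_stay_def)
  next
    case 8
    then have "x j m \<otimes> x i l = x i l \<otimes> x j m \<oplus> (q - inverse q) \<odot> (x j l \<otimes> x i m)" using D(5) ij by auto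
    moreover have "x j l \<otimes> x i m = x i m \<otimes> x j l" using 8 D(4) ij by auto
    ultimately show ?thesis using 8 c' by (simp add: R_swap_def R_stay_def)
  next
    case 9
    then have "x j m \<otimes> x i l = x i l \<otimes> x j m" using D(4) ij by auto
    then show ?thesis using 9 c' by (simp add: R_swap_def R_stay_def)
  qed
qed

lemma R_commute_qmatrix:
  assumes R: "R_commute A I q x" and "q \<noteq> 0" and x: "\<And>i j. i \<in> I \<Longrightarrow> j \<in> I \<Longrightarrow> x i j \<in> carrier A"
  shows "qmatrix A I q x"
proof -
  have R': "R_swap q i j \<odot> (x j m \<otimes> x i l) \<oplus> R_stay q i j \<odot> (x i m \<otimes> x j l)
      = R_swap q m l \<odot> (x i l \<otimes> x j m) \<oplus> R_stay q m l \<odot> (x i m \<otimes> x j l)"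
    if "i \<in> I" "j \<in> I" "m \<in> I" "l \<in> I" for i j m l
    using R that unfolding R_commute_def by blast
  have comm: "x i j \<otimes> x l m = x l m \<otimes> x i j"
    if "i \<in> I" "j \<in> I" "l \<in> I" "m \<in> I" "i < l" "m < j" for i j l m
    using R'[of l i j m] that x by (simp add: R_swap_def R_stay_def)
  show ?thesis
    unfolding qmatrix_def
    apply (intro conjI ballI impI)
    subgoal by (rule x)
    subgoal for i j m using R'[of i i m j] x by (simp add: R_swap_def R_stay_def)
    subgoal for i j l using R'[of l i j j] x by (simp add: R_swap_def R_stay_def)
    subgoal by (rule comm)
    \<comment> \<open>The matrix equation yields the cross term as \<open>x l j\<close> times
      \<open>x i m\<close>; the previous relation puts its factors in the required order.\<close>
    subgoal for i j l m using R'[of l i j m] comm[of i m l j] x by (simp add: R_swap_def R_stay_def)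
    done
qed

end

section \<open>Products of quantum matrices with mutually commuting entries\<close>

definition mat_prod :: "('k, 'a) module \<Rightarrow> nat set \<Rightarrow> (nat \<Rightarrow> nat \<Rightarrow> 'a) \<Rightarrow> (nat \<Rightarrow> nat \<Rightarrow> 'a) \<Rightarrow> nat \<Rightarrow> nat \<Rightarrow> 'a" where
  "mat_prod A I x y i j = (\<Oplus>\<^bsub>A\<^esub>r\<in>I. x i r \<otimes>\<^bsub>A\<^esub> y r j)"

text \<open>Modelled on the matrices with entries \<open>X i j \<otimes> 1\<close> and
  \<open>1 \<otimes> X i j\<close> over a tensor square; their product has the comultiplications of
  the \<open>X i j\<close> as its entries.\<close>

locale qmatrix_pair = kalgebra A for A :: "('k::field, 'a) module" (structure) +
  fixes I :: "nat set" and q :: 'k and x y :: "nat \<Rightarrow> nat \<Rightarrow> 'a"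
  assumes fin [simp]: "finite I" and q0: "q \<noteq> 0" and qx: "qmatrix A I q x" and qy: "qmatrix A I q y"
    and commute: "\<And>i j k l. i \<in> I \<Longrightarrow> j \<in> I \<Longrightarrow> k \<in> I \<Longrightarrow> l \<in> I \<Longrightarrow>
      x i j \<otimes> y k l = y k l \<otimes> x i j"
begin

lemma x_car [simp]: "i \<in> I \<Longrightarrow> j \<in> I \<Longrightarrow> x i j \<in> carrier A"
  and y_car [simp]: "i \<in> I \<Longrightarrow> j \<in> I \<Longrightarrow> y i j \<in> carrier A"
  using qmatrixD(1)[OF qx] qmatrixD(1)[OF qy] by auto

abbreviation z where "z \<equiv> mat_prod A I x y"

lemma z_car [simp]: "i \<in> I \<Longrightarrow> j \<in> I \<Longrightarrow> z i j \<in> carrier A"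
  unfolding mat_prod_def by (intro finsum_closed Pi_I) simp

abbreviation dsum where "dsum f \<equiv> (\<Oplus>r\<in>I. \<Oplus>s\<in>I. f r s)"

lemma dsum_eqI:
  assumes "\<And>r s. r \<in> I \<Longrightarrow> s \<in> I \<Longrightarrow> f r s = g r s"
    "\<And>r s. r \<in> I \<Longrightarrow> s \<in> I \<Longrightarrow> g r s \<in> carrier A"
  shows "dsum f = dsum g"
  using assms by (intro finsum_eqI finsum_closed Pi_I) simp_all

lemma dsum_add:
  assumes "\<And>r s. r \<in> I \<Longrightarrow> s \<in> I \<Longrightarrow> f r s \<in> carrier A"
    "\<And>r s. r \<in> I \<Longrightarrow> s \<in> I \<Longrightarrow> g r s \<in> carrier A"
  shows "dsum (\<lambda>r s. f r s \<oplus> g r s) = dsum f \<oplus> dsum g"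
proof -
  have "dsum (\<lambda>r s. f r s \<oplus> g r s) = (\<Oplus>r\<in>I. (\<Oplus>s\<in>I. f r s) \<oplus> (\<Oplus>s\<in>I. g r s))"
    using assms by (intro finsum_eqI finsum_addf finsum_closed a_closed Pi_I) simp_all
  also have "\<dots> = dsum f \<oplus> dsum g"
    using assms by (intro finsum_addf finsum_closed Pi_I) simp_all
  finally show ?thesis .
qed

lemma dsum_smult:
  assumes "\<And>r s. r \<in> I \<Longrightarrow> s \<in> I \<Longrightarrow> f r s \<in> carrier A"
  shows "c \<odot> dsum f = dsum (\<lambda>r s. c \<odot> f r s)"
proof -
  have "c \<odot> dsum f = (\<Oplus>r\<in>I. c \<odot> (\<Oplus>s\<in>I. f r s))"
    using assms by (intro smult_finsum finsum_closed Pi_I) simp_all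
  also have "\<dots> = dsum (\<lambda>r s. c \<odot> f r s)"
    using assms by (intro finsum_eqI smult_finsum finsum_closed smult_closed Pi_I) simp_all
  finally show ?thesis .
qed

lemma dsum_swap:
  assumes "\<And>r s. r \<in> I \<Longrightarrow> s \<in> I \<Longrightarrow> f r s \<in> carrier A"
  shows "dsum f = dsum (\<lambda>r s. f s r)"
  using assms by (intro finsum_swap) simp_all

text \<open>Moving \<open>y r m\<close> past \<open>x j s\<close> separates the factors, so the
  tensor square of the product is the product of the tensor squares.\<close>

lemma z_mult:
  assumes "i \<in> I" "j \<in> I" "m \<in> I" "l \<in> I"
  shows "z i m \<otimes> z j l = dsum (\<lambda>r s. (x i r \<otimes> x j s) \<otimes> (y r m \<otimes> y s l))"
proof -
  have "z i m \<otimes> z j l = (\<Oplus>r\<in>I. (x i r \<otimes> y r m) \<otimes> z j l)"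
    unfolding mat_prod_def[of A I x y i m] using assms by (intro finsum_ldistr Pi_I) simp_all
  also have "\<dots> = dsum (\<lambda>r s. (x i r \<otimes> y r m) \<otimes> (x j s \<otimes> y s l))"
    unfolding mat_prod_def[of A I x y j l] using assms
    by (intro finsum_eqI finsum_rdistr finsum_closed Pi_I) simp_all
  also have "\<dots> = dsum (\<lambda>r s. (x i r \<otimes> x j s) \<otimes> (y r m \<otimes> y s l))"
  proof (rule dsum_eqI)
    fix r s assume rs: "r \<in> I" "s \<in> I"
    have "(x i r \<otimes> y r m) \<otimes> (x j s \<otimes> y s l) = x i r \<otimes> (y r m \<otimes> x j s) \<otimes> y s l"
      using assms rs by (simp add: m_assoc)
    also have "\<dots> = (x i r \<otimes> x j s) \<otimes> (y r m \<otimes> y s l)"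
      using assms rs by (simp add: m_assoc commute[symmetric])
    finally show "(x i r \<otimes> y r m) \<otimes> (x j s \<otimes> y s l) = (x i r \<otimes> x j s) \<otimes> (y r m \<otimes> y s l)" .
    show "(x i r \<otimes> x j s) \<otimes> (y r m \<otimes> y s l) \<in> carrier A" using assms rs by simp
  qed
  finally show ?thesis .
qed

text \<open>\<open>R\<close> commutes with the tensor square of \<open>x\<close> and with that of
  \<open>y\<close>, hence with their product. The calculation carries \<open>R\<close> through the
  two factors in turn.\<close>

lemma qmatrix_mat_prod: "qmatrix A I q z"
proof (rule R_commute_qmatrix)
  show "R_commute A I q z"
    unfolding R_commute_def
  proof (intro ballI)
    fix i j m l assume ij: "i \<in> I" "j \<in> I" "m \<in> I" "l \<in> I"
    note [simp] = ij
    let ?b = "R_swap q" and ?a = "R_stay q"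
    let ?t = "\<lambda>i r j s k m k' l. (x i r \<otimes> x j s) \<otimes> (y k m \<otimes> y k' l)"
    have Rx: "?b i j \<odot> (x j m \<otimes> x i l) \<oplus> ?a i j \<odot> (x i m \<otimes> x j l)
      = ?b m l \<odot> (x i l \<otimes> x j m) \<oplus> ?a m l \<odot> (x i m \<otimes> x j l)"
      if "i \<in> I" "j \<in> I" "m \<in> I" "l \<in> I" for i j m l
      using qmatrix_R_commute[OF qx q0] that unfolding R_commute_def by blast
    have Ry: "?b i j \<odot> (y j m \<otimes> y i l) \<oplus> ?a i j \<odot> (y i m \<otimes> y j l)
      = ?b m l \<odot> (y i l \<otimes> y j m) \<oplus> ?a m l \<odot> (y i m \<otimes> y j l)"
      if "i \<in> I" "j \<in> I" "m \<in> I" "l \<in> I" for i j m l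
      using qmatrix_R_commute[OF qy q0] that unfolding R_commute_def by blast
    have bsym: "?b s r = ?b r s" for r s by (auto simp: R_swap_def)
    have "?b i j \<odot> (z j m \<otimes> z i l) \<oplus> ?a i j \<odot> (z i m \<otimes> z j l)
      = dsum (\<lambda>r s. ?b i j \<odot> ?t j r i s r m s l)
        \<oplus> dsum (\<lambda>r s. ?a i j \<odot> ?t i r j s r m s l)"
      by (simp add: z_mult dsum_smult)
    also have "\<dots> = dsum (\<lambda>r s. ?b i j \<odot> ?t j r i s r m s l
        \<oplus> ?a i j \<odot> ?t i r j s r m s l)"
      by (rule dsum_add[symmetric]) simp_all
    \<comment> \<open>First passage: \<open>R\<close> moves from the outer row indices
      \<open>i\<close>, \<open>j\<close> to the summation indices \<open>r\<close>,
      \<open>s\<close>.\<close>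
    also have "\<dots> = dsum (\<lambda>r s. ?b r s \<odot> ?t i s j r r m s l
        \<oplus> ?a r s \<odot> ?t i r j s r m s l)"
      apply (rule dsum_eqI)
      subgoal for r s
        using arg_cong[OF Rx[of i j r s], of "\<lambda>u. u \<otimes> (y r m \<otimes> y s l)"] by (simp add: l_distr smult_mult_l)
      by simp
    also have "\<dots> = dsum (\<lambda>r s. ?b r s \<odot> ?t i s j r r m s l)
        \<oplus> dsum (\<lambda>r s. ?a r s \<odot> ?t i r j s r m s l)"
      by (rule dsum_add) simp_all
    \<comment> \<open>Renaming the summation indices gives both sums the common left factor
      \<open>x i r\<close> times \<open>x j s\<close>, so that the relation for \<open>y\<close> can
      be applied.\<close>
    also have "dsum (\<lambda>r s. ?b r s \<odot> ?t i s j r r m s l)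
      = dsum (\<lambda>r s. ?b s r \<odot> ?t i r j s s m r l)"
      by (rule dsum_swap) simp_all
    also have "\<dots> \<oplus> dsum (\<lambda>r s. ?a r s \<odot> ?t i r j s r m s l)
      = dsum (\<lambda>r s. ?b s r \<odot> ?t i r j s s m r l
        \<oplus> ?a r s \<odot> ?t i r j s r m s l)"
      by (rule dsum_add[symmetric]) simp_all
    \<comment> \<open>Second passage: \<open>R\<close> moves from the summation indices to the outer
      column indices \<open>m\<close>, \<open>l\<close>.\<close>
    also have "\<dots> = dsum (\<lambda>r s. ?b m l \<odot> ?t i r j s r l s m
        \<oplus> ?a m l \<odot> ?t i r j s r m s l)"
      apply (rule dsum_eqI)
      subgoal for r s
        using arg_cong[OF Ry[of r s m l], of "\<lambda>u. (x i r \<otimes> x j s) \<otimes> u"]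
        by (simp add: r_distr smult_mult_r bsym)
      by simp
    also have "\<dots> = dsum (\<lambda>r s. ?b m l \<odot> ?t i r j s r l s m)
        \<oplus> dsum (\<lambda>r s. ?a m l \<odot> ?t i r j s r m s l)"
      by (rule dsum_add) simp_all
    also have "\<dots> = ?b m l \<odot> (z i l \<otimes> z j m) \<oplus> ?a m l \<odot> (z i m \<otimes> z j l)"
      by (simp add: z_mult dsum_smult)
    finally show "?b i j \<odot> (z j m \<otimes> z i l) \<oplus> ?a i j \<odot> (z i m \<otimes> z j l)
      = ?b m l \<odot> (z i l \<otimes> z j m) \<oplus> ?a m l \<odot> (z i m \<otimes> z j l)" .
  qed
qed (use q0 z_car in auto)

end

section \<open>Quantum determinants\<close>

text \<open>The length of a permutation in one-line notation. Lists with repetitions are allowed,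
  since it also measures the progress of sorting a list of rows.\<close>

fun ninv :: "nat list \<Rightarrow> nat" where
  "ninv [] = 0"
| "ninv (c # cs) = length (filter (\<lambda>d. d < c) cs) + ninv cs"

lemma ninv_swap: "a < b \<Longrightarrow> ninv (us @ b # a # vs) = Suc (ninv (us @ a # b # vs))"
  by (induction us) auto

lemma ninv_sorted: "sorted_wrt (<) cs \<Longrightarrow> ninv cs = 0"
proof (induction cs)
  case (Cons c cs)
  then have "filter (\<lambda>d. d < c) cs = []" by (auto simp: filter_empty_conv)
  then show ?case using Cons by simp
qed simp

lemma not_sorted_adjacent:
  assumes "\<not> sorted_wrt (<) (ks :: nat list)"
  obtains us r s vs where "ks = us @ r # s # vs" "s \<le> r"
proof -
  obtain i where "Suc i < length ks" "\<not> ks ! i < ks ! Suc i"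
    using assms sorted_wrt_iff_nth_Suc_transp[of "(<)" ks] by auto
  then show ?thesis
    using that[of "take i ks" "ks ! i" "ks ! Suc i" "drop (Suc (Suc i)) ks"]
    by (simp add: Cons_nth_drop_Suc id_take_nth_drop[symmetric])
qed

text \<open>Induction on the length of the interval: the inversions whose first index is
  \<open>a\<close> are those counted by the filter in \<open>ninv\<close>, and the others belong to
  the tail.\<close>

lemma ninv_upt:
  "ninv (map \<sigma> [a..<b]) = card {(i, j). i \<in> {a..<b} \<and> j \<in> {a..<b} \<and> i < j \<and> \<sigma> j < \<sigma> i}"
proof (induction "b - a" arbitrary: a)
  case (Suc m)
  then have ab: "a < b" by simp
  let ?S = "\<lambda>a. {(i, j). i \<in> {a..<b} \<and> j \<in> {a..<b} \<and> i < j \<and> \<sigma> j < \<sigma> i}"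
  have fin: "finite (?S c)" for c
    by (rule finite_subset[of _ "{c..<b} \<times> {c..<b}"]) auto
  have "?S a = (\<lambda>j. (a, j)) ` {j \<in> {Suc a..<b}. \<sigma> j < \<sigma> a} \<union> ?S (Suc a)"
    by (auto simp: Suc_le_eq order.order_iff_strict)
  then have "card (?S a) = card ((\<lambda>j. (a, j)) ` {j \<in> {Suc a..<b}. \<sigma> j < \<sigma> a} \<union> ?S (Suc a))"
    by (rule arg_cong)
  also have "\<dots> = card ((\<lambda>j. (a, j)) ` {j \<in> {Suc a..<b}. \<sigma> j < \<sigma> a}) + card (?S (Suc a))"
    using fin by (intro card_Un_disjoint) auto
  also have "card ((\<lambda>j. (a, j)) ` {j \<in> {Suc a..<b}. \<sigma> j < \<sigma> a}) = card {j \<in> {Suc a..<b}. \<sigma> j < \<sigma> a}"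
    by (intro card_image inj_onI) auto
  also have "\<dots> = length (filter (\<lambda>j. \<sigma> j < \<sigma> a) [Suc a..<b])"
    by (subst distinct_card[symmetric]) (auto intro!: arg_cong[where f = card])
  also have "\<dots> = length (filter (\<lambda>d. d < \<sigma> a) (map \<sigma> [Suc a..<b]))"
    by (simp add: filter_map comp_def)
  also have "card (?S (Suc a)) = ninv (map \<sigma> [Suc a..<b])"
    using Suc by (intro Suc(1)[symmetric]) simp
  finally show ?case using ab by (simp add: upt_conv_Cons)
qed auto

text \<open>Row indices and column indices are kept in separate lists, so that rows can be permuted
  with the columns fixed. As \<open>zip\<close> truncates, lists of equal length are
  intended.\<close>

definition word_prod :: "('k, 'a) module \<Rightarrow> (nat \<Rightarrow> nat \<Rightarrow> 'a) \<Rightarrow> nat list \<Rightarrow> nat list \<Rightarrow> 'a" where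
  "word_prod A x ks cs = foldr (\<lambda>(i, j) y. x i j \<otimes>\<^bsub>A\<^esub> y) (zip ks cs) \<one>\<^bsub>A\<^esub>"

lemma word_prod_simps [simp]:
  "word_prod A x [] cs = \<one>\<^bsub>A\<^esub>" "word_prod A x ks [] = \<one>\<^bsub>A\<^esub>"
  "word_prod A x (k # ks) (c # cs) = x k c \<otimes>\<^bsub>A\<^esub> word_prod A x ks cs"
  by (simp_all add: word_prod_def)

abbreviation slist where "slist I \<equiv> sorted_list_of_set (I :: nat set)"

text \<open>The quantum determinant of the matrix formed by the rows \<open>ks\<close> of
  \<open>x\<close> in the given order, with repetitions allowed; \<open>ks = slist I\<close> gives
  the usual one.\<close>

definition qdet_rows :: "('k::field, 'a) module \<Rightarrow> nat set \<Rightarrow> 'k \<Rightarrow> (nat \<Rightarrow> nat \<Rightarrow> 'a) \<Rightarrow> nat list \<Rightarrow> 'a" where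
  "qdet_rows A I q x ks =
     (\<Oplus>\<^bsub>A\<^esub>cs\<in>permutations_of_set I. (- q) ^ ninv cs \<odot>\<^bsub>A\<^esub> word_prod A x ks cs)"

lemma permutations_of_set_length: "cs \<in> permutations_of_set I \<Longrightarrow> length cs = card I"
  using distinct_card by (fastforce simp: permutations_of_set_def)

context kalgebra
begin

lemma word_prod_closed:
  assumes "\<And>i j. i \<in> I \<Longrightarrow> j \<in> I \<Longrightarrow> x i j \<in> carrier A" "set ks \<subseteq> I" "set cs \<subseteq> I"
  shows "word_prod A x ks cs \<in> carrier A"
  using assms(2,3) by (induction ks cs rule: list_induct2') (auto simp: assms(1))

lemma word_prod_append:
  assumes "\<And>i j. i \<in> I \<Longrightarrow> j \<in> I \<Longrightarrow> x i j \<in> carrier A"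
    and "length us = length us'" "set us \<subseteq> I" "set us' \<subseteq> I" "set vs \<subseteq> I" "set vs' \<subseteq> I"
  shows "word_prod A x (us @ vs) (us' @ vs') = word_prod A x us us' \<otimes> word_prod A x vs vs'"
  using assms(2-)
proof (induction us us' rule: list_induct2)
  case (Cons k ks c cs)
  then show ?case by (simp add: assms(1) m_assoc word_prod_closed[OF assms(1)])
qed (simp add: word_prod_closed[OF assms(1)])

end

locale qmatrix_alg = kalgebra A for A :: "('k::field, 'a) module" (structure) +
  fixes I :: "nat set" and q :: 'k and x :: "nat \<Rightarrow> nat \<Rightarrow> 'a"
  assumes fin [simp]: "finite I" and q0: "q \<noteq> 0" and qx: "qmatrix A I q x"
begin

lemma x_car [simp]: "i \<in> I \<Longrightarrow> j \<in> I \<Longrightarrow> x i j \<in> carrier A"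
  using qmatrixD(1)[OF qx] by auto

text \<open>The left side is the two-by-two quantum minor with both rows equal to \<open>r\<close>;
  the relation inside a row makes it vanish.\<close>

lemma minor_repeated_row:
  assumes "r \<in> I" "a \<in> I" "b \<in> I" "a < b"
  shows "x r a \<otimes> x r b \<oplus> (- q) \<odot> (x r b \<otimes> x r a) = \<zero>"
  using assms qmatrixD(2)[OF qx, of r a b] by (simp add: smult_minus_left r_neg)

text \<open>Antisymmetry up to \<open>- q\<close> of the two-by-two quantum minor. The two relations
  between different rows and columns rewrite the right side in terms of the two monomials on the
  left.\<close>

lemma minor_swap_rows:
  assumes "r \<in> I" "s \<in> I" "a \<in> I" "b \<in> I" "a < b" "s < r"
  shows "x r a \<otimes> x s b \<oplus> (- q) \<odot> (x r b \<otimes> x s a)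
    = (- q) \<odot> (x s a \<otimes> x r b \<oplus> (- q) \<odot> (x s b \<otimes> x r a))"
proof -
  have e1: "x s b \<otimes> x r a = x r a \<otimes> x s b" using qmatrixD(4)[OF qx, of s b r a] assms by simp
  have e2: "x s a \<otimes> x r b = x r b \<otimes> x s a \<oplus> (q - inverse q) \<odot> (x r a \<otimes> x s b)"
    using qmatrixD(5)[OF qx, of s a r b] assms e1 by simp
  define u v where "u = x r b \<otimes> x s a" and "v = x r a \<otimes> x s b"
  have uv: "u \<in> carrier A" "v \<in> carrier A" using assms by (auto simp: u_def v_def)
  have "c \<odot> (u \<oplus> d \<odot> v \<oplus> e \<odot> v) = c \<odot> u \<oplus> (c * d + c * e) \<odot> v" for c d e
    using uv by (simp add: smult_r_distr smult_assoc smult_l_distr a_assoc)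
  then have "(- q) \<odot> (u \<oplus> (q - inverse q) \<odot> v \<oplus> (- q) \<odot> v)
      = (- q) \<odot> u \<oplus> ((- q) * (q - inverse q) + (- q) * (- q)) \<odot> v" .
  \<comment> \<open>One summand comes from the cross term of the mixed relation, the other from the
    second term of the minor.\<close>
  also have "(- q) * (q - inverse q) + (- q) * (- q) = 1" using q0 by (simp add: algebra_simps)
  also have "(- q) \<odot> u \<oplus> 1 \<odot> v = v \<oplus> (- q) \<odot> u" using uv by (simp add: a_comm)
  finally show ?thesis unfolding e2 e1 u_def v_def by simp
qed

lemma qdet_rows_closed: "set ks \<subseteq> I \<Longrightarrow> qdet_rows A I q x ks \<in> carrier A"
  unfolding qdet_rows_def
  by (intro finsum_closed Pi_I smult_closed word_prod_closed) (auto dest: permutations_of_setD)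

text \<open>The permutations are paired by swapping the entries at the positions \<open>p\<close> and \<open>p + 1\<close>; each
  pair contributes a two-by-two quantum minor.\<close>

lemma qdet_rows_pairing:
  assumes "set us \<subseteq> I" "set vs \<subseteq> I" "r \<in> I" "s \<in> I" "length (us @ r # s # vs) = card I"
  defines "p \<equiv> length us"
  shows "qdet_rows A I q x (us @ r # s # vs) = (\<Oplus>cs\<in>{cs \<in> permutations_of_set I. cs ! p < cs ! Suc p}.
    (- q) ^ ninv cs \<odot> (word_prod A x us (take p cs) \<otimes>
      (x r (cs ! p) \<otimes> x s (cs ! Suc p) \<oplus> (- q) \<odot> (x r (cs ! Suc p) \<otimes> x s (cs ! p)))
      \<otimes> word_prod A x vs (drop (Suc (Suc p)) cs)))" (is "_ = finsum _ ?m _")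
proof -
  define ks where "ks = us @ r # s # vs"
  define P where "P = permutations_of_set I"
  define L where "L = {cs \<in> P. cs ! p < cs ! Suc p}"
  define swp where "swp = (\<lambda>cs :: nat list. take p cs @ cs ! Suc p # cs ! p # drop (Suc (Suc p)) cs)"
  define F where "F = (\<lambda>cs. (- q) ^ ninv cs \<odot> word_prod A x ks cs)"
  have dec: "\<exists>u a b v. cs = u @ a # b # v \<and> length u = p" if "cs \<in> P" for cs
  proof -
    have len: "Suc p < length cs" using permutations_of_set_length[of cs I] that assms(5) by (simp add: P_def p_def)
    then have "cs = take p cs @ cs ! p # cs ! Suc p # drop (Suc (Suc p)) cs"
      by (simp add: Cons_nth_drop_Suc id_take_nth_drop[symmetric])
    moreover have "length (take p cs) = p" using len by simp
    ultimately show ?thesis by blast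
  qed
  have decL: "\<exists>u a b v. cs = u @ a # b # v \<and> length u = p" if "cs \<in> L" for cs
    using that dec unfolding L_def by blast
  have swp: "swp (u @ a # b # v) = u @ b # a # v" if "length u = p" for u a b v
    using that by (simp add: swp_def nth_append)
  have inP: "u @ b # a # v \<in> P \<longleftrightarrow> u @ a # b # v \<in> P" for u a b v
    by (auto simp: P_def permutations_of_set_def)
  have inL: "u @ a # b # v \<in> L \<longleftrightarrow> u @ a # b # v \<in> P \<and> a < b" if "length u = p" for u a b v
    using that by (simp add: L_def nth_append)
  \<comment> \<open>Distinct entries make exactly one member of each pair ascending at
    \<open>p\<close>, so \<open>L\<close> is a set of representatives.\<close>
  have neq: "a \<noteq> b" if "u @ a # b # v \<in> P" for u a b v using that by (auto simp: P_def permutations_of_set_def)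
  have split: "P = L \<union> swp ` L"
  proof (intro equalityI subsetI)
    fix cs assume cs: "cs \<in> P"
    then obtain u a b v where u: "cs = u @ a # b # v" "length u = p" using dec by blast
    consider "a < b" | "b < a" using neq cs u by fastforce
    then show "cs \<in> L \<union> swp ` L"
    proof cases
      case 2
      then have "u @ b # a # v \<in> L" using inL u cs inP by blast
      moreover have "cs = swp (u @ b # a # v)" using swp u by simp
      ultimately show ?thesis by blast
    qed (use inL u cs in blast)
  next
    fix cs assume "cs \<in> L \<union> swp ` L"
    then show "cs \<in> P"
    proof
      assume "cs \<in> swp ` L"
      then obtain c where c: "c \<in> L" "cs = swp c" by blast
      then have "c \<in> P" by (simp add: L_def)
      then obtain u a b v where "c = u @ a # b # v" "length u = p" using dec by blast
      then show ?thesis using c swp inL inP by metis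
    qed (simp add: L_def)
  qed
  have disj: "L \<inter> swp ` L = {}"
  proof -
    have "swp c \<notin> L" if c: "c \<in> L" for c
    proof -
      have "c \<in> P" using c by (simp add: L_def)
      then obtain u a b v where "c = u @ a # b # v" "length u = p" using dec by blast
      then show ?thesis using c swp inL by fastforce
    qed
    then show ?thesis by blast
  qed
  have inj: "inj_on swp L"
  proof (rule inj_on_inverseI[where g = swp])
    fix c assume "c \<in> L"
    then obtain u a b v where "c = u @ a # b # v" "length u = p" using decL by blast
    then show "swp (swp c) = c" using swp by simp
  qed
  have finP: "finite P" by (simp add: P_def)
  have finL: "finite L" using finP by (simp add: L_def)
  have Fc: "F cs \<in> carrier A" if "cs \<in> P" for cs
    unfolding F_def ks_def using that assms
    by (intro smult_closed word_prod_closed[of I]) (auto simp: P_def permutations_of_set_def)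
  have "qdet_rows A I q x ks = (\<Oplus>cs\<in>L \<union> swp ` L. F cs)"
    unfolding qdet_rows_def F_def using split by (simp add: P_def)
  also have "\<dots> = (\<Oplus>cs\<in>L. F cs) \<oplus> (\<Oplus>cs\<in>swp ` L. F cs)"
    using finL disj Fc split by (intro finsum_Un_disjoint) auto
  also have "(\<Oplus>cs\<in>swp ` L. F cs) = (\<Oplus>cs\<in>L. F (swp cs))"
    using inj Fc split by (intro finsum_reindex) auto
  also have "(\<Oplus>cs\<in>L. F cs) \<oplus> \<dots> = (\<Oplus>cs\<in>L. F cs \<oplus> F (swp cs))"
    using Fc split by (intro finsum_addf[symmetric]) auto
  also have "\<dots> = (\<Oplus>cs\<in>L. ?m cs)"
  proof (rule finsum_eqI)
    fix cs assume cs: "cs \<in> L"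
    then obtain u a b v where u: "cs = u @ a # b # v" "length u = p" using decL by blast
    then have ab: "a < b" using cs inL by blast
    have mem: "set u \<subseteq> I" "set v \<subseteq> I" "a \<in> I" "b \<in> I"
      using cs u by (auto simp: L_def P_def permutations_of_set_def)
    define W W' where "W = word_prod A x us u" and "W' = word_prod A x vs v"
    have W: "W \<in> carrier A" "W' \<in> carrier A"
      unfolding W_def W'_def using mem assms by (auto intro!: word_prod_closed[of I])
    have w: "word_prod A x ks (u @ c # d # v) = W \<otimes> (x r c \<otimes> x s d) \<otimes> W'" if "c \<in> I" "d \<in> I" for c d
      unfolding ks_def W_def W'_def using u(2) mem assms that
      by (subst word_prod_append[of I]) (auto simp: m_assoc word_prod_closed[of I] p_def)
    \<comment> \<open>The partner has one more inversion, which is the source of the second factor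
      \<open>- q\<close> and hence of the minor.\<close>
    have "F cs \<oplus> F (swp cs) = (- q) ^ ninv cs \<odot> (W \<otimes> (x r a \<otimes> x s b) \<otimes> W')
        \<oplus> ((- q) ^ ninv cs * (- q)) \<odot> (W \<otimes> (x r b \<otimes> x s a) \<otimes> W')"
      unfolding F_def u(1) swp[OF u(2)] using mem ninv_swap[OF ab, of u v] by (simp add: w mult.commute)
    also have "\<dots> = (- q) ^ ninv cs \<odot> (W \<otimes> (x r a \<otimes> x s b \<oplus> (- q) \<odot> (x r b \<otimes> x s a)) \<otimes> W')"
      using W mem assms by (simp add: r_distr l_distr smult_mult_l smult_mult_r smult_r_distr smult_assoc)
    finally have eq: "F cs \<oplus> F (swp cs) = (- q) ^ ninv cs \<odot> (W \<otimes> (x r a \<otimes> x s b \<oplus> (- q) \<odot> (x r b \<otimes> x s a)) \<otimes> W')" .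
    have s: "take p cs = u" "cs ! p = a" "cs ! Suc p = b" "drop (Suc (Suc p)) cs = v"
      using u by (auto simp: nth_append)
    show "F cs \<oplus> F (swp cs) = ?m cs"
      unfolding s eq W_def W'_def ..
    show "?m cs \<in> carrier A"
      unfolding s using W mem assms by (simp add: W_def W'_def)
  qed
  finally show ?thesis by (simp add: ks_def L_def P_def)
qed

lemma swap_mem:
  assumes "cs \<in> permutations_of_set I" "Suc p < card I"
  shows "cs ! p \<in> I" "cs ! Suc p \<in> I" "set (take p cs) \<subseteq> I" "set (drop (Suc (Suc p)) cs) \<subseteq> I"
  using assms permutations_of_set_length[OF assms(1)] set_take_subset[of p cs] set_drop_subset[of "Suc (Suc p)" cs]
  by (auto simp: permutations_of_set_def)

lemma qdet_rows_repeated: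
  assumes "set us \<subseteq> I" "set vs \<subseteq> I" "r \<in> I" "length (us @ r # r # vs) = card I"
  shows "qdet_rows A I q x (us @ r # r # vs) = \<zero>"
proof -
  have p: "Suc (length us) < card I" using assms(4) by simp
  show ?thesis
    unfolding qdet_rows_pairing[OF assms(1-3,3,4)]
    by (rule add.finprod_one_eqI)
       (use assms p in \<open>auto simp: minor_repeated_row swap_mem word_prod_closed[of I]\<close>)
qed

text \<open>The representatives depend on the columns and not on the rows, so both pairings run over
  the same set and are compared term by term.\<close>

lemma qdet_rows_swap:
  assumes "set us \<subseteq> I" "set vs \<subseteq> I" "r \<in> I" "s \<in> I" "length (us @ r # s # vs) = card I" "s < r"
  shows "qdet_rows A I q x (us @ r # s # vs) = (- q) \<odot> qdet_rows A I q x (us @ s # r # vs)"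
proof -
  have p: "Suc (length us) < card I" using assms(5) by simp
  have l: "length (us @ s # r # vs) = card I" using assms(5) by simp
  note c = swap_mem[OF _ p] word_prod_closed[of I]
  show ?thesis
    unfolding qdet_rows_pairing[OF assms(1-5)] qdet_rows_pairing[OF assms(1,2,4,3) l]
    apply (subst smult_finsum)
    subgoal using assms by (auto simp: c)
    apply (rule finsum_eqI)
    subgoal for cs using assms
      by (subst minor_swap_rows) (auto simp: c smult_mult_l smult_mult_r smult_assoc mult.commute)
    subgoal for cs using assms by (auto simp: c)
    done
qed

text \<open>Bubble sort, by induction on inversions: exchanging an adjacent descent removes one
  inversion and costs \<open>- q\<close>, while two equal adjacent rows give zero. A list with a
  repetition can never become strictly increasing, so it must reach the second case.\<close>

lemma qdet_rows_eq:
  assumes "set ks \<subseteq> I" "length ks = card I"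
  shows "qdet_rows A I q x ks =
    (if distinct ks then (- q) ^ ninv ks \<odot> qdet_rows A I q x (slist I) else \<zero>)"
  using assms
proof (induction "ninv ks" arbitrary: ks rule: less_induct)
  case less
  have D: "qdet_rows A I q x (slist I) \<in> carrier A" by (rule qdet_rows_closed) simp
  show ?case
  proof (cases "sorted_wrt (<) ks")
    case True
    then have "distinct ks" "sorted ks" by (auto simp: strict_sorted_iff)
    \<comment> \<open>A repetition-free list of \<open>card I\<close> elements of \<open>I\<close>
      exhausts \<open>I\<close>.\<close>
    moreover have "set ks = I"
      using less \<open>distinct ks\<close> by (intro card_subset_eq) (auto simp: distinct_card)
    ultimately have "ks = slist I"
      by (metis sorted_list_of_set.idem_if_sorted_distinct)
    then show ?thesis using ninv_sorted[OF True] \<open>distinct ks\<close> D by simp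
  next
    case False
    then obtain us r s vs where ks: "ks = us @ r # s # vs" "s \<le> r" by (rule not_sorted_adjacent)
    have mem: "set us \<subseteq> I" "set vs \<subseteq> I" "r \<in> I" "s \<in> I" using less(2) ks by auto
    show ?thesis
    proof (cases "r = s")
      case True
      then show ?thesis using qdet_rows_repeated[of us vs r] mem less(3) ks by simp
    next
      case neq: False
      then have sr: "s < r" using ks by simp
      let ?k = "us @ s # r # vs"
      have inv: "ninv ks = Suc (ninv ?k)" using ninv_swap[OF sr] ks by simp
      have "qdet_rows A I q x ks = (- q) \<odot> qdet_rows A I q x ?k"
        unfolding ks(1) using mem less(3) ks sr by (intro qdet_rows_swap) auto
      also have "qdet_rows A I q x ?k =
        (if distinct ?k then (- q) ^ ninv ?k \<odot> qdet_rows A I q x (slist I) else \<zero>)"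
        using less(2,3) ks inv by (intro less(1)) auto
      also have "distinct ?k \<longleftrightarrow> distinct ks" unfolding ks by auto
      finally show ?thesis using D by (simp add: inv smult_assoc)
    qed
  qed
qed

end

context qmatrix_pair
begin

lemma word_prod_commute:
  assumes "i \<in> I" "j \<in> I" "set ks \<subseteq> I" "set cs \<subseteq> I"
  shows "word_prod A x ks cs \<otimes> y i j = y i j \<otimes> word_prod A x ks cs"
  using assms(3,4)
proof (induction ks cs rule: list_induct2')
  case (4 k ks c cs)
  then have c: "word_prod A x ks cs \<in> carrier A" by (intro word_prod_closed[of I]) auto
  have "x k c \<otimes> word_prod A x ks cs \<otimes> y i j = x k c \<otimes> (y i j \<otimes> word_prod A x ks cs)"
    using 4 c assms by (simp add: m_assoc)
  also have "\<dots> = y i j \<otimes> (x k c \<otimes> word_prod A x ks cs)"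
    using 4 c assms by (simp add: m_assoc[symmetric] commute)
  finally show ?case by simp
qed (use assms in auto)

lemma finsum_lists_Suc:
  assumes "\<And>ks. set ks \<subseteq> I \<Longrightarrow> f ks \<in> carrier A"
  shows "(\<Oplus>ks\<in>{ks. set ks \<subseteq> I \<and> length ks = Suc m}. f ks) =
    (\<Oplus>r\<in>I. \<Oplus>ks\<in>{ks. set ks \<subseteq> I \<and> length ks = m}. f (r # ks))"
proof -
  let ?L = "\<lambda>m. {ks. set ks \<subseteq> I \<and> length ks = m}"
  have eq: "?L (Suc m) = (\<Union>r\<in>I. (#) r ` ?L m)"
    by (auto simp: length_Suc_conv image_iff)
  have "(\<Oplus>ks\<in>?L (Suc m). f ks) = (\<Oplus>r\<in>I. \<Oplus>ks\<in>(#) r ` ?L m. f ks)"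
    unfolding eq by (rule add.finprod_UN_disjoint)
      (auto simp: finite_lists_length_eq pairwise_def disjnt_def assms)
  also have "\<dots> = (\<Oplus>r\<in>I. \<Oplus>ks\<in>?L m. f (r # ks))"
  proof (rule finsum_eqI)
    fix r assume "r \<in> I"
    then show "(\<Oplus>ks\<in>(#) r ` ?L m. f ks) = (\<Oplus>ks\<in>?L m. f (r # ks))"
      using assms by (intro finsum_reindex) (auto intro!: inj_onI)
    show "(\<Oplus>ks\<in>?L m. f (r # ks)) \<in> carrier A"
      using assms \<open>r \<in> I\<close> by (intro finsum_closed) auto
  qed
  finally show ?thesis .
qed

text \<open>The list \<open>ks\<close> collects the summation index chosen in each factor; each
  entry of \<open>y\<close> is then moved to the right past the remaining word in
  \<open>x\<close>.\<close>

lemma word_prod_mat_prod: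
  assumes "length is = length cs" "set is \<subseteq> I" "set cs \<subseteq> I"
  shows "word_prod A z is cs = (\<Oplus>ks\<in>{ks. set ks \<subseteq> I \<and> length ks = length is}.
    word_prod A x is ks \<otimes> word_prod A y ks cs)"
  using assms
proof (induction "is" cs rule: list_induct2)
  case Nil
  have "{ks :: nat list. set ks \<subseteq> I \<and> length ks = length ([] :: nat list)} = {[]}" by auto
  then show ?case by (simp del: length_0_conv)
next
  case (Cons i "is" c cs)
  let ?L = "{ks. set ks \<subseteq> I \<and> length ks = length is}"
  have finL: "finite ?L" by (simp add: finite_lists_length_eq)
  have ic [simp]: "i \<in> I" "c \<in> I" and sub: "set is \<subseteq> I" "set cs \<subseteq> I" using Cons by auto
  have wx [simp]: "word_prod A x is ks \<in> carrier A" if "ks \<in> ?L" for ks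
    using that sub by (intro word_prod_closed[of I]) auto
  have wy [simp]: "word_prod A y ks cs \<in> carrier A" if "ks \<in> ?L" for ks
    using that sub by (intro word_prod_closed[of I]) auto
  have "word_prod A z (i # is) (c # cs) = (\<Oplus>r\<in>I. x i r \<otimes> y r c) \<otimes> (\<Oplus>ks\<in>?L. word_prod A x is ks \<otimes> word_prod A y ks cs)"
    using Cons by (simp add: mat_prod_def[of A I x y i c])
  also have "\<dots> = (\<Oplus>r\<in>I. (x i r \<otimes> y r c) \<otimes> (\<Oplus>ks\<in>?L. word_prod A x is ks \<otimes> word_prod A y ks cs))"
    by (intro finsum_ldistr finsum_closed Pi_I) (simp_all del: mem_Collect_eq)
  also have "\<dots> = (\<Oplus>r\<in>I. \<Oplus>ks\<in>?L. (x i r \<otimes> y r c) \<otimes> (word_prod A x is ks \<otimes> word_prod A y ks cs))"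
    using finL by (intro finsum_eqI finsum_rdistr finsum_closed Pi_I) (simp_all del: mem_Collect_eq)
  also have "\<dots> = (\<Oplus>r\<in>I. \<Oplus>ks\<in>?L. word_prod A x (i # is) (r # ks) \<otimes> word_prod A y (r # ks) (c # cs))"
  proof (intro finsum_eqI finsum_closed Pi_I)
    fix r ks assume r: "r \<in> I" and ks: "ks \<in> ?L"
    have "(x i r \<otimes> y r c) \<otimes> (word_prod A x is ks \<otimes> word_prod A y ks cs)
      = x i r \<otimes> (y r c \<otimes> word_prod A x is ks) \<otimes> word_prod A y ks cs"
      using r ks by (simp add: m_assoc del: mem_Collect_eq)
    also have "y r c \<otimes> word_prod A x is ks = word_prod A x is ks \<otimes> y r c"
      using r ks sub by (intro word_prod_commute[symmetric]) auto
    finally show "(x i r \<otimes> y r c) \<otimes> (word_prod A x is ks \<otimes> word_prod A y ks cs)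
      = word_prod A x (i # is) (r # ks) \<otimes> word_prod A y (r # ks) (c # cs)"
      using r ks by (simp add: m_assoc del: mem_Collect_eq)
  qed (simp_all del: mem_Collect_eq)
  also have "\<dots> = (\<Oplus>ks\<in>{ks. set ks \<subseteq> I \<and> length ks = Suc (length is)}.
      word_prod A x (i # is) ks \<otimes> word_prod A y ks (c # cs))"
    using Cons by (intro finsum_lists_Suc[symmetric] m_closed word_prod_closed[of I]) auto
  finally show ?case by simp
qed

sublocale X: qmatrix_alg A I q x by unfold_locales (use fin q0 qx in auto)
sublocale Y: qmatrix_alg A I q y by unfold_locales (use fin q0 qy in auto)

text \<open>Expanding the product leaves the quantum determinants of \<open>y\<close> with rows \<open>ks\<close>; those with a
  repeated row vanish.\<close>

lemma qdet_mat_prod: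
  "qdet_rows A I q z (slist I) =
    qdet_rows A I q x (slist I) \<otimes> qdet_rows A I q y (slist I)"
proof -
  define e where "e = slist I"
  define L where "L = {ks. set ks \<subseteq> I \<and> length ks = card I}"
  define P where "P = permutations_of_set I"
  have finL: "finite L" by (simp add: L_def finite_lists_length_eq)
  have e: "set e = I" "length e = card I" by (auto simp: e_def)
  have finP: "finite P" by (simp add: P_def)
  have wx: "word_prod A x e ks \<in> carrier A" if "ks \<in> L" for ks
    using that e by (intro word_prod_closed[of I]) (auto simp: L_def)
  have wy: "word_prod A y ks cs \<in> carrier A" if "ks \<in> L" "cs \<in> P" for ks cs
    using that by (intro word_prod_closed[of I]) (auto simp: L_def P_def permutations_of_set_def)
  have D: "qdet_rows A I q y ks \<in> carrier A" if "ks \<in> L" for ks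
    using that by (intro Y.qdet_rows_closed) (auto simp: L_def)
  have De: "qdet_rows A I q y e \<in> carrier A" using e by (intro Y.qdet_rows_closed) auto
  have PL: "P \<subseteq> L" using permutations_of_set_length by (auto simp: P_def L_def permutations_of_set_def)
  have "qdet_rows A I q z e =
    (\<Oplus>cs\<in>P. (- q) ^ ninv cs \<odot> (\<Oplus>ks\<in>L. word_prod A x e ks \<otimes> word_prod A y ks cs))"
    unfolding qdet_rows_def P_def[symmetric]
  proof (rule finsum_eqI)
    fix cs assume cs: "cs \<in> P"
    then have "word_prod A z e cs = (\<Oplus>ks\<in>L. word_prod A x e ks \<otimes> word_prod A y ks cs)"
      using word_prod_mat_prod[of e cs] e permutations_of_set_length[of cs I]
      by (auto simp: P_def L_def permutations_of_set_def)
    then show "(- q) ^ ninv cs \<odot> word_prod A z e cs =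
        (- q) ^ ninv cs \<odot> (\<Oplus>ks\<in>L. word_prod A x e ks \<otimes> word_prod A y ks cs)" by simp
    show "(- q) ^ ninv cs \<odot> (\<Oplus>ks\<in>L. word_prod A x e ks \<otimes> word_prod A y ks cs) \<in> carrier A"
      using wx wy cs by (intro smult_closed finsum_closed) auto
  qed
  also have "\<dots> = (\<Oplus>cs\<in>P. \<Oplus>ks\<in>L. word_prod A x e ks \<otimes> ((- q) ^ ninv cs \<odot> word_prod A y ks cs))"
  proof (rule finsum_eqI)
    fix cs assume cs: "cs \<in> P"
    show "(- q) ^ ninv cs \<odot> (\<Oplus>ks\<in>L. word_prod A x e ks \<otimes> word_prod A y ks cs) =
      (\<Oplus>ks\<in>L. word_prod A x e ks \<otimes> ((- q) ^ ninv cs \<odot> word_prod A y ks cs))"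
      using wx wy cs by (subst smult_finsum) (auto intro!: finsum_eqI simp: smult_mult_r)
    show "(\<Oplus>ks\<in>L. word_prod A x e ks \<otimes> ((- q) ^ ninv cs \<odot> word_prod A y ks cs)) \<in> carrier A"
      using wx wy cs by (intro finsum_closed) auto
  qed
  also have "\<dots> = (\<Oplus>ks\<in>L. \<Oplus>cs\<in>P. word_prod A x e ks \<otimes> ((- q) ^ ninv cs \<odot> word_prod A y ks cs))"
    using finL finP wx wy by (intro finsum_swap) auto
  also have "\<dots> = (\<Oplus>ks\<in>L. word_prod A x e ks \<otimes> qdet_rows A I q y ks)"
    unfolding qdet_rows_def P_def[symmetric] using finP wx wy
    by (intro finsum_eqI finsum_rdistr[symmetric] m_closed finsum_closed) auto
  \<comment> \<open>Sorting the rows of a permutation \<open>ks\<close> costs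
    \<open>(- q) ^ ninv ks\<close>, which is the coefficient of its word in the quantum determinant
    of \<open>x\<close>.\<close>
  also have "\<dots> = (\<Oplus>ks\<in>P. ((- q) ^ ninv ks \<odot> word_prod A x e ks) \<otimes> qdet_rows A I q y e)"
  proof (rule add.finprod_mono_neutral_cong_right[OF finL PL])
    fix ks assume "ks \<in> L - P"
    then have "ks \<in> L" "\<not> distinct ks"
      using card_subset_eq[of I "set ks"] distinct_card[of ks]
      by (auto simp: L_def P_def permutations_of_set_def)
    then show "word_prod A x e ks \<otimes> qdet_rows A I q y ks = \<zero>"
      using Y.qdet_rows_eq[of ks] wx by (simp add: L_def)
  next
    fix ks assume ks: "ks \<in> P"
    then have kL: "ks \<in> L" and "distinct ks" using PL by (auto simp: P_def permutations_of_set_def)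
    then have "qdet_rows A I q y ks = (- q) ^ ninv ks \<odot> qdet_rows A I q y e"
      using Y.qdet_rows_eq[of ks] by (simp add: L_def e_def)
    then show "word_prod A x e ks \<otimes> qdet_rows A I q y ks =
      ((- q) ^ ninv ks \<odot> word_prod A x e ks) \<otimes> qdet_rows A I q y e"
      using wx[OF kL] De by (simp add: smult_mult_l smult_mult_r)
  qed (use wx D in auto)
  also have "\<dots> = (\<Oplus>ks\<in>P. (- q) ^ ninv ks \<odot> word_prod A x e ks) \<otimes> qdet_rows A I q y e"
    using finP wx PL De by (intro finsum_ldistr[symmetric]) auto
  also have "\<dots> = qdet_rows A I q x e \<otimes> qdet_rows A I q y e"
    by (simp add: qdet_rows_def P_def)
  finally show ?thesis by (simp add: e_def)
qed

end

section \<open>The quantized coordinate ring of the special linear group\<close>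

lemma (in abelian_monoid) finsum_single:
  assumes "finite I" "i \<in> I" "f i \<in> carrier G" "\<And>j. j \<in> I \<Longrightarrow> j \<noteq> i \<Longrightarrow> f j = \<zero>"
  shows "finsum G f I = f i"
proof -
  have "f j \<in> carrier G" if "j \<in> I" for j using assms that by (cases "j = i") auto
  then have "finsum G f I = finsum G f {i}"
    by (intro add.finprod_mono_neutral_cong_right) (use assms in auto)
  then show ?thesis using assms by simp
qed

lemma qmatrix_cong:
  "(\<And>i j. i \<in> I \<Longrightarrow> j \<in> I \<Longrightarrow> x i j = y i j) \<Longrightarrow> qmatrix A I q x = qmatrix A I q y"
  unfolding qmatrix_def by simp

lemma alg_hom_word_prod:
  assumes "kalgebra A" "h \<in> alg_hom A B" "\<And>i j. i \<in> I \<Longrightarrow> j \<in> I \<Longrightarrow> x i j \<in> carrier A"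
    and "set ks \<subseteq> I" "set cs \<subseteq> I"
  shows "h (word_prod A x ks cs) = word_prod B (\<lambda>i j. h (x i j)) ks cs"
proof -
  interpret A: kalgebra A by fact
  show ?thesis using assms(4,5)
  proof (induction ks cs rule: list_induct2')
    case (4 k ks c cs)
    then show ?case
      using A.word_prod_closed[of I x ks cs] by (simp add: alg_hom_mult[OF assms(2)] assms(3))
  qed (simp_all add: alg_hom_one[OF assms(2)])
qed

lemma alg_hom_qdet_rows:
  assumes "kalgebra A" "kalgebra B" "h \<in> alg_hom A B" "\<And>i j. i \<in> I \<Longrightarrow> j \<in> I \<Longrightarrow> x i j \<in> carrier A"
    and "set ks \<subseteq> I"
  shows "h (qdet_rows A I q x ks) = qdet_rows B I q (\<lambda>i j. h (x i j)) ks"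
proof -
  interpret A: kalgebra A by fact
  interpret B: kalgebra B by fact
  have c: "word_prod A x ks cs \<in> carrier A" "set cs \<subseteq> I" if "cs \<in> permutations_of_set I" for cs
    using that assms(5) by (auto intro!: A.word_prod_closed[OF assms(4)] dest: permutations_of_setD)
  show ?thesis
    unfolding qdet_rows_def
    using c lin_map_finsum[OF assms(1,2) alg_hom_lin_map[OF assms(3)], of
        "\<lambda>cs. (- q) ^ ninv cs \<odot>\<^bsub>A\<^esub> word_prod A x ks cs" "permutations_of_set I"]
    by (auto simp: alg_hom_smult[OF assms(3)] alg_hom_word_prod[OF assms(1,3,4,5)]
        alg_hom_closed[OF assms(3)] simp flip: alg_hom_word_prod[OF assms(1,3,4,5)] intro!: B.finsum_eqI)
qed

lemma alg_hom_qmatrix: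
  assumes "kalgebra A" "h \<in> alg_hom A B" "qmatrix A I q x"
  shows "qmatrix B I q (\<lambda>i j. h (x i j))"
proof -
  interpret A: kalgebra A by fact
  note D = qmatrixD[OF assms(3)]
  note h = alg_hom_mult[OF assms(2), symmetric] alg_hom_smult[OF assms(2), symmetric]
    alg_hom_add[OF assms(2), symmetric]
  show ?thesis
    unfolding qmatrix_def
    apply (intro conjI ballI impI)
    subgoal using D(1) alg_hom_closed[OF assms(2)] by blast
    subgoal for i j m using D(1) D(2)[of i j m] by (simp add: h)
    subgoal for i j l using D(1) D(3)[of i j l] by (simp add: h)
    subgoal for i j l m using D(1) D(4)[of i j l m] by (simp add: h)
    subgoal for i j l m using D(1) D(5)[of i j l m] by (simp add: h)
    done
qed

section \<open>The free algebra on the matrix entries and evaluation of words\<close>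

lemma free_monoid_simps [simp]:
  "carrier (free_monoid G) = lists G" "(\<otimes>\<^bsub>free_monoid G\<^esub>) = (@)" "\<one>\<^bsub>free_monoid G\<^esub> = []"
  by (simp_all add: free_monoid_def)

lemma monoid_free_monoid: "Group.monoid (free_monoid G)"
  by (rule monoidI) auto

lemma kalgebra_OqFree: "kalgebra (OqFree n)"
  unfolding OqFree_def free_alg_def by (rule kalgebra_monoid_alg[OF monoid_free_monoid])

definition eval_word :: "('k, 'a) module \<Rightarrow> (nat \<Rightarrow> nat \<Rightarrow> 'a) \<Rightarrow> (nat \<times> nat) list \<Rightarrow> 'a" where
  "eval_word A x w = foldr (\<lambda>(i, j) y. x i j \<otimes>\<^bsub>A\<^esub> y) w \<one>\<^bsub>A\<^esub>"

lemma eval_word_simps [simp]: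
  "eval_word A x [] = \<one>\<^bsub>A\<^esub>" "eval_word A x ((i, j) # w) = x i j \<otimes>\<^bsub>A\<^esub> eval_word A x w"
  by (simp_all add: eval_word_def)

lemma word_prod_eval_word: "word_prod A x ks cs = eval_word A x (zip ks cs)"
  by (simp add: word_prod_def eval_word_def)

context kalgebra
begin

lemma eval_word_closed:
  assumes "\<And>i j. i \<in> I \<Longrightarrow> j \<in> I \<Longrightarrow> x i j \<in> carrier A" "w \<in> lists (I \<times> I)"
  shows "eval_word A x w \<in> carrier A"
  using assms(2) by (induction w) (auto simp: assms(1))

lemma eval_word_append:
  assumes "\<And>i j. i \<in> I \<Longrightarrow> j \<in> I \<Longrightarrow> x i j \<in> carrier A" "v \<in> lists (I \<times> I)" "w \<in> lists (I \<times> I)"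
  shows "eval_word A x (v @ w) = eval_word A x v \<otimes> eval_word A x w"
  using assms(2)
proof (induction v)
  case (Cons a v)
  then show ?case
    using eval_word_closed[of I x v] eval_word_closed[of I x w] assms(1,3)
    by (cases a) (simp add: m_assoc)
qed (simp add: eval_word_closed[of I x w] assms)

end

text \<open>The index interval is given a name, with the equation oriented towards \<open>I\<close>,
  so that membership is not expanded into inequalities.\<close>

locale quantum =
  fixes n :: nat and q :: "'k::field" and I :: "nat set"
  assumes q0: "q \<noteq> 0" and I_def: "idx n = I"
begin

lemma fin [simp]: "finite I" by (simp flip: I_def)

lemma I_list: "slist I = [1..<n + 2]"
  using sorted_list_of_set_range[of 1 "n + 2"]
  by (simp flip: I_def add: atLeastLessThanSuc_atLeastAtMost)

abbreviation F where "F \<equiv> OqFree n :: ('k, (nat \<times> nat) list \<Rightarrow>\<^sub>0 'k) module"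

abbreviation X where "X \<equiv> \<lambda>i j. free_gen (i, j) :: (nat \<times> nat) list \<Rightarrow>\<^sub>0 'k"

lemma F_eq: "F = monoid_alg (free_monoid (I \<times> I))"
  unfolding OqFree_def free_alg_def I_def ..

sublocale F: kalgebra F by (rule kalgebra_OqFree)

lemma F_car: "carrier F = {f. keys f \<subseteq> lists (I \<times> I)}"
  by (simp add: F_eq)

lemma X_car [simp]: "i \<in> I \<Longrightarrow> j \<in> I \<Longrightarrow> X i j \<in> carrier F"
  by (simp add: F_car free_gen_def)

lemma F_single_mult: "single v c \<otimes>\<^bsub>F\<^esub> single w d = single (v @ w) (c * d)"
  by (simp add: F_eq)

lemma F_one: "\<one>\<^bsub>F\<^esub> = single [] 1"
  by (simp add: F_eq)

lemma single_eval_word: "single w 1 = eval_word F X w"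
proof (induction w)
  case (Cons a w)
  obtain i j where a: "a = (i, j)" by fastforce
  have "single (a # w) 1 = X i j \<otimes>\<^bsub>F\<^esub> single w 1"
    by (simp add: a free_gen_def F_single_mult)
  then show ?case using Cons by (simp add: a)
qed (simp add: F_one)

lemma alg_hom_eval_word:
  assumes "kalgebra A" "h \<in> alg_hom A B" "\<And>i j. i \<in> I \<Longrightarrow> j \<in> I \<Longrightarrow> x i j \<in> carrier A" "w \<in> lists (I \<times> I)"
  shows "h (eval_word A x w) = eval_word B (\<lambda>i j. h (x i j)) w"
proof -
  interpret A: kalgebra A by fact
  show ?thesis using assms(4)
  proof (induction w)
    case (Cons a w)
    then show ?case
      using A.eval_word_closed[of I x w] assms(3) by (cases a) (simp add: alg_hom_mult[OF assms(2)] assms(3))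
  qed (simp add: alg_hom_one[OF assms(2)])
qed

lemma F_eval:
  assumes "kalgebra C" "\<And>i j. i \<in> I \<Longrightarrow> j \<in> I \<Longrightarrow> y i j \<in> carrier C"
  shows "\<exists>h \<in> alg_hom F C. \<forall>i\<in>I. \<forall>j\<in>I. h (X i j) = y i j"
proof (intro bexI ballI)
  interpret C: kalgebra C by fact
  show "lin_ext C (eval_word C y) \<in> alg_hom F C"
    unfolding F_eq
    by (rule C.lin_ext_alg_hom[OF monoid_free_monoid])
       (auto intro!: C.eval_word_closed[of I] C.eval_word_append[of I] assms(2))
  fix i j assume "i \<in> I" "j \<in> I"
  then show "lin_ext C (eval_word C y) (X i j) = y i j"
    using assms(2) by (simp add: free_gen_def C.lin_ext_single)
qed

text \<open>A permutation is determined by its values on \<open>I\<close>; surjectivity follows by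
  counting both sides.\<close>

lemma permutes_list_bij:
  "bij_betw (\<lambda>\<sigma>. map \<sigma> (slist I)) {\<sigma>. \<sigma> permutes I} (permutations_of_set I)"
proof -
  let ?f = "\<lambda>\<sigma>. map \<sigma> (slist I)"
  have inj: "inj_on ?f {\<sigma>. \<sigma> permutes I}"
  proof (rule inj_onI)
    fix \<sigma> \<tau> assume s: "\<sigma> \<in> {\<sigma>. \<sigma> permutes I}" "\<tau> \<in> {\<sigma>. \<sigma> permutes I}" and "?f \<sigma> = ?f \<tau>"
    then have "\<sigma> i = \<tau> i" if "i \<in> I" for i using that by (auto simp: map_eq_conv)
    then show "\<sigma> = \<tau>" using s by (metis ext mem_Collect_eq permutes_not_in)
  qed
  have sub: "?f ` {\<sigma>. \<sigma> permutes I} \<subseteq> permutations_of_set I"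
    by (auto simp: permutations_of_set_def permutes_image distinct_map permutes_inj_on)
  have "card (?f ` {\<sigma>. \<sigma> permutes I}) = card (permutations_of_set I)"
    by (simp add: card_image[OF inj] card_permutations[OF refl fin] card_permutations_of_set)
  then have "?f ` {\<sigma>. \<sigma> permutes I} = permutations_of_set I"
    using sub by (intro card_subset_eq) auto
  then show ?thesis using inj by (simp add: bij_betw_def)
qed

lemma perm_length_ninv: "perm_length n \<sigma> = ninv (map \<sigma> (slist I))"
  unfolding I_list ninv_upt perm_length_def
  by (rule arg_cong[where f = card]) auto

text \<open>Passes from permutations as functions to one-line notation, the form in which
  multiplicativity was proved.\<close>

lemma qdet_eq: "qdet n q = qdet_rows F I q X (slist I)"
proof -
  let ?f = "\<lambda>\<sigma>. map \<sigma> (slist I)"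
  have foldr: "foldr (\<lambda>i y. free_gen (i, \<sigma> i) \<otimes>\<^bsub>F\<^esub> y) ks \<one>\<^bsub>F\<^esub> = word_prod F X ks (map \<sigma> ks)" for ks and \<sigma> :: "nat \<Rightarrow> nat"
    by (induction ks) auto
  have "qdet n q = (\<Oplus>\<^bsub>F\<^esub>\<sigma> \<in> {\<sigma>. \<sigma> permutes I}. (- q) ^ ninv (?f \<sigma>) \<odot>\<^bsub>F\<^esub> word_prod F X (slist I) (?f \<sigma>))"
    unfolding qdet_def Let_def I_def perm_length_ninv foldr I_list ..
  also have "\<dots> = (\<Oplus>\<^bsub>F\<^esub>cs \<in> ?f ` {\<sigma>. \<sigma> permutes I}. (- q) ^ ninv cs \<odot>\<^bsub>F\<^esub> word_prod F X (slist I) cs)"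
  proof (rule F.finsum_reindex[symmetric])
    show "inj_on ?f {\<sigma>. \<sigma> permutes I}" using permutes_list_bij by (simp add: bij_betw_def)
    show "(\<lambda>cs. (- q) ^ ninv cs \<odot>\<^bsub>F\<^esub> word_prod F X (slist I) cs) \<in> ?f ` {\<sigma>. \<sigma> permutes I} \<rightarrow> carrier F"
      by (intro Pi_I F.smult_closed F.word_prod_closed[of I]) (auto simp: permutes_image)
  qed
  also have "?f ` {\<sigma>. \<sigma> permutes I} = permutations_of_set I"
    using permutes_list_bij by (simp add: bij_betw_def)
  finally show ?thesis by (simp add: qdet_rows_def)
qed

lemma qdet_car: "qdet n q \<in> carrier F"
  unfolding qdet_eq qdet_rows_def
  by (intro F.finsum_closed Pi_I F.smult_closed F.word_prod_closed[of I]) (auto dest: permutations_of_setD)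

lemma qrels_cases:
  assumes "r \<in> qrels n q"
  obtains (row) i j m where "r = X i j \<otimes>\<^bsub>F\<^esub> X i m \<ominus>\<^bsub>F\<^esub> q \<odot>\<^bsub>F\<^esub> (X i m \<otimes>\<^bsub>F\<^esub> X i j)"
        "i \<in> I" "j \<in> I" "m \<in> I" "j < m"
    | (col) i j l where "r = X i j \<otimes>\<^bsub>F\<^esub> X l j \<ominus>\<^bsub>F\<^esub> q \<odot>\<^bsub>F\<^esub> (X l j \<otimes>\<^bsub>F\<^esub> X i j)"
        "i \<in> I" "j \<in> I" "l \<in> I" "i < l"
    | (anti) i j l m where "r = X i j \<otimes>\<^bsub>F\<^esub> X l m \<ominus>\<^bsub>F\<^esub> X l m \<otimes>\<^bsub>F\<^esub> X i j"
        "i \<in> I" "j \<in> I" "l \<in> I" "m \<in> I" "i < l" "m < j"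
    | (diag) i j l m where "r = (X i j \<otimes>\<^bsub>F\<^esub> X l m \<ominus>\<^bsub>F\<^esub> X l m \<otimes>\<^bsub>F\<^esub> X i j)
          \<ominus>\<^bsub>F\<^esub> (q - inverse q) \<odot>\<^bsub>F\<^esub> (X i m \<otimes>\<^bsub>F\<^esub> X l j)"
        "i \<in> I" "j \<in> I" "l \<in> I" "m \<in> I" "i < l" "j < m"
    | (det) "r = qdet n q \<ominus>\<^bsub>F\<^esub> \<one>\<^bsub>F\<^esub>"
  using assms unfolding qrels_def Let_def I_def
  by (elim UnE CollectE exE conjE singletonE) (simp_all only: insert_subset)

lemma qrelsI:
  "i \<in> I \<Longrightarrow> j \<in> I \<Longrightarrow> m \<in> I \<Longrightarrow> j < m \<Longrightarrow>
    X i j \<otimes>\<^bsub>F\<^esub> X i m \<ominus>\<^bsub>F\<^esub> q \<odot>\<^bsub>F\<^esub> (X i m \<otimes>\<^bsub>F\<^esub> X i j) \<in> qrels n q"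
  "i \<in> I \<Longrightarrow> j \<in> I \<Longrightarrow> l \<in> I \<Longrightarrow> i < l \<Longrightarrow>
    X i j \<otimes>\<^bsub>F\<^esub> X l j \<ominus>\<^bsub>F\<^esub> q \<odot>\<^bsub>F\<^esub> (X l j \<otimes>\<^bsub>F\<^esub> X i j) \<in> qrels n q"
  "i \<in> I \<Longrightarrow> j \<in> I \<Longrightarrow> l \<in> I \<Longrightarrow> m \<in> I \<Longrightarrow> i < l \<Longrightarrow> m < j \<Longrightarrow>
    X i j \<otimes>\<^bsub>F\<^esub> X l m \<ominus>\<^bsub>F\<^esub> X l m \<otimes>\<^bsub>F\<^esub> X i j \<in> qrels n q"
  "i \<in> I \<Longrightarrow> j \<in> I \<Longrightarrow> l \<in> I \<Longrightarrow> m \<in> I \<Longrightarrow> i < l \<Longrightarrow> j < m \<Longrightarrow>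
    (X i j \<otimes>\<^bsub>F\<^esub> X l m \<ominus>\<^bsub>F\<^esub> X l m \<otimes>\<^bsub>F\<^esub> X i j) \<ominus>\<^bsub>F\<^esub> (q - inverse q) \<odot>\<^bsub>F\<^esub> (X i m \<otimes>\<^bsub>F\<^esub> X l j) \<in> qrels n q"
  "qdet n q \<ominus>\<^bsub>F\<^esub> \<one>\<^bsub>F\<^esub> \<in> qrels n q"
  unfolding qrels_def Let_def I_def by blast+

lemma qrels_closed: "qrels n q \<subseteq> carrier F"
proof
  fix r assume "r \<in> qrels n q"
  then show "r \<in> carrier F" by (cases rule: qrels_cases) (simp_all add: qdet_car)
qed

text \<open>Read from left to right it gives the properties of the generators in the quotient; read
  from right to left it produces homomorphisms out of the quotient.\<close>

lemma qrels_hom_iff: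
  assumes C: "kalgebra C" and h: "h \<in> alg_hom F C"
  defines "y \<equiv> \<lambda>i j. h (X i j)"
  shows "(\<forall>r\<in>qrels n q. h r = \<zero>\<^bsub>C\<^esub>) \<longleftrightarrow>
    qmatrix C I q y \<and> qdet_rows C I q y (slist I) = \<one>\<^bsub>C\<^esub>"
proof -
  interpret C: kalgebra C by fact
  have y [simp]: "y i j \<in> carrier C" if "i \<in> I" "j \<in> I" for i j
    unfolding y_def using that alg_hom_closed[OF h] by simp
  note hl = lin_map_minus[OF F.kalgebra_axioms C alg_hom_lin_map[OF h]] alg_hom_mult[OF h] alg_hom_smult[OF h]
    alg_hom_one[OF h]
  have hX: "h (X i j) = y i j" for i j by (simp add: y_def)
  have det: "h (qdet n q \<ominus>\<^bsub>F\<^esub> \<one>\<^bsub>F\<^esub>) = qdet_rows C I q y (slist I) \<ominus>\<^bsub>C\<^esub> \<one>\<^bsub>C\<^esub>"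
    unfolding y_def using qdet_car
    by (simp add: hl) (simp add: qdet_eq alg_hom_qdet_rows[OF F.kalgebra_axioms C h])
  have detc: "qdet_rows C I q y (slist I) \<in> carrier C"
    unfolding qdet_rows_def
    by (intro C.finsum_closed Pi_I C.smult_closed C.word_prod_closed[of I]) (auto dest: permutations_of_setD)
  have d2: "a \<ominus>\<^bsub>C\<^esub> b = c \<longleftrightarrow> a = b \<oplus>\<^bsub>C\<^esub> c"
    if "a \<in> carrier C" "b \<in> carrier C" "c \<in> carrier C" for a b c
  proof -
    have "(a \<ominus>\<^bsub>C\<^esub> b) \<ominus>\<^bsub>C\<^esub> c = a \<ominus>\<^bsub>C\<^esub> (b \<oplus>\<^bsub>C\<^esub> c)"
      using that by (simp add: C.minus_eq C.minus_add C.a_assoc)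
    then show ?thesis using that by (metis C.minus_closed C.a_closed C.r_right_minus_eq)
  qed
  show ?thesis
  proof
    assume r: "\<forall>r\<in>qrels n q. h r = \<zero>\<^bsub>C\<^esub>"
    have "qmatrix C I q y"
      unfolding qmatrix_def
      apply (intro conjI ballI impI)
      subgoal by simp
      subgoal for i j m using r[rule_format, OF qrelsI(1), of i j m] by (simp add: hl hX)
      subgoal for i j l using r[rule_format, OF qrelsI(2), of i j l] by (simp add: hl hX)
      subgoal for i j l m using r[rule_format, OF qrelsI(3), of i j l m] by (simp add: hl hX)
      subgoal for i j l m using r[rule_format, OF qrelsI(4), of i j l m] by (simp add: hl hX d2)
      done
    moreover have "qdet_rows C I q y (slist I) = \<one>\<^bsub>C\<^esub>"
      using r[rule_format, OF qrelsI(5)] detc unfolding det by simp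
    ultimately show "qmatrix C I q y \<and> qdet_rows C I q y (slist I) = \<one>\<^bsub>C\<^esub>" ..
  next
    assume "qmatrix C I q y \<and> qdet_rows C I q y (slist I) = \<one>\<^bsub>C\<^esub>"
    then have D: "qmatrix C I q y" and d: "qdet_rows C I q y (slist I) = \<one>\<^bsub>C\<^esub>" by auto
    note D = qmatrixD[OF D]
    show "\<forall>r\<in>qrels n q. h r = \<zero>\<^bsub>C\<^esub>"
    proof
      fix r assume "r \<in> qrels n q"
      then show "h r = \<zero>\<^bsub>C\<^esub>"
      proof (cases rule: qrels_cases)
        case row then show ?thesis using D(2) by (simp add: hl hX)
      next
        case col then show ?thesis using D(3) by (simp add: hl hX)
      next
        case anti then show ?thesis using D(4) by (simp add: hl hX)
      next
        case diag then show ?thesis using D(5) by (simp add: hl hX d2)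
      next
        case det' : det
        show ?thesis using d unfolding det' det by simp
      qed
    qed
  qed
qed

section \<open>The quantized special linear group and its universal property\<close>

abbreviation A where "A \<equiv> OqSL n q"

sublocale SI: kalgebra_ideal F "SL_ideal n q"
  unfolding SL_ideal_def
  by (intro kalgebra_ideal.intro F.kalgebra_axioms F.genideal_ideal qrels_closed)

lemma A_eq: "A = SI.Q" by (simp add: OqSL_def)

sublocale A: kalgebra A unfolding A_eq by (rule SI.kalgebra_quot)

abbreviation projSL where "projSL \<equiv> (\<lambda>x. SL_ideal n q +>\<^bsub>F\<^esub> x)"

lemma projSL_hom: "projSL \<in> alg_hom F A"
  unfolding A_eq by (rule SI.coset_alg_hom)

lemma projSL_surj: "C \<in> carrier A \<Longrightarrow> \<exists>x\<in>carrier F. C = projSL x"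
  unfolding A_eq by (rule SI.coset_surj)

lemma projSL_X: "projSL (X i j) = XSL n q i j"
  by (simp add: XSL_def)

lemma SL_ideal_kernel:
  assumes "kalgebra C" "h \<in> alg_hom F C" "\<forall>r\<in>qrels n q. h r = \<zero>\<^bsub>C\<^esub>" "x \<in> SL_ideal n q"
  shows "h x = \<zero>\<^bsub>C\<^esub>"
  using alg_hom_kills_genideal[OF F.kalgebra_axioms assms(1,2) qrels_closed _ assms(4)[unfolded SL_ideal_def]] assms(3)
  by blast

lemma qmatrix_SL: "qmatrix A I q (XSL n q)" "qdet_rows A I q (XSL n q) (slist I) = \<one>\<^bsub>A\<^esub>"
proof -
  have "\<forall>r\<in>qrels n q. projSL r = \<zero>\<^bsub>A\<^esub>"
    unfolding A_eq SL_ideal_def[symmetric]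
    using SI.coset_zero_iff F.genideal_self[OF qrels_closed] qrels_closed
    unfolding SL_ideal_def by blast
  then show "qmatrix A I q (XSL n q)" "qdet_rows A I q (XSL n q) (slist I) = \<one>\<^bsub>A\<^esub>"
    unfolding qrels_hom_iff[OF A.kalgebra_axioms projSL_hom] projSL_X by auto
qed

lemma XSL_car [simp]: "i \<in> I \<Longrightarrow> j \<in> I \<Longrightarrow> XSL n q i j \<in> carrier A"
  using qmatrixD(1)[OF qmatrix_SL(1)] by blast

text \<open>Evaluation on the free algebra kills all relations by \<open>qrels_hom_iff\<close> and
  therefore descends. This is what makes a comultiplication available.\<close>

lemma SL_universal:
  assumes C: "kalgebra C" and y: "qmatrix C I q y" "qdet_rows C I q y (slist I) = \<one>\<^bsub>C\<^esub>"
  shows "\<exists>h \<in> alg_hom A C. \<forall>i\<in>I. \<forall>j\<in>I. h (XSL n q i j) = y i j"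
proof -
  interpret C: kalgebra C by fact
  have yc: "y i j \<in> carrier C" if "i \<in> I" "j \<in> I" for i j using qmatrixD(1)[OF y(1)] that by blast
  obtain h where h: "h \<in> alg_hom F C" and hX: "\<forall>i\<in>I. \<forall>j\<in>I. h (X i j) = y i j"
    using F_eval[OF C, of y] yc by blast
  have "qmatrix C I q (\<lambda>i j. h (X i j))"
    using y(1) qmatrix_cong[of I "\<lambda>i j. h (X i j)" y C q] hX by simp
  \<comment> \<open>The evaluation agrees with \<open>y\<close> only at indices in \<open>I\<close>,
    and these are the only ones occurring in the determinant.\<close>
  moreover have "qdet_rows C I q (\<lambda>i j. h (X i j)) ks = qdet_rows C I q y ks" if "set ks \<subseteq> I" for ks
  proof -
    have "word_prod C (\<lambda>i j. h (X i j)) ks cs = word_prod C y ks cs" if "set ks \<subseteq> I" "set cs \<subseteq> I" for ks cs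
      using that by (induction ks cs rule: list_induct2') (auto simp: hX)
    then show ?thesis
      unfolding qdet_rows_def using that yc
      by (intro C.finsum_eqI) (auto intro!: C.word_prod_closed[of I] dest: permutations_of_setD)
  qed
  ultimately have "\<forall>r\<in>qrels n q. h r = \<zero>\<^bsub>C\<^esub>"
    unfolding qrels_hom_iff[OF C h] using y(2) by simp
  note kill = SL_ideal_kernel[OF C h this]
  show ?thesis
  proof (intro bexI ballI)
    show "descend h \<in> alg_hom A C" unfolding A_eq by (rule SI.descend_alg_hom[OF C h kill])
    fix i j assume "i \<in> I" "j \<in> I"
    then show "descend h (XSL n q i j) = y i j"
      unfolding projSL_X[symmetric]
      by (subst SI.descend_lin_map_coset[OF C alg_hom_lin_map[OF h] kill]) (auto simp: hX)
  qed
qed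

end

section \<open>Comultiplication and coactions\<close>

context quantum
begin

abbreviation A2 where "A2 \<equiv> tensor_alg A A"

text \<open>The prescribed values are the entries of the product of \<open>x\<close> and
  \<open>y\<close>, the two copies of the generating matrix in the tensor square. That product is
  again a quantum matrix with quantum determinant \<open>1\<close>, so the universal property yields
  a homomorphism for the choice to pick.\<close>

lemma comultSL_spec:
  shows comultSL_hom: "comultSL n q \<in> alg_hom A (A2)"
    and comultSL_X: "i \<in> I \<Longrightarrow> j \<in> I \<Longrightarrow> comultSL n q (XSL n q i j) =
      (\<Oplus>\<^bsub>A2\<^esub>r \<in> I. tens A A (XSL n q i r) (XSL n q r j))"
proof -
  interpret P: kalgebra_pair A A by (intro kalgebra_pair.intro A.kalgebra_axioms)
  define x y where "x = (\<lambda>i j. tens A A (XSL n q i j) \<one>\<^bsub>A\<^esub>)" and "y = (\<lambda>i j. tens A A \<one>\<^bsub>A\<^esub> (XSL n q i j))"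
  interpret M: qmatrix_pair "A2" I q x y
  proof
    show "qmatrix (A2) I q x" unfolding x_def
      by (rule alg_hom_qmatrix[OF A.kalgebra_axioms P.tens_left_alg_hom qmatrix_SL(1)])
    show "qmatrix (A2) I q y" unfolding y_def
      by (rule alg_hom_qmatrix[OF A.kalgebra_axioms P.tens_right_alg_hom qmatrix_SL(1)])
  qed (simp_all add: q0 x_def y_def P.tens_mult)
  have "qdet_rows (A2) I q x (slist I) = \<one>\<^bsub>A2\<^esub>"
    unfolding x_def
    by (subst alg_hom_qdet_rows[OF A.kalgebra_axioms P.T.kalgebra_axioms P.tens_left_alg_hom, symmetric])
       (simp_all add: qmatrix_SL(2) P.tens_one)
  moreover have "qdet_rows (A2) I q y (slist I) = \<one>\<^bsub>A2\<^esub>"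
    unfolding y_def
    by (subst alg_hom_qdet_rows[OF A.kalgebra_axioms P.T.kalgebra_axioms P.tens_right_alg_hom, symmetric])
       (simp_all add: qmatrix_SL(2) P.tens_one)
  ultimately have det: "qdet_rows (A2) I q (mat_prod (A2) I x y) (slist I)
      = \<one>\<^bsub>A2\<^esub>"
    by (simp add: M.qdet_mat_prod)
  have z: "mat_prod (A2) I x y i j =
      (\<Oplus>\<^bsub>A2\<^esub>r \<in> I. tens A A (XSL n q i r) (XSL n q r j))" if "i \<in> I" "j \<in> I" for i j
    unfolding mat_prod_def x_def y_def using that
    by (intro P.T.finsum_eqI) (simp_all add: P.tens_mult)
  obtain h where "h \<in> alg_hom A (A2)"
      "\<forall>i\<in>I. \<forall>j\<in>I. h (XSL n q i j) = mat_prod (A2) I x y i j"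
    using SL_universal[OF P.T.kalgebra_axioms M.qmatrix_mat_prod det] by blast
  then have "\<exists>h. h \<in> alg_hom A (A2) \<and> (\<forall>i \<in> I. \<forall>j \<in> I. h (XSL n q i j) =
          (\<Oplus>\<^bsub>A2\<^esub>r \<in> I. tens A A (XSL n q i r) (XSL n q r j)))"
    using z by auto
  from someI_ex[OF this]
  show "comultSL n q \<in> alg_hom A (A2)"
    and "i \<in> I \<Longrightarrow> j \<in> I \<Longrightarrow> comultSL n q (XSL n q i j) =
      (\<Oplus>\<^bsub>A2\<^esub>r \<in> I. tens A A (XSL n q i r) (XSL n q r j))"
    unfolding comultSL_def Let_def I_def by blast+
qed

section \<open>The torus quotient\<close>

abbreviation T where "T \<equiv> OqT n q"

lemma T_gens_closed: "{XSL n q i j | i j. i \<in> I \<and> j \<in> I \<and> i \<noteq> j} \<subseteq> carrier A"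
  by auto

sublocale TI: kalgebra_ideal A "T_ideal n q"
  unfolding T_ideal_def I_def
  by (intro kalgebra_ideal.intro A.kalgebra_axioms A.genideal_ideal T_gens_closed)

lemma T_eq: "T = TI.Q" by (simp add: OqT_def)

sublocale T: kalgebra T unfolding T_eq by (rule TI.kalgebra_quot)

abbreviation projT where "projT \<equiv> (\<lambda>x. T_ideal n q +>\<^bsub>A\<^esub> x)"

lemma projT_hom: "projT \<in> alg_hom A T"
  unfolding T_eq by (rule TI.coset_alg_hom)

lemma projT_zero:
  assumes "i \<in> I" "j \<in> I" "i \<noteq> j"
  shows "projT (XSL n q i j) = \<zero>\<^bsub>T\<^esub>"
proof -
  have "XSL n q i j \<in> T_ideal n q"
    unfolding T_ideal_def I_def using A.genideal_self[OF T_gens_closed] assms by blast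
  then show ?thesis unfolding T_eq using TI.coset_zero_iff assms by simp
qed

lemma YT_car [simp]: "i \<in> I \<Longrightarrow> YT n q i \<in> carrier T"
  unfolding YT_def by (rule alg_hom_closed[OF projT_hom]) simp

end

section \<open>The Borel quotients, their comultiplication and their coactions\<close>

locale quantum_borel = quantum n q I for n :: nat and q :: "'k::field" and I :: "nat set" +
  fixes s :: pm
begin

abbreviation B where "B \<equiv> OqB n q s"

abbreviation B2 where "B2 \<equiv> tensor_alg B B"

lemma B_gens_closed: "{XSL n q i j | i j. i \<in> I \<and> j \<in> I \<and> zero_pos s i j} \<subseteq> carrier A"
  by auto

sublocale BI: kalgebra_ideal A "B_ideal n q s"
  unfolding B_ideal_def I_def
  by (intro kalgebra_ideal.intro A.kalgebra_axioms A.genideal_ideal B_gens_closed)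

lemma B_eq: "B = BI.Q" by (simp add: OqB_def)

sublocale B: kalgebra B unfolding B_eq by (rule BI.kalgebra_quot)

lemma projB_eq: "projB n q s = (\<lambda>x. B_ideal n q s +>\<^bsub>A\<^esub> x)"
  by (rule ext) (simp add: projB_def)

lemma projB_hom: "projB n q s \<in> alg_hom A B"
  unfolding B_eq projB_eq by (rule BI.coset_alg_hom)

abbreviation Xb where "Xb \<equiv> XB n q s"

lemma X_zero:
  assumes "i \<in> I" "j \<in> I" "zero_pos s i j"
  shows "Xb i j = \<zero>\<^bsub>B\<^esub>"
proof -
  have "XSL n q i j \<in> B_ideal n q s"
    unfolding B_ideal_def I_def using A.genideal_self[OF B_gens_closed] assms by blast
  then show ?thesis unfolding B_eq XB_def projB_eq using BI.coset_zero_iff assms by simp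
qed

lemma qmatrix_B: "qmatrix B I q Xb"
  using alg_hom_qmatrix[OF A.kalgebra_axioms projB_hom qmatrix_SL(1)] by (simp add: XB_def[abs_def])

lemma qdet_B: "qdet_rows B I q Xb (slist I) = \<one>\<^bsub>B\<^esub>"
  using alg_hom_qdet_rows[OF A.kalgebra_axioms B.kalgebra_axioms projB_hom, of I "XSL n q" "slist I" q]
    alg_hom_one[OF projB_hom]
  by (simp add: XB_def[abs_def] qmatrix_SL(2))

lemma X_car [simp]: "i \<in> I \<Longrightarrow> j \<in> I \<Longrightarrow> Xb i j \<in> carrier B"
  using qmatrixD(1)[OF qmatrix_B] by blast

lemma descend_B:
  assumes C: "kalgebra C" and h: "h \<in> alg_hom A C"
    and z: "\<And>i j. i \<in> I \<Longrightarrow> j \<in> I \<Longrightarrow> zero_pos s i j \<Longrightarrow> h (XSL n q i j) = \<zero>\<^bsub>C\<^esub>"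
  shows "\<exists>g \<in> alg_hom B C. \<forall>x\<in>carrier A. g (projB n q s x) = h x"
proof -
  have kill: "h x = \<zero>\<^bsub>C\<^esub>" if "x \<in> B_ideal n q s" for x
    by (rule alg_hom_kills_genideal[OF A.kalgebra_axioms C h B_gens_closed _ that[unfolded B_ideal_def I_def]])
       (use z in auto)
  show ?thesis
  proof (intro bexI ballI)
    show "descend h \<in> alg_hom B C" unfolding B_eq by (rule BI.descend_alg_hom[OF C h kill])
    fix x assume "x \<in> carrier A"
    then show "descend h (projB n q s x) = h x"
      unfolding projB_eq by (intro BI.descend_lin_map_coset[OF C alg_hom_lin_map[OF h] kill])
  qed
qed

text \<open>The coideal property: when \<open>X i j\<close> is killed, each summand of its
  comultiplication has a killed tensor factor.\<close>

lemma zero_pos_trans: "zero_pos s i j \<Longrightarrow> zero_pos s i r \<or> zero_pos s r j"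
  by (cases s) auto

text \<open>The comultiplication followed by the projection in both factors vanishes on the killed
  generators by \<open>zero_pos_trans\<close>, hence factors through \<open>B\<close>.\<close>

lemma comultB_spec:
  shows comultB_hom: "comultB n q s \<in> alg_hom B (B2)"
    and comultB_X: "i \<in> I \<Longrightarrow> j \<in> I \<Longrightarrow> comultB n q s (Xb i j) =
      (\<Oplus>\<^bsub>B2\<^esub>r \<in> I. tens B B (Xb i r) (Xb r j))"
proof -
  interpret P: kalgebra_pair B B by (intro kalgebra_pair.intro B.kalgebra_axioms)
  interpret PA: kalgebra_pair A A by (intro kalgebra_pair.intro A.kalgebra_axioms)
  note tm = tensor_map_spec[OF A.kalgebra_axioms A.kalgebra_axioms B.kalgebra_axioms B.kalgebra_axioms projB_hom projB_hom]
  define G where "G = tensor_map A A B B (projB n q s) (projB n q s) \<circ> comultSL n q"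
  have G: "G \<in> alg_hom A (B2)"
    unfolding G_def by (rule alg_hom_comp[OF tm(1) comultSL_hom])
  have GX: "G (XSL n q i j) = (\<Oplus>\<^bsub>B2\<^esub>r \<in> I. tens B B (Xb i r) (Xb r j))"
    if "i \<in> I" "j \<in> I" for i j
  proof -
    have "G (XSL n q i j) = (\<Oplus>\<^bsub>B2\<^esub>r \<in> I.
      tensor_map A A B B (projB n q s) (projB n q s) (tens A A (XSL n q i r) (XSL n q r j)))"
      unfolding G_def o_apply comultSL_X[OF that] using that
      by (intro lin_map_finsum[OF PA.T.kalgebra_axioms P.T.kalgebra_axioms alg_hom_lin_map[OF tm(1)]]) auto
    also have "\<dots> = (\<Oplus>\<^bsub>B2\<^esub>r \<in> I. tens B B (Xb i r) (Xb r j))"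
      using that by (intro P.T.finsum_eqI) (simp_all add: tm(2) XB_def[symmetric])
    finally show ?thesis .
  qed
  have "G (XSL n q i j) = \<zero>\<^bsub>B2\<^esub>" if "i \<in> I" "j \<in> I" "zero_pos s i j" for i j
  proof -
    have "tens B B (Xb i r) (Xb r j) = \<zero>\<^bsub>B2\<^esub>" if "r \<in> I" for r
      using zero_pos_trans[OF \<open>zero_pos s i j\<close>, of r] that \<open>i \<in> I\<close> \<open>j \<in> I\<close> by (auto simp: X_zero)
    then show ?thesis using that by (simp add: GX P.T.add.finprod_one_eqI)
  qed
  from descend_B[OF P.T.kalgebra_axioms G this]
  have "\<exists>h. h \<in> alg_hom B (B2) \<and> (\<forall>x \<in> carrier A. h (projB n q s x) =
      tensor_map A A B B (projB n q s) (projB n q s) (comultSL n q x))"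
    by (auto simp: G_def)
  from someI_ex[OF this]
  have *: "comultB n q s \<in> alg_hom B (B2)"
    "\<And>x. x \<in> carrier A \<Longrightarrow> comultB n q s (projB n q s x) =  G x"
    unfolding comultB_def Let_def G_def by auto
  show "comultB n q s \<in> alg_hom B (B2)" by (rule *(1))
  show "comultB n q s (Xb i j) = (\<Oplus>\<^bsub>B2\<^esub>r \<in> I. tens B B (Xb i r) (Xb r j))" if "i \<in> I" "j \<in> I"
    unfolding XB_def[of n q s i j] using that by (simp add: *(2) GX)
qed

text \<open>Killed positions are off the diagonal, so the projection of \<open>A\<close> onto the
  torus factors through \<open>B\<close>.\<close>

lemma projBT_spec:
  shows projBT_hom: "projBT n q s \<in> alg_hom B T"
    and projBT_diag: "i \<in> I \<Longrightarrow> projBT n q s (Xb i i) = YT n q i"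
    and projBT_off_diag: "i \<in> I \<Longrightarrow> j \<in> I \<Longrightarrow> i \<noteq> j \<Longrightarrow> projBT n q s (Xb i j) = \<zero>\<^bsub>T\<^esub>"
proof -
  have "i \<noteq> j" if "zero_pos s i j" for i j using that by (cases s) auto
  then obtain g where g: "g \<in> alg_hom B T" "\<forall>x\<in>carrier A. g (projB n q s x) = projT x"
    using descend_B[OF T.kalgebra_axioms projT_hom projT_zero] by blast
  then have "g (Xb i i) = YT n q i" "i \<noteq> j \<Longrightarrow> g (Xb i j) = \<zero>\<^bsub>T\<^esub>" if "i \<in> I" "j \<in> I" for i j
    using that projT_zero by (auto simp: XB_def YT_def)
  then have "\<exists>h. h \<in> alg_hom B T \<and> (\<forall>i \<in> I. h (Xb i i) = YT n q i) \<and>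
     (\<forall>i \<in> I. \<forall>j \<in> I. i \<noteq> j \<longrightarrow> h (Xb i j) = \<zero>\<^bsub>T\<^esub>)"
    using g(1) by blast
  from someI_ex[OF this]
  show "projBT n q s \<in> alg_hom B T"
    and "i \<in> I \<Longrightarrow> projBT n q s (Xb i i) = YT n q i"
    and "i \<in> I \<Longrightarrow> j \<in> I \<Longrightarrow> i \<noteq> j \<Longrightarrow> projBT n q s (Xb i j) = \<zero>\<^bsub>T\<^esub>"
    unfolding projBT_def I_def by blast+
qed

sublocale BB: kalgebra_pair B B by (intro kalgebra_pair.intro B.kalgebra_axioms)
sublocale BT: kalgebra_pair B T by (intro kalgebra_pair.intro B.kalgebra_axioms T.kalgebra_axioms)
sublocale TB: kalgebra_pair T B by (intro kalgebra_pair.intro B.kalgebra_axioms T.kalgebra_axioms)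

text \<open>The torus projection kills off-diagonal entries, so only \<open>r = j\<close> survives
  in the comultiplication of \<open>Xb i j\<close>.\<close>

lemma eta_spec:
  shows eta_hom: "eta n q s \<in> alg_hom B (tensor_alg B T)"
    and eta_X: "i \<in> I \<Longrightarrow> j \<in> I \<Longrightarrow> eta n q s (Xb i j) = tens B T (Xb i j) (YT n q j)"
proof -
  note tm = tensor_map_spec[OF B.kalgebra_axioms B.kalgebra_axioms B.kalgebra_axioms T.kalgebra_axioms id_alg_hom projBT_hom]
  show "eta n q s \<in> alg_hom B (tensor_alg B T)"
    unfolding eta_def Let_def by (rule alg_hom_comp[OF tm(1) comultB_hom])
  assume ij: "i \<in> I" "j \<in> I"
  have "eta n q s (Xb i j) = (\<Oplus>\<^bsub>tensor_alg B T\<^esub>r \<in> I. tensor_map B B B T id (projBT n q s) (tens B B (Xb i r) (Xb r j)))"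
    unfolding eta_def Let_def o_apply comultB_X[OF ij] using ij
    by (intro lin_map_finsum[OF BB.T.kalgebra_axioms BT.T.kalgebra_axioms alg_hom_lin_map[OF tm(1)]]) auto
  also have "\<dots> = tensor_map B B B T id (projBT n q s) (tens B B (Xb i j) (Xb j j))"
    using ij by (intro BT.T.finsum_single) (simp_all add: tm(2) projBT_off_diag projBT_diag)
  also have "\<dots> = tens B T (Xb i j) (YT n q j)" using ij by (simp add: tm(2) projBT_diag)
  finally show "eta n q s (Xb i j) = tens B T (Xb i j) (YT n q j)" .
qed

text \<open>As for \<open>eta\<close>, except that the projection now acts on the left factor and
  \<open>r = i\<close> survives.\<close>

lemma theta_spec:
  shows theta_hom: "theta n q s \<in> alg_hom B (tensor_alg T B)"
    and theta_X: "i \<in> I \<Longrightarrow> j \<in> I \<Longrightarrow> theta n q s (Xb i j) = tens T B (YT n q i) (Xb i j)"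
proof -
  note tm = tensor_map_spec[OF B.kalgebra_axioms B.kalgebra_axioms T.kalgebra_axioms B.kalgebra_axioms projBT_hom id_alg_hom]
  show "theta n q s \<in> alg_hom B (tensor_alg T B)"
    unfolding theta_def Let_def by (rule alg_hom_comp[OF tm(1) comultB_hom])
  assume ij: "i \<in> I" "j \<in> I"
  have "theta n q s (Xb i j) = (\<Oplus>\<^bsub>tensor_alg T B\<^esub>r \<in> I. tensor_map B B T B (projBT n q s) id (tens B B (Xb i r) (Xb r j)))"
    unfolding theta_def Let_def o_apply comultB_X[OF ij] using ij
    by (intro lin_map_finsum[OF BB.T.kalgebra_axioms TB.T.kalgebra_axioms alg_hom_lin_map[OF tm(1)]]) auto
  also have "\<dots> = tensor_map B B T B (projBT n q s) id (tens B B (Xb i i) (Xb i j))"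
    using ij by (intro TB.T.finsum_single) (simp_all add: tm(2) projBT_off_diag projBT_diag)
  also have "\<dots> = tens T B (YT n q i) (Xb i j)" using ij by (simp add: tm(2) projBT_diag)
  finally show "theta n q s (Xb i j) = tens T B (YT n q i) (Xb i j)" .
qed

end


section \<open>A functional on the torus\<close>

text \<open>The ground field as an algebra over itself, so that linear functionals become instances
  of \<open>lin_map\<close>.\<close>

definition field_alg :: "('k::field, 'k) module" where
  "field_alg = \<lparr>carrier = UNIV, monoid.mult = (*), one = 1, zero = 0, add = (+), smult = (*)\<rparr>"

lemma field_alg_simps [simp]:
  "carrier field_alg = UNIV" "(\<otimes>\<^bsub>field_alg\<^esub>) = (*)" "\<one>\<^bsub>field_alg\<^esub> = 1" "\<zero>\<^bsub>field_alg\<^esub> = 0"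
  "(\<oplus>\<^bsub>field_alg\<^esub>) = (+)" "(\<odot>\<^bsub>field_alg\<^esub>) = (*)"
  by (simp_all add: field_alg_def)

interpretation field_alg: kalgebra "field_alg :: ('k::field, 'k) module"
proof (intro kalgebra.intro kalgebra_axioms.intro ringI abelian_groupI monoidI)
  fix x :: 'k
  show "\<exists>y\<in>carrier field_alg. y \<oplus>\<^bsub>field_alg\<^esub> x = \<zero>\<^bsub>field_alg\<^esub>" by (auto intro: exI[of _ "- x"])
qed (auto simp: algebra_simps)

lemma field_alg_minus [simp]: "x \<ominus>\<^bsub>field_alg\<^esub> y = (x :: 'k::field) - y"
proof -
  have "\<ominus>\<^bsub>field_alg\<^esub> y = - y" by (rule field_alg.minus_equality) auto
  then show ?thesis by (simp add: field_alg.minus_eq)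
qed

text \<open>Invariant under the two moves that are available in the torus: reordering the letters
  and inserting one full run of the diagonal letters.\<close>

definition balanced :: "'a set \<Rightarrow> ('a \<times> 'a) list \<Rightarrow> bool" where
  "balanced I w \<longleftrightarrow> (\<forall>p\<in>set w. fst p = snd p) \<and>
     (\<forall>i\<in>I. \<forall>j\<in>I. count_list w (i, i) = count_list w (j, j))"

lemma balanced_mset: "mset v = mset w \<Longrightarrow> balanced I v = balanced I w"
  unfolding balanced_def
  by (metis count_list_eq_length_filter mset_filter set_mset_mset size_mset)

lemma not_balancedI: "(i, j) \<in> set w \<Longrightarrow> i \<noteq> j \<Longrightarrow> \<not> balanced I w"
  by (force simp: balanced_def)

lemma count_list_zip_same: "count_list (zip w w) (i, i) = count_list w i"
  by (induction w) auto

lemma balanced_diagonal: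
  assumes "distinct e" "set e = I"
  shows "balanced I (u @ zip e e @ v) = balanced I (u @ v)"
proof -
  have "count_list (zip e e) (i, i) = 1" if "i \<in> I" for i
    using that assms unfolding count_list_zip_same by (metis count_mset distinct_count_atmost_1)
  moreover have "\<forall>p\<in>set (zip e e). fst p = snd p" by (auto simp: zip_same)
  ultimately show ?thesis by (simp add: balanced_def ball_Un)
qed

context quantum
begin

text \<open>The torus is the ring of Laurent monomials in the \<open>Y\<^sub>i\<^sub>i\<close> modulo \<open>Y\<^sub>1\<^sub>1 \<cdots> = 1\<close>.  The functional reads off
  the coefficient of the trivial monomial; on the free algebra it selects the words in which only
  diagonal letters occur, all of them equally often.\<close>

definition word_functional :: "((nat \<times> nat) list \<Rightarrow>\<^sub>0 'k) \<Rightarrow> 'k" where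
  "word_functional = lin_ext field_alg (\<lambda>w. if balanced I w then 1 else 0)"

lemma word_functional_lin: "word_functional \<in> lin_map F field_alg"
  unfolding word_functional_def F_eq by (rule field_alg.lin_ext_lin_map) simp

lemma word_functional_single [simp]:
  "word_functional (single w c) = (if balanced I w then c else 0)"
  by (simp add: word_functional_def field_alg.lin_ext_single)

text \<open>Row and column relations have an off-diagonal letter in every term. The two commutation
  relations compare reorderings of one word, and the extra term of the second has an off-diagonal
  letter. In the determinant only the identity permutation contributes.\<close>

lemma word_functional_rel:
  assumes u: "u \<in> lists (I \<times> I)" and v: "v \<in> lists (I \<times> I)" and r: "r \<in> qrels n q"
  shows "word_functional (single u 1 \<otimes>\<^bsub>F\<^esub> r \<otimes>\<^bsub>F\<^esub> single v 1) = 0"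
proof -
  define su sv where "su = (single u 1 :: (nat \<times> nat) list \<Rightarrow>\<^sub>0 'k)"
    and "sv = (single v 1 :: (nat \<times> nat) list \<Rightarrow>\<^sub>0 'k)"
  have s [simp]: "su \<in> carrier F" "sv \<in> carrier F" using u v by (auto simp: su_def sv_def F_car)
  define \<phi> where "\<phi> = (\<lambda>r. word_functional (su \<otimes>\<^bsub>F\<^esub> r \<otimes>\<^bsub>F\<^esub> sv))"
  have L: "\<phi> \<in> lin_map F field_alg"
    unfolding \<phi>_def
    by (rule lin_mapI)
       (simp_all add: F.l_distr F.r_distr F.smult_mult_l F.smult_mult_r
          lin_map_add[OF word_functional_lin] lin_map_smult[OF word_functional_lin])
  note Ls = lin_map_minus[OF F.kalgebra_axioms field_alg.kalgebra_axioms L] lin_map_smult[OF L]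
  have single: "\<phi> (single w c) = (if balanced I (u @ w @ v) then c else 0)" for w c
    by (simp add: \<phi>_def su_def sv_def F_single_mult)
  have XX: "\<phi> (X i j \<otimes>\<^bsub>F\<^esub> X l m) = (if balanced I (u @ [(i, j), (l, m)] @ v) then 1 else 0)" for i j l m
    by (simp add: free_gen_def F_single_mult single)
  have off: "\<not> balanced I (u @ [(i, j), (l, m)] @ v)" if "i \<noteq> j \<or> l \<noteq> m" for i j l m
    using that by (auto simp: balanced_def)
  have comm: "balanced I (u @ [(i, j), (l, m)] @ v) = balanced I (u @ [(l, m), (i, j)] @ v)" for i j l m
    by (rule balanced_mset) simp
  from r have "\<phi> r = 0"
  proof (cases rule: qrels_cases)
    case (row i j m)
    then show ?thesis by (simp only: Ls XX F.m_closed F.smult_closed X_car) (use off in auto)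
  next
    case (col i j l)
    then show ?thesis by (simp only: Ls XX F.m_closed F.smult_closed X_car) (use off in auto)
  next
    case (anti i j l m)
    then show ?thesis by (simp only: Ls XX F.m_closed F.smult_closed X_car) (use comm in auto)
  next
    case (diag i j l m)
    \<comment> \<open>If both equalities held, then \<open>i < l = j < m = i\<close>.\<close>
    then have "i \<noteq> m \<or> l \<noteq> j" by auto
    then show ?thesis
      using diag by (simp only: Ls XX F.m_closed F.smult_closed F.minus_closed X_car off comm[of i j l m]) simp
  next
    case det
    define e where "e = slist I"
    have e: "set e = I" "distinct e" by (auto simp: e_def)
    have wp: "word_prod F X e cs = single (zip e cs) 1" for cs
      by (simp add: word_prod_eval_word single_eval_word)
    have fc: "single (zip e cs) 1 \<in> carrier F" if "cs \<in> permutations_of_set I" for cs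
      using that e by (auto simp: F_car permutations_of_set_def dest: set_zip_leftD set_zip_rightD)
    have "\<phi> (qdet n q) = (\<Oplus>\<^bsub>field_alg\<^esub>cs\<in>permutations_of_set I. \<phi> ((- q) ^ ninv cs \<odot>\<^bsub>F\<^esub> single (zip e cs) 1))"
      unfolding qdet_eq qdet_rows_def e_def[symmetric] wp using fc
      by (intro lin_map_finsum[OF F.kalgebra_axioms field_alg.kalgebra_axioms L]) auto
    also have "\<dots> = \<phi> ((- q) ^ ninv e \<odot>\<^bsub>F\<^esub> single (zip e e) 1)"
    proof (rule field_alg.finsum_single)
      \<comment> \<open>A permutation other than the identity moves some index and so puts an
        off-diagonal letter into its word.\<close>
      fix cs assume cs: "cs \<in> permutations_of_set I" "cs \<noteq> e"
      have "length cs = length e" using cs e by (simp add: permutations_of_set_length e_def)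
      then obtain k where "k < length e" "e ! k \<noteq> cs ! k" using cs(2) by (metis nth_equalityI)
      then have "(e ! k, cs ! k) \<in> set (zip e cs)" using \<open>length cs = length e\<close> by (auto simp: set_zip)
      then have "\<not> balanced I (u @ zip e cs @ v)"
        using \<open>e ! k \<noteq> cs ! k\<close> by (intro not_balancedI[of "e ! k" "cs ! k"]) simp_all
      then show "\<phi> ((- q) ^ ninv cs \<odot>\<^bsub>F\<^esub> single (zip e cs) 1) = \<zero>\<^bsub>field_alg\<^esub>"
        using fc[OF cs(1)] by (simp add: Ls single)
    qed (use e fc[of e] in \<open>simp_all add: permutations_of_setI\<close>)
    \<comment> \<open>The identity has no inversions, so its coefficient is \<open>1\<close>;
      inserting its word does not affect balance.\<close>
    also have "\<dots> = (if balanced I (u @ v) then 1 else 0)"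
      using fc[of e] e ninv_sorted[of e]
      by (simp add: Ls single balanced_diagonal permutations_of_set_def e_def)
    finally have "\<phi> (qdet n q) = \<phi> \<one>\<^bsub>F\<^esub>" by (simp add: F_one single)
    then show ?thesis unfolding det using qdet_car by (simp add: Ls)
  qed
  then show ?thesis by (simp add: \<phi>_def su_def sv_def)
qed

text \<open>The functional on the free algebra descends twice, first modulo the quantum relations
  and then modulo the off-diagonal generators. It is not multiplicative, so both times the products
  of a generator with arbitrary factors have to be examined.\<close>

lemma torus_functional:
  "\<exists>f \<in> lin_map T field_alg. \<forall>w \<in> lists (I \<times> I).
     f (projT (projSL (single w 1))) = (if balanced I w then 1 else 0)"
proof -
  note L = word_functional_lin
  define Z where "Z = {x \<in> carrier F. word_functional x = 0}"
  have Z0: "0 \<in> Z" using F.zero_closed lin_map_zero[OF F.kalgebra_axioms field_alg.kalgebra_axioms L]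
    by (simp add: Z_def F_eq)
  have Zadd: "f + g \<in> Z" if "f \<in> Z" "g \<in> Z" for f g
    using that F.a_closed[of f g] lin_map_add[OF L, of f g] by (simp add: Z_def F_eq)
  have Zsm: "Poly_Mapping.map ((*) c) f \<in> Z" if "f \<in> Z" for c f
    using that F.smult_closed[of f c] lin_map_smult[OF L, of f c] by (simp add: Z_def F_eq)
  have car: "carrier F = {f. keys f \<subseteq> carrier (free_monoid (I \<times> I))}" by (simp add: F_car)
  have single_car: "u \<in> carrier (free_monoid (I \<times> I)) \<Longrightarrow> single u 1 \<in> carrier F" for u
    by (simp add: F_car)
  have "SL_ideal n q \<subseteq> Z"
    unfolding SL_ideal_def F_eq
  proof (rule genideal_monoid_alg_subset[OF monoid_free_monoid _ Z0 Zadd Zsm])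
    show "qrels n q \<subseteq> {f. keys f \<subseteq> carrier (free_monoid (I \<times> I))}"
      using qrels_closed car by simp
    fix u v r assume "u \<in> carrier (free_monoid (I \<times> I))" "v \<in> carrier (free_monoid (I \<times> I))" "r \<in> qrels n q"
    then show "single u 1 \<otimes>\<^bsub>monoid_alg (free_monoid (I \<times> I)) :: ('k, _) module\<^esub> r
        \<otimes>\<^bsub>monoid_alg (free_monoid (I \<times> I)) :: ('k, _) module\<^esub> single v 1 \<in> Z"
      unfolding F_eq[symmetric] Z_def using qrels_closed single_car
      by (auto intro!: word_functional_rel F.m_closed)
  qed
  then have kill: "word_functional x = \<zero>\<^bsub>field_alg\<^esub>" if "x \<in> SL_ideal n q" for x using that by (auto simp: Z_def)
  define f1 where "f1 = descend word_functional"
  have f1: "f1 \<in> lin_map A field_alg"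
    unfolding f1_def A_eq by (rule SI.descend_lin_map[OF field_alg.kalgebra_axioms L kill])
  have f1_proj: "f1 (projSL x) = word_functional x" if "x \<in> carrier F" for x
    unfolding f1_def by (rule SI.descend_lin_map_coset[OF field_alg.kalgebra_axioms L kill that])
  define Z1 where "Z1 = {x \<in> carrier A. f1 x = 0}"
  have "T_ideal n q \<subseteq> Z1"
    unfolding T_ideal_def I_def
  proof (rule A.genideal_subset[OF T_gens_closed])
    show "\<zero>\<^bsub>A\<^esub> \<in> Z1" using lin_map_zero[OF A.kalgebra_axioms field_alg.kalgebra_axioms f1] by (simp add: Z1_def)
    show "x \<oplus>\<^bsub>A\<^esub> y \<in> Z1" if "x \<in> Z1" "y \<in> Z1" for x y
      using that lin_map_add[OF f1, of x y] by (simp add: Z1_def)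
    show "c \<odot>\<^bsub>A\<^esub> x \<in> Z1" if "x \<in> Z1" for c x
      using that lin_map_smult[OF f1, of x c] by (simp add: Z1_def)
  next
    fix u v r assume u: "u \<in> carrier A" and v: "v \<in> carrier A"
      and "r \<in> {XSL n q i j |i j. i \<in> I \<and> j \<in> I \<and> i \<noteq> j}"
    then obtain i j where r: "r = XSL n q i j" and ij [simp]: "i \<in> I" "j \<in> I" and neq: "i \<noteq> j" by blast
    \<comment> \<open>Lifting both factors to the free algebra makes the test on words available;
      any word around an off-diagonal letter is unbalanced.\<close>
    obtain u' v' where u': "u' \<in> carrier F" "u = projSL u'" and v': "v' \<in> carrier F" "v = projSL v'"
      using projSL_surj u v by blast
    have "u' \<otimes>\<^bsub>F\<^esub> X i j \<otimes>\<^bsub>F\<^esub> v' \<in> Z"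
      unfolding F_eq
    proof (rule monoid_alg_sandwich[OF monoid_free_monoid Z0 Zadd Zsm])
      fix a b assume ab: "a \<in> carrier (free_monoid (I \<times> I))" "b \<in> carrier (free_monoid (I \<times> I))"
      have "\<not> balanced I (a @ (i, j) # b)" using neq by (auto simp: balanced_def)
      then have "word_functional (single a 1 \<otimes>\<^bsub>F\<^esub> X i j \<otimes>\<^bsub>F\<^esub> single b 1) = 0"
        by (simp add: free_gen_def F_single_mult)
      then show "single a 1 \<otimes>\<^bsub>monoid_alg (free_monoid (I \<times> I)) :: ('k, _) module\<^esub> X i j
        \<otimes>\<^bsub>monoid_alg (free_monoid (I \<times> I)) :: ('k, _) module\<^esub> single b 1 \<in> Z"
        unfolding F_eq[symmetric] Z_def using single_car ab by (auto intro!: F.m_closed)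
    qed (use u' v' X_car[OF ij] in \<open>auto simp: F_car\<close>)
    then have "f1 (projSL (u' \<otimes>\<^bsub>F\<^esub> X i j \<otimes>\<^bsub>F\<^esub> v')) = 0" by (simp add: f1_proj Z_def)
    then have "f1 (u \<otimes>\<^bsub>A\<^esub> r \<otimes>\<^bsub>A\<^esub> v) = 0"
      using u' v' by (simp add: r alg_hom_mult[OF projSL_hom] projSL_X)
    then show "u \<otimes>\<^bsub>A\<^esub> r \<otimes>\<^bsub>A\<^esub> v \<in> Z1" using u v by (simp add: Z1_def r)
  qed
  then have kill1: "f1 x = \<zero>\<^bsub>field_alg\<^esub>" if "x \<in> T_ideal n q" for x using that by (auto simp: Z1_def)
  show ?thesis
  proof (intro bexI ballI)
    show "descend f1 \<in> lin_map T field_alg"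
      unfolding T_eq by (rule TI.descend_lin_map[OF field_alg.kalgebra_axioms f1 kill1])
    fix w assume "w \<in> lists (I \<times> I)"
    then have c: "single w 1 \<in> carrier F" by (simp add: F_car)
    show "descend f1 (projT (projSL (single w 1))) = (if balanced I w then 1 else 0)"
      using c alg_hom_closed[OF projSL_hom c]
      by (simp add: TI.descend_lin_map_coset[OF field_alg.kalgebra_axioms f1 kill1] f1_proj)
  qed
qed

end

section \<open>Diagonal monomials and normal forms in the Borel quotients\<close>

lemma (in kalgebra) word_prod_zero:
  assumes "\<And>i j. i \<in> I \<Longrightarrow> j \<in> I \<Longrightarrow> x i j \<in> carrier A" "set ks \<subseteq> I" "set cs \<subseteq> I"
    and "(i, j) \<in> set (zip ks cs)" "x i j = \<zero>"
  shows "word_prod A x ks cs = \<zero>"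
  using assms(2-4)
proof (induction ks cs rule: list_induct2')
  case (4 k ks c cs)
  then show ?case using word_prod_closed[of I x ks cs] assms(1,5) by auto
qed auto

lemma (in monoid) commute_inv:
  assumes "x \<in> Units G" "y \<in> carrier G" "x \<otimes> y = y \<otimes> x"
  shows "inv x \<otimes> y = y \<otimes> inv x"
proof -
  note c = assms(2) Units_closed[OF assms(1)] Units_inv_closed[OF assms(1)]
  have "inv x \<otimes> y = inv x \<otimes> (y \<otimes> x) \<otimes> inv x"
    using assms(1) c by (simp add: m_assoc)
  also have "\<dots> = y \<otimes> inv x"
    unfolding assms(3)[symmetric] using assms(1) c by (simp add: m_assoc[symmetric])
  finally show ?thesis .
qed

context quantum_borel
begin

abbreviation multB (infixl "\<star>" 70) where "x \<star> y \<equiv> x \<otimes>\<^bsub>B\<^esub> y"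

text \<open>The cross term of the mixed relation contains the positions \<open>(k, l)\<close> and
  \<open>(l, k)\<close>, one of which is killed.\<close>

lemma diag_commute:
  assumes "k \<in> I" "l \<in> I"
  shows "Xb k k \<star> Xb l l = Xb l l \<star> Xb k k"
proof -
  have *: "Xb k k \<star> Xb l l = Xb l l \<star> Xb k k" if "k \<in> I" "l \<in> I" "k < l" for k l
  proof -
    have "zero_pos s k l \<or> zero_pos s l k" using that by (cases s) auto
    then show ?thesis using qmatrixD(5)[OF qmatrix_B, of k k l l] that by (auto simp: X_zero)
  qed
  show ?thesis using *[of k l] *[of l k] assms by (cases k l rule: linorder_cases) auto
qed

text \<open>A common row or column contributes a power of \<open>q\<close>. When \<open>k\<close> is
  smaller than both \<open>a\<close> and \<open>b\<close>, or larger than both, the cross term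
  involves the positions \<open>(a, k)\<close> and \<open>(k, b)\<close>; for either sign one of
  them is killed.\<close>

lemma diag_scalar_commute:
  assumes k: "k \<in> I" and a: "a \<in> I" and b: "b \<in> I"
  shows "\<exists>c. Xb k k \<star> Xb a b = c \<odot>\<^bsub>B\<^esub> (Xb a b \<star> Xb k k)"
proof -
  note D = qmatrixD[OF qmatrix_B]
  have inv: "\<exists>c. u = c \<odot>\<^bsub>B\<^esub> v" if "v = q \<odot>\<^bsub>B\<^esub> u" "u \<in> carrier B" for u v
    by (rule exI[of _ "inverse q"]) (use that q0 in \<open>simp add: B.smult_assoc\<close>)
  have eq: "\<exists>c. u = c \<odot>\<^bsub>B\<^esub> v" if "u = v" "v \<in> carrier B" for u v
    by (rule exI[of _ 1]) (use that in simp)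
  show ?thesis
  proof (cases "zero_pos s a b")
    case True
    then show ?thesis using assms by (auto simp: X_zero)
  next
    case nz: False
    consider "k = a" "k = b" | "k = a" "k < b" | "k = a" "b < k" | "k = b" "k < a" | "k = b" "a < k"
      | "k < a" "b < k" | "k < a" "k < b" | "a < k" "k < b" | "a < k" "b < k"
      using linorder_less_linear[of k a] linorder_less_linear[of k b] by blast
    then show ?thesis
    proof cases
      case 1 then show ?thesis using assms by (intro eq) auto
    next
      case 2 then show ?thesis using D(2)[OF k k b] by blast
    next
      case 3 then show ?thesis using inv[OF D(2)[OF k b k]] k b by simp
    next
      case 4 then show ?thesis using D(3)[OF k k a] by blast
    next
      case 5 then show ?thesis using inv[OF D(3)[OF a k k]] k a by simp
    next
      case 6 then show ?thesis using D(4)[of k k a b] assms by (intro eq) simp_all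
    next
      case 7
      then have "zero_pos s a k \<or> zero_pos s k b" by (cases s) auto
      then have "Xb k b \<star> Xb a k = \<zero>\<^bsub>B\<^esub>" using assms by (auto simp: X_zero)
      then show ?thesis using 7 D(5)[of k k a b] assms by (intro eq) auto
    next
      case 8 then show ?thesis using D(4)[of a b k k] assms by (intro eq) simp_all
    next
      case 9
      then have "zero_pos s a k \<or> zero_pos s k b" by (cases s) auto
      then have "Xb a k \<star> Xb k b = \<zero>\<^bsub>B\<^esub>" using assms by (auto simp: X_zero)
      then show ?thesis using 9 D(5)[of a b k k] assms by (intro eq) auto
    qed
  qed
qed

section \<open>Monomials in the diagonal generators\<close>

abbreviation Xd where "Xd w \<equiv> word_prod B Xb w w"

lemma Xd_closed [simp]: "set w \<subseteq> I \<Longrightarrow> Xd w \<in> carrier B"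
  by (rule B.word_prod_closed[of I]) auto

lemma Xd_append: "set v \<subseteq> I \<Longrightarrow> set w \<subseteq> I \<Longrightarrow> Xd (v @ w) = Xd v \<star> Xd w"
  by (rule B.word_prod_append[of I]) auto

lemma Xd_commute: "k \<in> I \<Longrightarrow> set w \<subseteq> I \<Longrightarrow> Xd w \<star> Xb k k = Xb k k \<star> Xd w"
proof (induction w)
  case (Cons a w)
  then have "Xd (a # w) \<star> Xb k k = Xb a a \<star> (Xd w \<star> Xb k k)" by (simp add: B.m_assoc)
  also have "\<dots> = (Xb a a \<star> Xb k k) \<star> Xd w" using Cons by (simp add: B.m_assoc)
  also have "\<dots> = Xb k k \<star> Xd (a # w)" using Cons by (simp add: diag_commute[of a k] B.m_assoc)
  finally show ?case .
qed simp

lemma Xd_mid: "i \<in> I \<Longrightarrow> set u \<subseteq> I \<Longrightarrow> set v \<subseteq> I \<Longrightarrow> Xd (u @ i # v) = Xb i i \<star> Xd (u @ v)"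
  using Xd_commute[of i u] by (simp add: Xd_append B.m_assoc[symmetric])

lemma Xd_mset: "mset v = mset w \<Longrightarrow> set v \<subseteq> I \<Longrightarrow> Xd v = Xd w"
proof (induction v arbitrary: w)
  case (Cons a v)
  then have "a \<in> set w" by (metis list.set_intros(1) mset_eq_setD)
  then obtain u1 u2 where w: "w = u1 @ a # u2" by (meson split_list)
  then have m: "mset v = mset (u1 @ u2)" using Cons by simp
  have "set w \<subseteq> I" using Cons mset_eq_setD by metis
  then have "Xd w = Xb a a \<star> Xd (u1 @ u2)" unfolding w by (intro Xd_mid) auto
  moreover have "Xd v = Xd (u1 @ u2)" using Cons.IH[OF m] Cons.prems by simp
  ultimately show ?case by simp
qed simp

text \<open>A permutation avoiding the killed positions would satisfy
  \<open>k \<le> \<sigma> k\<close> everywhere, or \<open>\<sigma> k \<le> k\<close> everywhere. The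
  sums over \<open>I\<close> agree, which forces equality at every index.\<close>

lemma permutation_zero_pos:
  assumes cs: "cs \<in> permutations_of_set I" and ne: "cs \<noteq> slist I"
  shows "\<exists>(i, j) \<in> set (zip (slist I) cs). zero_pos s i j"
proof (rule ccontr)
  define e where "e = slist I"
  assume "\<not> ?thesis"
  then have nz: "\<not> zero_pos s (e ! k) (cs ! k)" if "k < length e" "k < length cs" for k
    using that by (force simp: set_zip e_def)
  have len: "length cs = length e" using permutations_of_set_length[OF cs] by (simp add: e_def)
  have "sum_list cs = sum_list e"
    using cs sum_list_distinct_conv_sum_set[of cs "\<lambda>x. x"] sum_list_distinct_conv_sum_set[of e "\<lambda>x. x"]
    by (simp add: permutations_of_set_def e_def)
  then have sum: "(\<Sum>k\<in>{0..<length e}. cs ! k) = (\<Sum>k\<in>{0..<length e}. e ! k)"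
    by (simp add: sum_list_sum_nth len)
  have "cs ! k = e ! k" if "k < length e" for k
  proof (cases s)
    case PlusSign
    then have "e ! k \<le> cs ! k" if "k \<in> {0..<length e}" for k using nz[of k] that len by simp
    then show ?thesis using sum_mono_inv[OF sum[symmetric], of k] that by simp
  next
    case MinusSign
    then have "cs ! k \<le> e ! k" if "k \<in> {0..<length e}" for k using nz[of k] that len by simp
    then show ?thesis using sum_mono_inv[OF sum, of k] that by simp
  qed
  then have "cs = e" using len by (intro nth_equalityI) auto
  then show False using ne by (simp add: e_def)
qed

text \<open>Every term of the quantum determinant other than that of the identity contains a killed
  entry.\<close>

lemma Xd_all: "Xd (slist I) = \<one>\<^bsub>B\<^esub>"
proof -
  define e where "e = slist I"
  have e: "set e = I" "distinct e" "sorted_wrt (<) e" by (auto simp: e_def)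
  have "\<one>\<^bsub>B\<^esub> = (\<Oplus>\<^bsub>B\<^esub>cs\<in>permutations_of_set I. (- q) ^ ninv cs \<odot>\<^bsub>B\<^esub> word_prod B Xb e cs)"
    using qdet_B by (simp add: qdet_rows_def e_def)
  also have "\<dots> = (- q) ^ ninv e \<odot>\<^bsub>B\<^esub> word_prod B Xb e e"
  proof (rule B.finsum_single)
    fix cs assume cs: "cs \<in> permutations_of_set I" "cs \<noteq> e"
    then obtain i j where ij: "(i, j) \<in> set (zip e cs)" "zero_pos s i j"
      using permutation_zero_pos unfolding e_def by blast
    then have "i \<in> I" "j \<in> I" using cs e by (auto simp: permutations_of_set_def dest: set_zip_leftD set_zip_rightD)
    then have "word_prod B Xb e cs = \<zero>\<^bsub>B\<^esub>"
      using ij cs e by (intro B.word_prod_zero[of I]) (auto simp: permutations_of_set_def X_zero)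
    then show "(- q) ^ ninv cs \<odot>\<^bsub>B\<^esub> word_prod B Xb e cs = \<zero>\<^bsub>B\<^esub>" by simp
  qed (use e in \<open>simp_all add: permutations_of_setI\<close>)
  also have "\<dots> = Xd e" using e ninv_sorted by simp
  finally show ?thesis by (simp add: e_def)
qed

text \<open>Up to order, \<open>w\<close> consists of several copies of the list of all indices, and
  each copy contributes \<open>1\<close> by \<open>Xd_all\<close>. This matches the vanishing of
  \<open>f\<close> on all monomials that are not balanced.\<close>

lemma Xd_balanced:
  assumes "balanced I (zip w w)" "set w \<subseteq> I"
  shows "Xd w = \<one>\<^bsub>B\<^esub>"
proof (cases "w = []")
  case False
  define e where "e = slist I"
  have e: "set e = I" "distinct e" by (auto simp: e_def)
  define c where "c = count_list w (hd w)"
  have hd: "hd w \<in> I" using assms False by auto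
  have c: "count_list w i = c" if "i \<in> I" for i
    using assms(1) that hd unfolding balanced_def count_list_zip_same c_def by blast
  have rep: "Xd (concat (replicate m e)) = \<one>\<^bsub>B\<^esub>" for m
  proof (induction m)
    case (Suc m)
    have "set (concat (replicate m e)) \<subseteq> I" using e by auto
    then show ?case using Suc Xd_all e by (simp add: Xd_append e_def)
  qed simp
  have "mset w = mset (concat (replicate c e))"
  proof (rule multiset_eqI)
    fix i
    have "count_list (concat (replicate m e)) i = m * count_list e i" for m
      by (induction m) auto
    moreover have "count_list e i = (if i \<in> I then 1 else 0)"
      using e by (metis count_mset distinct_count_atmost_1)
    moreover have "i \<notin> I \<Longrightarrow> count_list w i = 0" using assms(2) by (auto simp: count_list_0_iff)
    ultimately show "count (mset w) i = count (mset (concat (replicate c e))) i"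
      using c[of i] by (simp only: count_mset) auto
  qed
  then show ?thesis using Xd_mset[of w] assms(2) rep by simp
qed simp

text \<open>By \<open>Xd_all\<close> the product of the remaining diagonal generators is an
  inverse.\<close>

lemma diag_unit: "i \<in> I \<Longrightarrow> Xb i i \<in> Units B"
proof -
  assume i: "i \<in> I"
  then obtain u v where e: "slist I = u @ i # v" using split_list[of i "slist I"] by auto
  then have uv: "set u \<subseteq> I" "set v \<subseteq> I" using set_sorted_list_of_set[OF fin] by auto
  have "Xb i i \<star> Xd (u @ v) = \<one>\<^bsub>B\<^esub>" using Xd_all Xd_mid[OF i uv] by (simp add: e)
  moreover have "Xd (u @ v) \<star> Xb i i = Xb i i \<star> Xd (u @ v)" using i uv by (intro Xd_commute) auto
  moreover have "Xd (u @ v) \<in> carrier B" using uv by simp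
  ultimately show ?thesis using i by (auto simp: Units_def)
qed

lemma diag_inv_closed [simp]: "i \<in> I \<Longrightarrow> inv\<^bsub>B\<^esub> Xb i i \<in> carrier B"
  using diag_unit B.Units_inv_closed by blast

lemma Xd_scalar_commute:
  assumes g: "g \<in> carrier B" and k: "\<And>k. k \<in> I \<Longrightarrow> \<exists>c. Xb k k \<star> g = c \<odot>\<^bsub>B\<^esub> (g \<star> Xb k k)"
    and w: "set w \<subseteq> I"
  shows "\<exists>c. Xd w \<star> g = c \<odot>\<^bsub>B\<^esub> (g \<star> Xd w)"
  using w
proof (induction w)
  case Nil
  then show ?case using g by (intro exI[of _ 1]) simp
next
  case (Cons a w)
  then obtain c where c: "Xd w \<star> g = c \<odot>\<^bsub>B\<^esub> (g \<star> Xd w)" by auto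
  obtain d where d: "Xb a a \<star> g = d \<odot>\<^bsub>B\<^esub> (g \<star> Xb a a)" using k[of a] Cons by auto
  have [simp]: "a \<in> I" "Xd w \<in> carrier B" using Cons by auto
  have "Xd (a # w) \<star> g = c \<odot>\<^bsub>B\<^esub> ((Xb a a \<star> g) \<star> Xd w)"
    using g by (simp add: B.m_assoc c B.smult_mult_r)
  also have "\<dots> = (c * d) \<odot>\<^bsub>B\<^esub> (g \<star> Xd (a # w))"
    using g by (simp add: d B.m_assoc B.smult_mult_l B.smult_assoc)
  finally show ?case by blast
qed

text \<open>Two shapes are allowed because the generators of \<open>OqN'\<close> split off a
  diagonal factor on the right and those of \<open>OqN\<close> on the left. The commutation clause
  lets \<open>g\<close> pass any diagonal monomial.\<close>

abbreviation diag_factor where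
  "diag_factor N i j \<equiv> \<exists>g\<in>N. (Xb i j = g \<star> Xb j j \<or> Xb i j = Xb i i \<star> g) \<and>
      (\<forall>k\<in>I. \<exists>c. Xb k k \<star> g = c \<odot>\<^bsub>B\<^esub> (g \<star> Xb k k))"

text \<open>Letters are appended on the right. A diagonal letter extends \<open>v\<close>; for any
  other letter the factor \<open>g\<close> moves left past the diagonal monomial at the price of a
  scalar, and both are absorbed into \<open>a\<close>.\<close>

lemma eval_word_normal_form:
  assumes N: "is_subalg B N"
    and gens: "\<And>i j. i \<in> I \<Longrightarrow> j \<in> I \<Longrightarrow> i \<noteq> j \<Longrightarrow> diag_factor N i j"
    and w: "w \<in> lists (I \<times> I)"
  shows "\<exists>a\<in>N. \<exists>v. set v \<subseteq> I \<and> eval_word B Xb w = a \<star> Xd v"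
proof -
  have N': "subring N B" and Nsm: "a \<in> N \<Longrightarrow> c \<odot>\<^bsub>B\<^esub> a \<in> N" for a c using N by (auto simp: is_subalg_def)
  note NE = subringE[OF N']
  show ?thesis using w
  proof (induction w rule: rev_induct)
    case Nil
    show ?case by (rule bexI[of _ "\<one>\<^bsub>B\<^esub>"], rule exI[of _ "[]"]) (use NE in auto)
  next
    case (snoc p w)
    obtain i j where p: "p = (i, j)" by fastforce
    have ij [simp]: "i \<in> I" "j \<in> I" using snoc p by auto
    obtain a v where a: "a \<in> N" and v: "set v \<subseteq> I" and eq: "eval_word B Xb w = a \<star> Xd v" using snoc by auto
    have ac [simp]: "a \<in> carrier B" "Xd v \<in> carrier B" using a NE(1) v by auto
    have ew: "eval_word B Xb (w @ [p]) = a \<star> Xd v \<star> Xb i j"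
      using snoc by (subst B.eval_word_append[of I]) (auto simp: p eq)
    have Xd_snoc: "Xd (v @ [k]) = Xd v \<star> Xb k k" if "k \<in> I" for k using v that by (simp add: Xd_append)
    show ?case
    proof (cases "i = j")
      case True
      show ?thesis
        by (rule bexI[OF _ a], rule exI[of _ "v @ [i]"]) (use v ew True Xd_snoc in \<open>auto simp: B.m_assoc\<close>)
    next
      case False
      then obtain g where g: "g \<in> N" "Xb i j = g \<star> Xb j j \<or> Xb i j = Xb i i \<star> g"
        and comm: "\<And>k. k \<in> I \<Longrightarrow> \<exists>c. Xb k k \<star> g = c \<odot>\<^bsub>B\<^esub> (g \<star> Xb k k)"
        using gens[of i j] by auto
      have gc [simp]: "g \<in> carrier B" using g NE(1) by auto
      have "\<exists>u c. set u \<subseteq> I \<and> Xd v \<star> Xb i j = c \<odot>\<^bsub>B\<^esub> (g \<star> Xd u)"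
        using g(2)
      proof
        assume e: "Xb i j = g \<star> Xb j j"
        obtain c where "Xd v \<star> g = c \<odot>\<^bsub>B\<^esub> (g \<star> Xd v)"
          using Xd_scalar_commute[OF gc comm v] by blast
        then have "Xd v \<star> Xb i j = c \<odot>\<^bsub>B\<^esub> (g \<star> Xd (v @ [j]))"
          by (simp add: e Xd_snoc B.m_assoc[symmetric] B.smult_mult_l)
        then show ?thesis using v ij by (intro exI[of _ "v @ [j]"] exI[of _ c]) simp
      next
        assume e: "Xb i j = Xb i i \<star> g"
        have v': "set (v @ [i]) \<subseteq> I" using v by simp
        obtain c where "Xd (v @ [i]) \<star> g = c \<odot>\<^bsub>B\<^esub> (g \<star> Xd (v @ [i]))"
          using Xd_scalar_commute[OF gc comm v'] by blast
        then have "Xd v \<star> Xb i j = c \<odot>\<^bsub>B\<^esub> (g \<star> Xd (v @ [i]))"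
          by (simp add: e Xd_snoc B.m_assoc)
        then show ?thesis using v' by (intro exI[of _ "v @ [i]"] exI[of _ c]) simp
      qed
      then obtain u c where u: "set u \<subseteq> I" "Xd v \<star> Xb i j = c \<odot>\<^bsub>B\<^esub> (g \<star> Xd u)" by blast
      have uc: "Xd u \<in> carrier B" using u by simp
      have "eval_word B Xb (w @ [p]) = (c \<odot>\<^bsub>B\<^esub> (a \<star> g)) \<star> Xd u"
        using u(2) uc by (simp add: ew B.m_assoc B.smult_mult_r B.smult_mult_l)
      moreover have "c \<odot>\<^bsub>B\<^esub> (a \<star> g) \<in> N" using a g NE Nsm by auto
      ultimately show ?thesis using u(1) by blast
    qed
  qed
qed

text \<open>\<open>B\<close> is a quotient of the free algebra in two steps, so it is spanned by the
  values of words.\<close>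

lemma B_induct [consumes 1, case_names zero add smult word]:
  assumes x: "x \<in> carrier B"
    and zero: "Q \<zero>\<^bsub>B\<^esub>"
    and add: "\<And>x y. x \<in> carrier B \<Longrightarrow> y \<in> carrier B \<Longrightarrow> Q x \<Longrightarrow> Q y \<Longrightarrow> Q (x \<oplus>\<^bsub>B\<^esub> y)"
    and smult: "\<And>c x. x \<in> carrier B \<Longrightarrow> Q x \<Longrightarrow> Q (c \<odot>\<^bsub>B\<^esub> x)"
    and word: "\<And>w. w \<in> lists (I \<times> I) \<Longrightarrow> Q (eval_word B Xb w)"
  shows "Q x"
proof -
  define h where "h = projB n q s \<circ> projSL"
  have h: "h \<in> alg_hom F B" unfolding h_def by (rule alg_hom_comp[OF projB_hom projSL_hom])
  obtain y where y: "y \<in> carrier A" "x = projB n q s y"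
    using x BI.coset_surj unfolding B_eq projB_eq by blast
  then obtain f where f: "f \<in> carrier F" "x = h f" using projSL_surj by (auto simp: h_def)
  have hX: "h (free_gen (i, j)) = Xb i j" for i j by (simp add: h_def projSL_X XB_def)
  have hw: "h (single w 1) = eval_word B Xb w" if "w \<in> lists (I \<times> I)" for w
    unfolding single_eval_word using that
    by (subst alg_hom_eval_word[OF F.kalgebra_axioms h]) (auto simp: hX)
  have "Q (h f)"
    using f(1)[unfolded F_car, simplified]
  proof (induction f rule: keys_induct[where S = "lists (I \<times> I)"])
    case zero
    then show ?case using \<open>Q \<zero>\<^bsub>B\<^esub>\<close> lin_map_zero[OF F.kalgebra_axioms B.kalgebra_axioms alg_hom_lin_map[OF h]]
      by (simp add: F_eq)
  next
    case (single a c)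
    then have c: "single a 1 \<in> carrier F" by (simp add: F_car)
    have "single a c = c \<odot>\<^bsub>F\<^esub> single a 1" by (simp add: F_eq)
    then have "h (single a c) = c \<odot>\<^bsub>B\<^esub> eval_word B Xb a"
      using c hw[OF single] by (simp add: alg_hom_smult[OF h])
    then show ?case using smult[OF _ word[OF single]] B.eval_word_closed[of I Xb a] single by simp
  next
    case (add f g)
    then have fg: "f \<in> carrier F" "g \<in> carrier F" by (simp_all add: F_car)
    then have "h (f + g) = h f \<oplus>\<^bsub>B\<^esub> h g" using alg_hom_add[OF h, of f g] by (simp add: F_eq)
    then show ?case using assms(3) alg_hom_closed[OF h] fg add by simp
  qed
  then show ?thesis using f by simp
qed

text \<open>On a normal form \<open>P\<close> is zero, or \<open>v\<close> is balanced and the value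
  is \<open>a\<close> itself because \<open>Xd v\<close> is \<open>1\<close>. Since words span
  \<open>B\<close>, linearity extends this to all of it.\<close>

lemma lin_map_into_subalg:
  assumes N: "is_subalg B N"
    and gens: "\<And>i j. i \<in> I \<Longrightarrow> j \<in> I \<Longrightarrow> i \<noteq> j \<Longrightarrow> diag_factor N i j"
    and P: "P \<in> lin_map B B"
    and PN: "\<And>a v. a \<in> N \<Longrightarrow> set v \<subseteq> I \<Longrightarrow>
      P (a \<star> Xd v) = (if balanced I (zip v v) then 1 else 0) \<odot>\<^bsub>B\<^esub> (a \<star> Xd v)"
    and x: "x \<in> carrier B"
  shows "P x \<in> N"
proof -
  have N': "subring N B" and Nsm: "a \<in> N \<Longrightarrow> c \<odot>\<^bsub>B\<^esub> a \<in> N" for a c using N by (auto simp: is_subalg_def)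
  note NE = subringE[OF N']
  show ?thesis using x
  proof (induction x rule: B_induct)
    case zero
    then show ?case using NE lin_map_zero[OF B.kalgebra_axioms B.kalgebra_axioms P] by simp
  next
    case (add x y)
    then show ?case using NE lin_map_add[OF P] by simp
  next
    case (smult c x)
    then show ?case using Nsm lin_map_smult[OF P] by simp
  next
    case (word w)
    obtain a v where a: "a \<in> N" "set v \<subseteq> I" and eq: "eval_word B Xb w = a \<star> Xd v"
      using eval_word_normal_form[OF N gens word] by blast
    have "a \<in> carrier B" using a NE(1) by blast
    then show ?case using PN[OF a] Xd_balanced[of v] a NE(2) by (auto simp: eq)
  qed
qed

text \<open>The torus monomial belonging to \<open>Xd v\<close>, written as the image of a word in
  the free algebra because \<open>torus_functional\<close> is stated for such images.\<close>

definition Yd :: "nat list \<Rightarrow> ((nat \<times> nat) list \<Rightarrow>\<^sub>0 'k) set set" where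
  "Yd v = projT (projSL (single (zip v v) 1))"

lemma Yd_Nil: "Yd [] = \<one>\<^bsub>T\<^esub>"
  using alg_hom_one[OF projSL_hom] alg_hom_one[OF projT_hom] by (simp add: Yd_def flip: F_one)

lemma Yd_closed [simp]: "set v \<subseteq> I \<Longrightarrow> Yd v \<in> carrier T"
  unfolding Yd_def
  by (intro alg_hom_closed[OF projT_hom] alg_hom_closed[OF projSL_hom])
     (auto simp: F_car dest: set_zip_leftD set_zip_rightD)

lemma Yd_Cons: "i \<in> I \<Longrightarrow> set v \<subseteq> I \<Longrightarrow> Yd (i # v) = YT n q i \<otimes>\<^bsub>T\<^esub> Yd v"
proof -
  assume i: "i \<in> I" and v: "set v \<subseteq> I"
  have c: "single (zip v v) 1 \<in> carrier F"
    using v by (auto simp: F_car dest: set_zip_leftD set_zip_rightD)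
  have "single (zip (i # v) (i # v)) 1 = free_gen (i, i) \<otimes>\<^bsub>F\<^esub> single (zip v v) 1"
    by (simp add: free_gen_def F_single_mult)
  then show ?thesis
    using i c alg_hom_closed[OF projSL_hom c]
    by (simp add: alg_hom_mult[OF projSL_hom] alg_hom_mult[OF projT_hom] projSL_X YT_def Yd_def)
qed

end


section \<open>Coinvariants\<close>

text \<open>Coinvariants are the equalizer of the coaction and the embedding with \<open>1\<close>
  in the torus factor, and both are algebra homomorphisms.\<close>

lemma equalizer_subalg:
  assumes "kalgebra A" "kalgebra C" "g \<in> alg_hom A C" "h \<in> alg_hom A C"
  shows "is_subalg A {x \<in> carrier A. g x = h x}"
proof -
  interpret A: kalgebra A by fact
  interpret C: kalgebra C by fact
  have minus: "f (\<ominus>\<^bsub>A\<^esub> x) = \<ominus>\<^bsub>C\<^esub> f x" if "f \<in> alg_hom A C" "x \<in> carrier A" for f x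
    using alg_hom_smult[OF that, of "- 1"] that(2) alg_hom_closed[OF that]
    by (simp add: A.smult_minus_left C.smult_minus_left)
  note hs = alg_hom_mult[OF assms(3)] alg_hom_mult[OF assms(4)] alg_hom_add[OF assms(3)] alg_hom_add[OF assms(4)]
    alg_hom_one[OF assms(3)] alg_hom_one[OF assms(4)] alg_hom_smult[OF assms(3)] alg_hom_smult[OF assms(4)]
    minus[OF assms(3)] minus[OF assms(4)]
  show ?thesis unfolding is_subalg_def
    by (intro conjI A.subringI) (auto simp: hs)
qed

lemma gen_subalg_props:
  assumes "kalgebra A" "G \<subseteq> carrier A"
  shows "is_subalg A (gen_subalg A G)" "G \<subseteq> gen_subalg A G"
    and "is_subalg A S \<Longrightarrow> G \<subseteq> S \<Longrightarrow> gen_subalg A G \<subseteq> S"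
proof -
  interpret A: kalgebra A by fact
  have "is_subalg A (carrier A)" by (simp add: is_subalg_def A.carrier_is_subring)
  \<comment> \<open>The intersection is taken over a nonempty family, which is what confines it to
    the carrier.\<close>
  then have ne: "{S. is_subalg A S \<and> G \<subseteq> S} \<noteq> {}" using assms(2) by blast
  have "subring (gen_subalg A G) A" unfolding gen_subalg_def
    using ne by (intro A.subring_Inter) (auto simp: is_subalg_def)
  then show "is_subalg A (gen_subalg A G)" unfolding is_subalg_def
    by (auto simp: gen_subalg_def is_subalg_def)
  show "G \<subseteq> gen_subalg A G" "is_subalg A S \<Longrightarrow> G \<subseteq> S \<Longrightarrow> gen_subalg A G \<subseteq> S"
    by (auto simp: gen_subalg_def)
qed

context quantum_borel
begin

text \<open>For either sign, the surviving off-diagonal positions are the transposes of the killed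
  ones; this merges the two cases of the definition.\<close>

lemma OqN'_gens_eq:
  "OqN'_gens n q s = {Xb i j \<star> inv\<^bsub>B\<^esub> Xb j j | i j. i \<in> I \<and> j \<in> I \<and> zero_pos s j i}"
  by (cases s) (fastforce simp: Let_def simp flip: I_def)+

lemma OqN_gens_eq:
  "OqN_gens n q s = {inv\<^bsub>B\<^esub> Xb i i \<star> Xb i j | i j. i \<in> I \<and> j \<in> I \<and> zero_pos s j i}"
  by (cases s) (fastforce simp: Let_def simp flip: I_def)+

lemma OqN'_gens_closed: "OqN'_gens n q s \<subseteq> carrier B"
  unfolding OqN'_gens_eq by auto

lemma OqN_gens_closed: "OqN_gens n q s \<subseteq> carrier B"
  unfolding OqN_gens_eq by auto

lemma zero_pos_cases: "i \<noteq> j \<Longrightarrow> zero_pos s i j \<or> zero_pos s j i"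
  by (cases s) auto

lemma scalar_commute_mult:
  assumes "Xb k k \<star> u = c \<odot>\<^bsub>B\<^esub> (u \<star> Xb k k)" "Xb k k \<star> v = d \<odot>\<^bsub>B\<^esub> (v \<star> Xb k k)"
    and [simp]: "k \<in> I" "u \<in> carrier B" "v \<in> carrier B"
  shows "Xb k k \<star> (u \<star> v) = (c * d) \<odot>\<^bsub>B\<^esub> ((u \<star> v) \<star> Xb k k)"
proof -
  have "Xb k k \<star> (u \<star> v) = c \<odot>\<^bsub>B\<^esub> (u \<star> (Xb k k \<star> v))"
    by (simp add: B.m_assoc[symmetric] assms(1) B.smult_mult_l)
  then show ?thesis by (simp add: assms(2) B.smult_mult_r B.smult_assoc B.m_assoc)
qed

lemma inv_diag_scalar_commute:
  assumes "k \<in> I" "j \<in> I"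
  shows "Xb k k \<star> inv\<^bsub>B\<^esub> Xb j j = 1 \<odot>\<^bsub>B\<^esub> (inv\<^bsub>B\<^esub> Xb j j \<star> Xb k k)"
proof -
  have "inv\<^bsub>B\<^esub> Xb j j \<star> Xb k k = Xb k k \<star> inv\<^bsub>B\<^esub> Xb j j"
    by (rule B.commute_inv) (use assms in \<open>auto simp: diag_unit diag_commute[of j k]\<close>)
  then show ?thesis using assms by simp
qed

text \<open>At a surviving position \<open>g\<close> is a generator; at a killed one it is zero and
  lies in every subring. Both of its factors commute with the diagonal generators up to
  scalars.\<close>

lemma OqN'_gen_factor:
  assumes ij: "i \<in> I" "j \<in> I" "i \<noteq> j"
  shows "diag_factor (OqN' n q s) i j"
proof -
  have sub: "subring (OqN' n q s) B" and gen: "OqN'_gens n q s \<subseteq> OqN' n q s"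
    using gen_subalg_props[OF B.kalgebra_axioms OqN'_gens_closed] by (auto simp: OqN'_def is_subalg_def)
  define g where "g = Xb i j \<star> inv\<^bsub>B\<^esub> Xb j j"
  have "g \<in> OqN' n q s"
  proof (cases "zero_pos s i j")
    case True
    then show ?thesis using ij subringE(2)[OF sub] by (simp add: g_def X_zero)
  next
    case False
    then have "g \<in> OqN'_gens n q s" unfolding OqN'_gens_eq g_def using ij zero_pos_cases by blast
    then show ?thesis using gen by blast
  qed
  moreover have "Xb i j = g \<star> Xb j j"
    using ij diag_unit[of j] by (simp add: g_def B.m_assoc)
  moreover have "\<exists>c. Xb k k \<star> g = c \<odot>\<^bsub>B\<^esub> (g \<star> Xb k k)" if k: "k \<in> I" for k
    using scalar_commute_mult[OF _ inv_diag_scalar_commute[OF k ij(2)], of "Xb i j"] diag_scalar_commute[OF k ij(1,2)]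
      k ij by (auto simp: g_def)
  ultimately show ?thesis by blast
qed

lemma OqN_gen_factor:
  assumes ij: "i \<in> I" "j \<in> I" "i \<noteq> j"
  shows "diag_factor (OqN n q s) i j"
proof -
  have sub: "subring (OqN n q s) B" and gen: "OqN_gens n q s \<subseteq> OqN n q s"
    using gen_subalg_props[OF B.kalgebra_axioms OqN_gens_closed] by (auto simp: OqN_def is_subalg_def)
  define g where "g = inv\<^bsub>B\<^esub> Xb i i \<star> Xb i j"
  have "g \<in> OqN n q s"
  proof (cases "zero_pos s i j")
    case True
    then show ?thesis using ij subringE(2)[OF sub] by (simp add: g_def X_zero)
  next
    case False
    then have "g \<in> OqN_gens n q s" unfolding OqN_gens_eq g_def using ij zero_pos_cases by blast
    then show ?thesis using gen by blast
  qed
  moreover have "Xb i j = Xb i i \<star> g"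
    using ij diag_unit[of i] by (simp add: g_def B.m_assoc[symmetric])
  moreover have "\<exists>c. Xb k k \<star> g = c \<odot>\<^bsub>B\<^esub> (g \<star> Xb k k)" if k: "k \<in> I" for k
    using scalar_commute_mult[OF inv_diag_scalar_commute[OF k ij(1)], of "Xb i j"] diag_scalar_commute[OF k ij(1,2)]
      k ij by (auto simp: g_def)
  ultimately show ?thesis by blast
qed

text \<open>For a generator \<open>g\<close>, both \<open>eta g\<close> and
  \<open>g \<otimes> 1\<close> give \<open>eta (Xb i j)\<close> when multiplied on the right by
  \<open>eta (Xb j j)\<close>. The latter is a unit and can be cancelled.\<close>

lemma OqN'_subset_coinv: "OqN' n q s \<subseteq> coinv_eta n q s"
  unfolding OqN'_def
proof (rule gen_subalg_props(3)[OF B.kalgebra_axioms OqN'_gens_closed])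
  show "is_subalg B (coinv_eta n q s)"
    unfolding coinv_eta_def Let_def
    by (rule equalizer_subalg[OF B.kalgebra_axioms BT.T.kalgebra_axioms eta_hom BT.tens_left_alg_hom])
  show "OqN'_gens n q s \<subseteq> coinv_eta n q s"
  proof
    fix g assume "g \<in> OqN'_gens n q s"
    then obtain i j where ij [simp]: "i \<in> I" "j \<in> I" and g: "g = Xb i j \<star> inv\<^bsub>B\<^esub> Xb j j"
      unfolding OqN'_gens_eq by blast
    let ?e = "eta n q s" and ?C = "tensor_alg B T"
    have gc [simp]: "g \<in> carrier B" by (simp add: g)
    note e = alg_hom_closed[OF eta_hom] alg_hom_mult[OF eta_hom, symmetric]
    have gX: "g \<star> Xb j j = Xb i j" using diag_unit[of j] by (simp add: g B.m_assoc)
    have u: "?e (Xb j j) \<otimes>\<^bsub>?C\<^esub> ?e (inv\<^bsub>B\<^esub> Xb j j) = \<one>\<^bsub>?C\<^esub>"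
      using diag_unit[of j] by (simp add: e alg_hom_one[OF eta_hom])
    have "?e g \<otimes>\<^bsub>?C\<^esub> ?e (Xb j j) = tens B T g \<one>\<^bsub>T\<^esub> \<otimes>\<^bsub>?C\<^esub> ?e (Xb j j)"
      by (simp add: e gX) (simp add: eta_X BT.tens_mult gX)
    then have "(?e g \<otimes>\<^bsub>?C\<^esub> ?e (Xb j j)) \<otimes>\<^bsub>?C\<^esub> ?e (inv\<^bsub>B\<^esub> Xb j j) =
        (tens B T g \<one>\<^bsub>T\<^esub> \<otimes>\<^bsub>?C\<^esub> ?e (Xb j j)) \<otimes>\<^bsub>?C\<^esub> ?e (inv\<^bsub>B\<^esub> Xb j j)" by simp
    then have "?e g = tens B T g \<one>\<^bsub>T\<^esub>"
      using u by (simp add: BT.T.m_assoc alg_hom_closed[OF eta_hom])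
    then show "g \<in> coinv_eta n q s" by (simp add: coinv_eta_def Let_def)
  qed
qed

text \<open>The mirror image of the previous argument: the unit \<open>theta (Xb i i)\<close> is
  cancelled on the left.\<close>

lemma OqN_subset_coinv: "OqN n q s \<subseteq> coinv_theta n q s"
  unfolding OqN_def
proof (rule gen_subalg_props(3)[OF B.kalgebra_axioms OqN_gens_closed])
  show "is_subalg B (coinv_theta n q s)"
    unfolding coinv_theta_def Let_def
    by (rule equalizer_subalg[OF B.kalgebra_axioms TB.T.kalgebra_axioms theta_hom TB.tens_right_alg_hom])
  show "OqN_gens n q s \<subseteq> coinv_theta n q s"
  proof
    fix g assume "g \<in> OqN_gens n q s"
    then obtain i j where ij [simp]: "i \<in> I" "j \<in> I" and g: "g = inv\<^bsub>B\<^esub> Xb i i \<star> Xb i j"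
      unfolding OqN_gens_eq by blast
    let ?e = "theta n q s" and ?C = "tensor_alg T B"
    have gc [simp]: "g \<in> carrier B" by (simp add: g)
    note e = alg_hom_closed[OF theta_hom] alg_hom_mult[OF theta_hom, symmetric]
    have gX: "Xb i i \<star> g = Xb i j" using diag_unit[of i] by (simp add: g B.m_assoc[symmetric])
    have u: "?e (inv\<^bsub>B\<^esub> Xb i i) \<otimes>\<^bsub>?C\<^esub> ?e (Xb i i) = \<one>\<^bsub>?C\<^esub>"
      using diag_unit[of i] by (simp add: e alg_hom_one[OF theta_hom])
    have "?e (Xb i i) \<otimes>\<^bsub>?C\<^esub> ?e g = ?e (Xb i i) \<otimes>\<^bsub>?C\<^esub> tens T B \<one>\<^bsub>T\<^esub> g"
      by (simp add: e gX) (simp add: theta_X TB.tens_mult gX)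
    then have "?e (inv\<^bsub>B\<^esub> Xb i i) \<otimes>\<^bsub>?C\<^esub> (?e (Xb i i) \<otimes>\<^bsub>?C\<^esub> ?e g) =
        ?e (inv\<^bsub>B\<^esub> Xb i i) \<otimes>\<^bsub>?C\<^esub> (?e (Xb i i) \<otimes>\<^bsub>?C\<^esub> tens T B \<one>\<^bsub>T\<^esub> g)" by simp
    then have "?e g = tens T B \<one>\<^bsub>T\<^esub> g"
      using u by (simp add: TB.T.m_assoc[symmetric] alg_hom_closed[OF theta_hom])
    then show "g \<in> coinv_theta n q s" by (simp add: coinv_theta_def Let_def)
  qed
qed

text \<open>Both coactions have the form \<open>e\<close> below, with \<open>\<tau> b t\<close> standing for \<open>b \<otimes> t\<close> or \<open>t \<otimes> b\<close>.\<close>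

lemma coinvariant_mem:
  assumes e: "e \<in> alg_hom B C"
    and \<tau>_mult: "\<And>b t b' t'. b \<in> carrier B \<Longrightarrow> t \<in> carrier T \<Longrightarrow> b' \<in> carrier B \<Longrightarrow> t' \<in> carrier T \<Longrightarrow>
      \<tau> b t \<otimes>\<^bsub>C\<^esub> \<tau> b' t' = \<tau> (b \<star> b') (t \<otimes>\<^bsub>T\<^esub> t')"
    and \<tau>_one: "\<tau> \<one>\<^bsub>B\<^esub> \<one>\<^bsub>T\<^esub> = \<one>\<^bsub>C\<^esub>"
    and e_diag: "\<And>i. i \<in> I \<Longrightarrow> e (Xb i i) = \<tau> (Xb i i) (YT n q i)"
    and functional: "\<And>f. f \<in> lin_map T field_alg \<Longrightarrow>
      \<exists>H\<in>lin_map C B. \<forall>b\<in>carrier B. \<forall>t\<in>carrier T. H (\<tau> b t) = f t \<odot>\<^bsub>B\<^esub> b"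
    and N: "is_subalg B N"
    and gens: "\<And>i j. i \<in> I \<Longrightarrow> j \<in> I \<Longrightarrow> i \<noteq> j \<Longrightarrow> diag_factor N i j"
    and N_coinv: "\<And>a. a \<in> N \<Longrightarrow> a \<in> carrier B \<and> e a = \<tau> a \<one>\<^bsub>T\<^esub>"
    and x: "x \<in> carrier B" "e x = \<tau> x \<one>\<^bsub>T\<^esub>"
  shows "x \<in> N"
proof -
  obtain f where f: "f \<in> lin_map T field_alg"
    and fY: "\<And>w. w \<in> lists (I \<times> I) \<Longrightarrow> f (projT (projSL (single w 1))) = (if balanced I w then 1 else 0)"
    using torus_functional by blast
  have fYd: "f (Yd v) = (if balanced I (zip v v) then 1 else 0)" if "set v \<subseteq> I" for v
    unfolding Yd_def using that by (intro fY) (auto dest: set_zip_leftD set_zip_rightD)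
  obtain H where H: "H \<in> lin_map C B"
    and H\<tau>: "\<And>b t. b \<in> carrier B \<Longrightarrow> t \<in> carrier T \<Longrightarrow> H (\<tau> b t) = f t \<odot>\<^bsub>B\<^esub> b"
    using functional[OF f] by blast
  have e_Xd: "e (Xd v) = \<tau> (Xd v) (Yd v)" if "set v \<subseteq> I" for v
    using that
  proof (induction v)
    case Nil
    show ?case using alg_hom_one[OF e] by (simp add: Yd_Nil \<tau>_one)
  next
    case (Cons i v)
    then show ?case by (simp add: alg_hom_mult[OF e] e_diag \<tau>_mult Yd_Cons)
  qed
  define P where "P = H \<circ> e"
  have P: "P \<in> lin_map B B" unfolding P_def by (rule lin_map_comp[OF H alg_hom_lin_map[OF e]])
  have "P x \<in> N"
  proof (rule lin_map_into_subalg[OF N gens P _ x(1)])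
    fix a v assume a: "a \<in> N" and v: "set v \<subseteq> I"
    then have "e (a \<star> Xd v) = \<tau> (a \<star> Xd v) (Yd v)"
      using N_coinv[OF a] by (simp add: alg_hom_mult[OF e] e_Xd \<tau>_mult)
    then show "P (a \<star> Xd v) = (if balanced I (zip v v) then 1 else 0) \<odot>\<^bsub>B\<^esub> (a \<star> Xd v)"
      using N_coinv[OF a] v by (simp add: P_def H\<tau> fYd)
  qed
  \<comment> \<open>The empty word is balanced, so \<open>f\<close> takes the value \<open>1\<close>
    at the unit of the torus and the contraction returns \<open>x\<close>.\<close>
  moreover have "P x = x"
    using x fYd[of "[]"] by (simp add: P_def H\<tau> Yd_Nil balanced_def)
  ultimately show ?thesis by simp
qed

text \<open>What \<open>coinvariant_mem\<close> still requires is the contraction of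
  \<open>b \<otimes> t\<close> to \<open>f t\<close> times \<open>b\<close>. It is bilinear, so
  \<open>bilinear_descend\<close> provides it.\<close>

lemma coinv_subset_OqN': "coinv_eta n q s \<subseteq> OqN' n q s"
proof
  fix x assume "x \<in> coinv_eta n q s"
  then have x: "x \<in> carrier B" "eta n q s x = tens B T x \<one>\<^bsub>T\<^esub>" by (auto simp: coinv_eta_def Let_def)
  show "x \<in> OqN' n q s"
  proof (rule coinvariant_mem[OF eta_hom, where \<tau> = "tens B T"])
    fix f assume f: "f \<in> lin_map T field_alg"
    have "BT.bilinear B (\<lambda>b t. f t \<odot>\<^bsub>B\<^esub> b)"
      unfolding BT.bilinear_def using lin_map_add[OF f] lin_map_smult[OF f]
      by (auto intro!: lin_mapI simp: B.smult_l_distr B.smult_r_distr B.smult_assoc mult.commute)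
    then show "\<exists>H\<in>lin_map (tensor_alg B T) B. \<forall>b\<in>carrier B. \<forall>t\<in>carrier T. H (tens B T b t) = f t \<odot>\<^bsub>B\<^esub> b"
      by (rule BT.bilinear_descend[OF B.kalgebra_axioms])
  next
    show "is_subalg B (OqN' n q s)"
      unfolding OqN'_def by (rule gen_subalg_props(1)[OF B.kalgebra_axioms OqN'_gens_closed])
  next
    fix a assume "a \<in> OqN' n q s"
    then show "a \<in> carrier B \<and> eta n q s a = tens B T a \<one>\<^bsub>T\<^esub>"
      using OqN'_subset_coinv by (auto simp: coinv_eta_def Let_def)
  qed (rule OqN'_gen_factor | simp add: BT.tens_mult BT.tens_one eta_X x)+
qed

lemma coinv_subset_OqN: "coinv_theta n q s \<subseteq> OqN n q s"
proof
  fix x assume "x \<in> coinv_theta n q s"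
  then have x: "x \<in> carrier B" "theta n q s x = tens T B \<one>\<^bsub>T\<^esub> x" by (auto simp: coinv_theta_def Let_def)
  show "x \<in> OqN n q s"
  proof (rule coinvariant_mem[OF theta_hom, where \<tau> = "\<lambda>b t. tens T B t b"])
    fix f assume f: "f \<in> lin_map T field_alg"
    have bil: "TB.bilinear B (\<lambda>t b. f t \<odot>\<^bsub>B\<^esub> b)"
      unfolding TB.bilinear_def using lin_map_add[OF f] lin_map_smult[OF f]
      by (auto intro!: lin_mapI simp: B.smult_l_distr B.smult_r_distr B.smult_assoc mult.commute)
    then show "\<exists>H\<in>lin_map (tensor_alg T B) B. \<forall>b\<in>carrier B. \<forall>t\<in>carrier T. H (tens T B t b) = f t \<odot>\<^bsub>B\<^esub> b"
      using TB.bilinear_descend[OF B.kalgebra_axioms bil] by blast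
  next
    show "is_subalg B (OqN n q s)"
      unfolding OqN_def by (rule gen_subalg_props(1)[OF B.kalgebra_axioms OqN_gens_closed])
  next
    fix a assume "a \<in> OqN n q s"
    then show "a \<in> carrier B \<and> theta n q s a = tens T B \<one>\<^bsub>T\<^esub> a"
      using OqN_subset_coinv by (auto simp: coinv_theta_def Let_def)
  qed (rule OqN_gen_factor | simp add: TB.tens_mult TB.tens_one theta_X x)+
qed

end

theorem theorem4:
  fixes q :: "'k::field" and n :: nat and s :: pm
  assumes "n \<ge> 1"
    and "q \<noteq> 0"
    and "\<And>m::nat. m \<ge> 1 \<Longrightarrow> q ^ m \<noteq> 1"
  shows "OqN' n q s = coinv_eta n q s \<and> OqN n q s = coinv_theta n q s"
proof -
  interpret quantum_borel n q "idx n" s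
    by unfold_locales (use assms in auto)
  show ?thesis
    using OqN'_subset_coinv coinv_subset_OqN' OqN_subset_coinv coinv_subset_OqN by blast
qed

end
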